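(* Let $(\mathcal{T}_h^1,\mathcal{T}_h^2)_h$ be a shape regular family of meshes of $\Omega_1,\Omega_2$, and let $V_h$, $\varLambda_h$ (with polynomial degrees $k\ge 1$, $l\ge 0$), the stabilized bilinear form $\mathcal{B}_h$ with stabilization parameter $\alpha>0$, and the mesh-dependent norm $|||(\cdot,\cdot)|||_h$ be as defined in the context. For small enough $\alpha>0$ (i.e. for all $0<\alpha<\alpha_0$, with some $\alpha_0>0$ independent of $h$) there exists $C>0$, independent of $h$, such that for all $(\boldsymbol{w}_h,\boldsymbol{\xi}_h)\in V_h\times\varLambda_h$ $$\mathcal{B}_h(\boldsymbol{w}_h,\boldsymbol{\xi}_h;\boldsymbol{w}_h,-\boldsymbol{\xi}_h)\ \ge\ C\,|||(\boldsymbol{w}_h,\boldsymbol{\xi}_h)|||_h^2 .$$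
   Context: Domains. $\Omega\subset\mathbb{R}^d$, $d\in\{2,3\}$, is split into two (polygonal/polyhedral) subdomains $\Omega_1,\Omega_2$ with interface $\Gamma=\partial\Omega_1\cap\partial\Omega_2$. For $i=1,2$ the boundary $\partial\Omega_i$ is split into a Dirichlet part $\Gamma_{D,i}$ (of positive measure), a Neumann part $\Gamma_{N,i}$ and $\Gamma$; $\Gamma_{D,i}$ and $\Gamma$ are separated by $\Gamma_{N,i}$ (they do not touch). Elasticity. $\boldsymbol{\varepsilon}(\boldsymbol{w})=\frac12(\nabla\boldsymbol{w}+\nabla\boldsymbol{w}^T)$ and $\boldsymbol{\sigma}(\boldsymbol{w})=\frac{E}{1+\nu}\boldsymbol{\varepsilon}(\boldsymbol{w})+\frac{E\nu}{(1+\nu)(1-2\nu)}\,\mathrm{tr}\,\boldsymbol{\varepsilon}(\boldsymbol{w})\,\boldsymbol{I}$, with Young's modulus $E>0$ and Poisson ratio $\nu\in(-1,1/2)$. Spaces. $V_i=\{\boldsymbol{w}\in H^1(\Omega_i)^d:\boldsymbol{w}|_{\Gamma_{D,i}}=0\}$, $V=V_1\times V_2$, $\varLambda=(H^{1/2}(\Gamma)^d)'$, where $H^{1/2}(\Gamma)$ is the space of traces on $\Gamma$ of $H^1$ functions. $\langle\cdot,\cdot\rangle$ is the duality pairing of $\varLambda$ and $H^{1/2}(\Gamma)^d$ (equal to the $L^2(\Gamma)$ inner product for $L^2$ multipliers), $(\cdot,\cdot)_A$ is the $L^2$ inner product over $A$, and $\|\cdot\|_{0,\Gamma}$ is the $L^2(\Gamma)$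 norm. For $\boldsymbol{w}=(\boldsymbol{w}_1,\boldsymbol{w}_2)\in V$ the jump is $[\![\boldsymbol{w}]\!]=\boldsymbol{w}_1-\boldsymbol{w}_2$ on $\Gamma$. Form. $\mathcal{B}(\boldsymbol{w},\boldsymbol{\xi};\boldsymbol{v},\boldsymbol{\mu})=\sum_{i=1}^2(\boldsymbol{\sigma}(\boldsymbol{w}_i),\boldsymbol{\varepsilon}(\boldsymbol{v}_i))_{\Omega_i}+\langle\boldsymbol{\mu},[\![\boldsymbol{w}]\!]\rangle+\langle\boldsymbol{\xi},[\![\boldsymbol{v}]\!]\rangle$. Discretization. $\mathcal{T}_h^i$ is a (simplicial, boundary-fitted) mesh of $\Omega_i$ with mesh parameter $h$; $\mathcal{G}_h$ is the set of edges/facets of $\mathcal{T}_h^1$ on $\Gamma$. The meshes $\mathcal{T}_h^1$ and $\mathcal{T}_h^2$ need not match on $\Gamma$. With $k\ge1$, $l\ge0$, $V_{h,i}=\{\boldsymbol{w}\in V_i:\boldsymbol{w}|_T\in\mathcal{P}_k(T)^d\ \forall T\in\mathcal{T}_h^i\}$, $V_h=V_{h,1}\times V_{h,2}$, $\varLambda_h=\{\boldsymbol{\xi}\in\varLambda:\boldsymbol{\xi}|_E\in\mathcal{P}_l(E)^d\ \forall E\in\mathcal{G}_h\}$ (piecewise polynomials, no continuity required), where $\mathcal{P}_m$ denotes polynomials of degree at most $m$. The function $h_\Gamma\in L^2(\Gamma)$ is defined by $h_\Gamma|_E=h_E$ (the diameter of $E$) for all $E\in\mathcal{G}_h$. Let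 $\boldsymbol{n}$ be the unit normal to $\Gamma$ pointing out of $\Omega_1$. For $(\boldsymbol{w}_h,\boldsymbol{\xi}_h),(\boldsymbol{v}_h,\boldsymbol{\mu}_h)\in V_h\times\varLambda_h$, with $\boldsymbol{w}_h=(\boldsymbol{w}_{1,h},\boldsymbol{w}_{2,h})$ and $\boldsymbol{v}_h=(\boldsymbol{v}_{1,h},\boldsymbol{v}_{2,h})$, $$\mathcal{B}_h(\boldsymbol{w}_h,\boldsymbol{\xi}_h;\boldsymbol{v}_h,\boldsymbol{\mu}_h)=\mathcal{B}(\boldsymbol{w}_h,\boldsymbol{\xi}_h;\boldsymbol{v}_h,\boldsymbol{\mu}_h)-\alpha\,\big(h_\Gamma(\boldsymbol{\xi}_h+\boldsymbol{\sigma}(\boldsymbol{w}_{1,h})\boldsymbol{n}),\ \boldsymbol{\mu}_h+\boldsymbol{\sigma}(\boldsymbol{v}_{1,h})\boldsymbol{n}\big)_\Gamma .$$ Norms. $|||\boldsymbol{w}|||^2=\sum_{i=1}^2(\boldsymbol{\sigma}(\boldsymbol{w}_i),\boldsymbol{\varepsilon}(\boldsymbol{w}_i))_{\Omega_i}$ and $|||(\boldsymbol{w},\boldsymbol{\xi})|||_h^2=|||\boldsymbol{w}|||^2+\|h_\Gamma^{1/2}\boldsymbol{\xi}\|_{0,\Gamma}^2$. "Independent of $h$" means uniform over the mesh family. *)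

theory Defs
  imports "HOL-Analysis.Analysis"
begin

type_synonym 'n vfield = "real^'n \<Rightarrow> real^'n"
type_synonym 'n mfield = "real^'n \<Rightarrow> real^'n^'n"

text \<open>Surface measure: the Hausdorff measure of dimension \<open>k \<ge> 1\<close> on the Borel sets, normalised
  to agree with \<open>k\<close>-dimensional Lebesgue measure on \<open>k\<close>-planes. The boundedness of the covering
  sets matters because \<^term>\<open>diameter\<close> is unspecified on unbounded sets.\<close>

definition hausdorff_pre :: "nat \<Rightarrow> real \<Rightarrow> 'a::metric_space set \<Rightarrow> ennreal" where
  "hausdorff_pre k \<delta> A =
     (INF C \<in> {C :: nat \<Rightarrow> 'a set. A \<subseteq> (\<Union>i. C i) \<and> (\<forall>i. bounded (C i) \<and> diameter (C i) \<le> \<delta>)}.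
        \<Sum>i. ennreal (unit_ball_vol (real k) * (diameter (C i) / 2) ^ k))"

definition hausdorff_measure :: "nat \<Rightarrow> 'a::metric_space measure" where
  "hausdorff_measure k =
     measure_of UNIV (sets borel) (\<lambda>A. SUP \<delta> \<in> {0<..}. hausdorff_pre k \<delta> A)"

definition surface_measure :: "(real^'n) measure" where
  "surface_measure = hausdorff_measure (CARD('n) - 1)"

definition surface_on :: "(real^'n) set \<Rightarrow> (real^'n) measure" where
  "surface_on A = restrict_space surface_measure A"


definition square_integrable :: "'a measure \<Rightarrow> ('a \<Rightarrow> 'b::euclidean_space) \<Rightarrow> bool" where
  "square_integrable M f \<longleftrightarrow> f \<in> borel_measurable M \<and> integrable M (\<lambda>x. (norm (f x))\<^sup>2)"

text \<open>On matrices, the inner product below is the Frobenius product.\<close>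

definition l2_inner :: "'a measure \<Rightarrow> ('a \<Rightarrow> 'b::euclidean_space) \<Rightarrow> ('a \<Rightarrow> 'b) \<Rightarrow> real" where
  "l2_inner M f g = (LINT x|M. f x \<bullet> g x)"

definition l2_norm :: "'a measure \<Rightarrow> ('a \<Rightarrow> 'b::euclidean_space) \<Rightarrow> real" where
  "l2_norm M f = sqrt (LINT x|M. (norm (f x))\<^sup>2)"


definition partial :: "(real^'n \<Rightarrow> real) \<Rightarrow> 'n \<Rightarrow> real^'n \<Rightarrow> real" where
  "partial f j x = frechet_derivative f (at x) (axis j 1)"

primrec Ck :: "nat \<Rightarrow> (real^'n \<Rightarrow> real) \<Rightarrow> bool" where
  "Ck 0 f \<longleftrightarrow> continuous_on UNIV f"
| "Ck (Suc m) f \<longleftrightarrow> (\<forall>x. f differentiable (at x)) \<and> (\<forall>j. Ck m (partial f j))"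

definition smooth :: "(real^'n \<Rightarrow> real) \<Rightarrow> bool" where
  "smooth f \<longleftrightarrow> (\<forall>m. Ck m f)"

definition test_function :: "(real^'n) set \<Rightarrow> (real^'n \<Rightarrow> real) \<Rightarrow> bool" where
  "test_function \<Omega> \<phi> \<longleftrightarrow> smooth \<phi> \<and> (\<exists>K. compact K \<and> K \<subseteq> \<Omega> \<and> (\<forall>x. x \<notin> K \<longrightarrow> \<phi> x = 0))"

text \<open>Members of Sobolev and trace spaces are represented by functions; membership and all
  integrals depend only on the class modulo null sets. Gradients follow the convention
  \<open>(\<nabla>w)\<^sub>i\<^sub>j = \<partial>\<^sub>j w\<^sub>i\<close>, as \<^term>\<open>jacobian\<close> does.\<close>

definition has_weak_grad :: "(real^'n) set \<Rightarrow> 'n vfield \<Rightarrow> 'n mfield \<Rightarrow> bool" where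
  "has_weak_grad \<Omega> w G \<longleftrightarrow>
     square_integrable (lebesgue_on \<Omega>) G \<and>
     (\<forall>\<phi> i j. test_function \<Omega> \<phi> \<longrightarrow>
        (LINT x|lebesgue_on \<Omega>. w x $ i * partial \<phi> j x) = - (LINT x|lebesgue_on \<Omega>. G x $ i $ j * \<phi> x))"

definition H1 :: "(real^'n) set \<Rightarrow> 'n vfield set" where
  "H1 \<Omega> = {w. square_integrable (lebesgue_on \<Omega>) w \<and> (\<exists>G. has_weak_grad \<Omega> w G)}"

definition weak_grad :: "(real^'n) set \<Rightarrow> 'n vfield \<Rightarrow> 'n mfield" where
  "weak_grad \<Omega> w = (SOME G. has_weak_grad \<Omega> w G)"

definition H1_norm :: "(real^'n) set \<Rightarrow> 'n vfield \<Rightarrow> real" where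
  "H1_norm \<Omega> w =
     sqrt ((l2_norm (lebesgue_on \<Omega>) w)\<^sup>2 + (l2_norm (lebesgue_on \<Omega>) (weak_grad \<Omega> w))\<^sup>2)"

text \<open>The trace on \<open>A \<subseteq> \<partial>\<Omega>\<close> is the continuous extension of the restriction map for functions
  smooth up to the boundary.\<close>

definition has_trace :: "(real^'n) set \<Rightarrow> (real^'n) set \<Rightarrow> 'n vfield \<Rightarrow> 'n vfield \<Rightarrow> bool" where
  "has_trace \<Omega> A w g \<longleftrightarrow>
     w \<in> H1 \<Omega> \<and> square_integrable (surface_on A) g \<and>
     (\<exists>\<phi> :: nat \<Rightarrow> 'n vfield.
        (\<forall>m i. smooth (\<lambda>x. \<phi> m x $ i)) \<and>
        (\<lambda>m. l2_norm (lebesgue_on \<Omega>) (\<lambda>x. \<phi> m x - w x)) \<longlonglongrightarrow> 0 \<and>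
        (\<lambda>m. l2_norm (lebesgue_on \<Omega>) (\<lambda>x. jacobian (\<phi> m) (at x) - weak_grad \<Omega> w x)) \<longlonglongrightarrow> 0 \<and>
        (\<lambda>m. l2_norm (surface_on A) (\<lambda>x. \<phi> m x - g x)) \<longlonglongrightarrow> 0)"

definition trace_on :: "(real^'n) set \<Rightarrow> (real^'n) set \<Rightarrow> 'n vfield \<Rightarrow> 'n vfield" where
  "trace_on \<Omega> A w = (SOME g. has_trace \<Omega> A w g)"

definition V_space :: "(real^'n) set \<Rightarrow> (real^'n) set \<Rightarrow> 'n vfield set" where
  "V_space \<Omega> \<Gamma>D = {w \<in> H1 \<Omega>. has_trace \<Omega> \<Gamma>D w (\<lambda>x. 0)}"

definition H_half :: "(real^'n) set \<Rightarrow> (real^'n) set \<Rightarrow> 'n vfield set" where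
  "H_half \<Omega> \<Gamma> = {g. \<exists>u \<in> H1 \<Omega>. has_trace \<Omega> \<Gamma> u g}"

definition H_half_norm :: "(real^'n) set \<Rightarrow> (real^'n) set \<Rightarrow> 'n vfield \<Rightarrow> real" where
  "H_half_norm \<Omega> \<Gamma> g = Inf {H1_norm \<Omega> u | u. u \<in> H1 \<Omega> \<and> has_trace \<Omega> \<Gamma> u g}"

definition Multipliers :: "(real^'n) set \<Rightarrow> (real^'n) set \<Rightarrow> ('n vfield \<Rightarrow> real) set" where
  "Multipliers \<Omega> \<Gamma> = {f.
     (\<forall>g \<in> H_half \<Omega> \<Gamma>. \<forall>g' \<in> H_half \<Omega> \<Gamma>. f (\<lambda>x. g x + g' x) = f g + f g') \<and>
     (\<forall>c. \<forall>g \<in> H_half \<Omega> \<Gamma>. f (\<lambda>x. c *\<^sub>R g x) = c * f g) \<and>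
     (\<exists>K. \<forall>g \<in> H_half \<Omega> \<Gamma>. \<bar>f g\<bar> \<le> K * H_half_norm \<Omega> \<Gamma> g)}"

definition L2_functional :: "(real^'n) set \<Rightarrow> 'n vfield \<Rightarrow> 'n vfield \<Rightarrow> real" where
  "L2_functional \<Gamma> \<xi> = (\<lambda>g. l2_inner (surface_on \<Gamma>) \<xi> g)"


definition strain :: "real^'n^'n \<Rightarrow> real^'n^'n" where
  "strain G = (1/2) *\<^sub>R (G + transpose G)"

definition stress :: "real \<Rightarrow> real \<Rightarrow> real^'n^'n \<Rightarrow> real^'n^'n" where
  "stress E \<nu> G = (E / (1 + \<nu>)) *\<^sub>R strain G
     + (E * \<nu> / ((1 + \<nu>) * (1 - 2 * \<nu>)) * trace (strain G)) *\<^sub>R mat 1"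

definition elastic_form ::
    "real \<Rightarrow> real \<Rightarrow> (real^'n) set \<Rightarrow> 'n vfield \<Rightarrow> 'n vfield \<Rightarrow> real" where
  "elastic_form E \<nu> \<Omega> w v =
     l2_inner (lebesgue_on \<Omega>)
       (\<lambda>x. stress E \<nu> (weak_grad \<Omega> w x)) (\<lambda>x. strain (weak_grad \<Omega> v x))"

definition interface :: "(real^'n) set \<Rightarrow> (real^'n) set \<Rightarrow> (real^'n) set" where
  "interface \<Omega>1 \<Omega>2 = frontier \<Omega>1 \<inter> frontier \<Omega>2"

definition jump ::
    "(real^'n) set \<Rightarrow> (real^'n) set \<Rightarrow> 'n vfield \<times> 'n vfield \<Rightarrow> 'n vfield" where
  "jump \<Omega>1 \<Omega>2 w = (\<lambda>x. trace_on \<Omega>1 (interface \<Omega>1 \<Omega>2) (fst w) x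
                      - trace_on \<Omega>2 (interface \<Omega>1 \<Omega>2) (snd w) x)"

text \<open>The continuous form takes its multipliers as functionals on traces.\<close>

definition B_form :: "real \<Rightarrow> real \<Rightarrow> (real^'n) set \<Rightarrow> (real^'n) set
    \<Rightarrow> 'n vfield \<times> 'n vfield \<Rightarrow> ('n vfield \<Rightarrow> real)
    \<Rightarrow> 'n vfield \<times> 'n vfield \<Rightarrow> ('n vfield \<Rightarrow> real) \<Rightarrow> real" where
  "B_form E \<nu> \<Omega>1 \<Omega>2 w \<xi> v \<mu> =
     elastic_form E \<nu> \<Omega>1 (fst w) (fst v) + elastic_form E \<nu> \<Omega>2 (snd w) (snd v)
     + \<mu> (jump \<Omega>1 \<Omega>2 w) + \<xi> (jump \<Omega>1 \<Omega>2 v)"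


definition polyhedral_domain :: "(real^'n) set \<Rightarrow> bool" where
  "polyhedral_domain \<Omega> \<longleftrightarrow>
     open \<Omega> \<and> connected \<Omega> \<and> \<Omega> \<noteq> {} \<and> \<Omega> = interior (closure \<Omega>) \<and>
     (\<exists>\<P>. finite \<P> \<and> (\<forall>P \<in> \<P>. polytope P) \<and> closure \<Omega> = \<Union>\<P>)"

definition split_domain :: "(real^'n) set \<Rightarrow> (real^'n) set \<Rightarrow> (real^'n) set \<Rightarrow> bool" where
  "split_domain \<Omega> \<Omega>1 \<Omega>2 \<longleftrightarrow>
     open \<Omega> \<and> connected \<Omega> \<and> polyhedral_domain \<Omega>1 \<and> polyhedral_domain \<Omega>2 \<and>
     \<Omega>1 \<inter> \<Omega>2 = {} \<and> \<Omega>1 \<union> \<Omega>2 \<subseteq> \<Omega> \<and> closure \<Omega> = closure \<Omega>1 \<union> closure \<Omega>2"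

text \<open>\<open>\<Gamma>D\<close>, \<open>\<Gamma>N\<close>, \<open>\<Gamma>\<close> cover the boundary and overlap at most in surface null sets (their common
  edges), so it does not matter whether the parts are taken open or closed.\<close>

definition boundary_split ::
    "(real^'n) set \<Rightarrow> (real^'n) set \<Rightarrow> (real^'n) set \<Rightarrow> (real^'n) set \<Rightarrow> bool" where
  "boundary_split \<Omega> \<Gamma>D \<Gamma>N \<Gamma> \<longleftrightarrow>
     \<Gamma>D \<in> sets borel \<and> \<Gamma>N \<in> sets borel \<and> frontier \<Omega> = \<Gamma>D \<union> \<Gamma>N \<union> \<Gamma> \<and>
     emeasure surface_measure (\<Gamma>D \<inter> \<Gamma>N) = 0 \<and> emeasure surface_measure (\<Gamma>N \<inter> \<Gamma>) = 0 \<and>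
     closure \<Gamma>D \<inter> closure \<Gamma> = {} \<and> emeasure surface_measure \<Gamma>D > 0"

text \<open>\<open>v\<close> is the outer unit normal at a boundary point near which \<open>\<Omega>\<close> is a half-space; for a
  polyhedral domain this covers almost every boundary point.\<close>

definition outer_unit_normal :: "(real^'n) set \<Rightarrow> real^'n \<Rightarrow> real^'n \<Rightarrow> bool" where
  "outer_unit_normal \<Omega> x v \<longleftrightarrow>
     norm v = 1 \<and> (\<exists>r>0. \<forall>y \<in> ball x r. y \<in> \<Omega> \<longleftrightarrow> (y - x) \<bullet> v < 0)"

definition unit_normal_field :: "(real^'n) set \<Rightarrow> (real^'n) set \<Rightarrow> 'n vfield \<Rightarrow> bool" where
  "unit_normal_field \<Omega> \<Gamma> n \<longleftrightarrow>
     n \<in> borel_measurable (surface_on \<Gamma>) \<and> (AE x in surface_on \<Gamma>. outer_unit_normal \<Omega> x (n x))"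


definition simplicial_mesh :: "(real^'n) set \<Rightarrow> (real^'n) set set \<Rightarrow> bool" where
  "simplicial_mesh \<Omega> \<T> \<longleftrightarrow>
     triangulation \<T> \<and> (\<forall>T \<in> \<T>. int CARD('n) simplex T) \<and> \<Union>\<T> = closure \<Omega>"

definition facets_on :: "(real^'n) set set \<Rightarrow> (real^'n) set \<Rightarrow> (real^'n) set set" where
  "facets_on \<T> \<Gamma> = {F. F \<subseteq> \<Gamma> \<and> (\<exists>T \<in> \<T>. F facet_of T)}"

definition fitted_to :: "(real^'n) set \<Rightarrow> (real^'n) set set \<Rightarrow> bool" where
  "fitted_to \<Gamma> \<T> \<longleftrightarrow> (AE x in surface_on \<Gamma>. x \<in> \<Union>(facets_on \<T> \<Gamma>))"

definition inradius :: "(real^'n) set \<Rightarrow> real" where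
  "inradius T = Sup {r. 0 \<le> r \<and> (\<exists>x. cball x r \<subseteq> T)}"

definition shape_regular :: "('h \<Rightarrow> (real^'n) set set) \<Rightarrow> bool" where
  "shape_regular \<T> \<longleftrightarrow> (\<exists>\<kappa>>0. \<forall>h. \<forall>T \<in> \<T> h. diameter T \<le> \<kappa> * inradius T)"

definition Poly :: "nat \<Rightarrow> (real^'n \<Rightarrow> real) set" where
  "Poly m = {p. \<exists>c. p = (\<lambda>x. \<Sum>a \<in> {a :: 'n \<Rightarrow> nat. (\<Sum>i\<in>UNIV. a i) \<le> m}.
                              c a * (\<Prod>i\<in>UNIV. (x $ i) ^ a i))}"

definition Poly_vec :: "nat \<Rightarrow> ('n::finite) vfield set" where
  "Poly_vec m = {p. \<forall>i. (\<lambda>x. p x $ i) \<in> Poly m}"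

definition Vh_space ::
    "nat \<Rightarrow> (real^'n) set \<Rightarrow> (real^'n) set \<Rightarrow> (real^'n) set set \<Rightarrow> 'n vfield set" where
  "Vh_space k \<Omega> \<Gamma>D \<T> =
     {w \<in> V_space \<Omega> \<Gamma>D. \<forall>T \<in> \<T>. \<exists>p \<in> Poly_vec k. AE x in lebesgue_on T. w x = p x}"

text \<open>Discrete multipliers are \<open>L\<^sup>2(\<Gamma>)\<close> functions, identified with the functionals they induce.
  The restriction to a facet of a polynomial in the ambient coordinates is the same as a polynomial
  of the same degree on the facet.\<close>

definition Lambdah_space :: "nat \<Rightarrow> (real^'n) set \<Rightarrow> (real^'n) set \<Rightarrow> (real^'n) set set \<Rightarrow> 'n vfield set"
  where
  "Lambdah_space l \<Omega> \<Gamma> \<T> =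
     {\<xi>. square_integrable (surface_on \<Gamma>) \<xi> \<and> L2_functional \<Gamma> \<xi> \<in> Multipliers \<Omega> \<Gamma> \<and>
         (\<forall>F \<in> facets_on \<T> \<Gamma>. \<exists>p \<in> Poly_vec l. AE x in surface_on F. \<xi> x = p x)}"

text \<open>Relative interiors of distinct facets of a mesh are disjoint, so at most one summand is nonzero
  in each of the two facetwise definitions below. They fix the value \<open>0\<close> on facet boundaries, a null
  set.\<close>

definition h_Gamma :: "(real^'n) set set \<Rightarrow> (real^'n) set \<Rightarrow> real^'n \<Rightarrow> real" where
  "h_Gamma \<T> \<Gamma> x = (\<Sum>F \<in> facets_on \<T> \<Gamma>. diameter F * indicator (rel_interior F) x)"

text \<open>The gradient of a discrete displacement on a facet is the one from the adjacent mesh element,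
  i.e. that of the polynomial representing the displacement there. The element is unique for
  facets on the boundary.\<close>

definition local_poly :: "nat \<Rightarrow> 'n vfield \<Rightarrow> (real^'n) set \<Rightarrow> 'n vfield" where
  "local_poly k w T = (SOME p. p \<in> Poly_vec k \<and> (AE x in lebesgue_on T. w x = p x))"

definition adjacent_element :: "(real^'n) set set \<Rightarrow> (real^'n) set \<Rightarrow> (real^'n) set" where
  "adjacent_element \<T> F = (SOME T. T \<in> \<T> \<and> F facet_of T)"

definition normal_stress :: "nat \<Rightarrow> real \<Rightarrow> real \<Rightarrow> (real^'n) set set \<Rightarrow> (real^'n) set \<Rightarrow> 'n vfield
    \<Rightarrow> 'n vfield \<Rightarrow> 'n vfield" where
  "normal_stress k E \<nu> \<T> \<Gamma> n w x =
     (\<Sum>F \<in> facets_on \<T> \<Gamma>. indicator (rel_interior F) x *\<^sub>R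
        (stress E \<nu> (jacobian (local_poly k w (adjacent_element \<T> F)) (at x)) *v n x))"

definition Bh_form :: "real \<Rightarrow> nat \<Rightarrow> real \<Rightarrow> real \<Rightarrow> (real^'n) set \<Rightarrow> (real^'n) set \<Rightarrow> 'n vfield
    \<Rightarrow> (real^'n) set set \<Rightarrow> 'n vfield \<times> 'n vfield \<Rightarrow> 'n vfield
    \<Rightarrow> 'n vfield \<times> 'n vfield \<Rightarrow> 'n vfield \<Rightarrow> real" where
  "Bh_form \<alpha> k E \<nu> \<Omega>1 \<Omega>2 n \<T>1 w \<xi> v \<mu> =
     (let \<Gamma> = interface \<Omega>1 \<Omega>2 in
        B_form E \<nu> \<Omega>1 \<Omega>2 w (L2_functional \<Gamma> \<xi>) v (L2_functional \<Gamma> \<mu>)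
        - \<alpha> * l2_inner (surface_on \<Gamma>)
            (\<lambda>x. h_Gamma \<T>1 \<Gamma> x *\<^sub>R (\<xi> x + normal_stress k E \<nu> \<T>1 \<Gamma> n (fst w) x))
            (\<lambda>x. \<mu> x + normal_stress k E \<nu> \<T>1 \<Gamma> n (fst v) x))"

definition energy_norm ::
    "real \<Rightarrow> real \<Rightarrow> (real^'n) set \<Rightarrow> (real^'n) set \<Rightarrow> 'n vfield \<times> 'n vfield \<Rightarrow> real" where
  "energy_norm E \<nu> \<Omega>1 \<Omega>2 w =
     sqrt (elastic_form E \<nu> \<Omega>1 (fst w) (fst w) + elastic_form E \<nu> \<Omega>2 (snd w) (snd w))"

definition mesh_norm :: "real \<Rightarrow> real \<Rightarrow> (real^'n) set \<Rightarrow> (real^'n) set \<Rightarrow> (real^'n) set set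
    \<Rightarrow> 'n vfield \<times> 'n vfield \<Rightarrow> 'n vfield \<Rightarrow> real" where
  "mesh_norm E \<nu> \<Omega>1 \<Omega>2 \<T>1 w \<xi> =
     (let \<Gamma> = interface \<Omega>1 \<Omega>2 in
        sqrt ((energy_norm E \<nu> \<Omega>1 \<Omega>2 w)\<^sup>2
              + (l2_norm (surface_on \<Gamma>) (\<lambda>x. sqrt (h_Gamma \<T>1 \<Gamma> x) *\<^sub>R \<xi> x))\<^sup>2))"

end

theory Submission
  imports Defs "HOL-Computational_Algebra.Polynomial"
begin

text \<open>
  Testing with \<open>(w, -\<xi>)\<close> cancels the two duality pairings, and the stabilization term becomes a
  difference of squares, because \<open>(\<xi> + s) \<bullet> (-\<xi> + s) = |s|\<^sup>2 - |\<xi>|\<^sup>2\<close> for the discrete traction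
  \<open>s = \<sigma>(w\<^sub>1)n\<close>. Hence
  \<open>B\<^sub>h(w, \<xi>; w, -\<xi>) = |||w|||\<^sup>2 + \<alpha> \<integral>\<^sub>\<Gamma> h\<^sub>\<Gamma> |\<xi>|\<^sup>2 - \<alpha> \<integral>\<^sub>\<Gamma> h\<^sub>\<Gamma> |s|\<^sup>2\<close>.
  So everything rests on the discrete trace inequality
  \<open>\<integral>\<^sub>\<Gamma> h\<^sub>\<Gamma> |s|\<^sup>2 \<le> C \<parallel>\<epsilon>(w\<^sub>1)\<parallel>\<^sup>2\<close> with \<open>C\<close> depending on the mesh through its shape
  regularity only (lemma \<open>discrete_trace_inequality\<close>). The elastic energy dominates the norm of
  the strain (lemma \<open>elastic_form_coercive\<close>), so for small \<open>\<alpha>\<close> the negative term is absorbed by the energy of \<open>w\<^sub>1\<close>.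

  The discrete trace inequality is proved facet by facet. Let \<open>F\<close> be a facet of a simplex \<open>T\<close> of
  diameter \<open>D\<close>, and let \<open>p\<close> be the polynomial that represents \<open>w\<^sub>1\<close> on \<open>T\<close>. The facet lies in a
  hyperplane, so its Hausdorff measure is at most a constant times \<open>D\<close> to the power \<open>d-1\<close>. This
  upper bound follows from an explicit grid covering (\<open>surface_measure_hyperplane_le\<close>). Hence
  \<open>\<integral>\<^sub>F D |s|\<^sup>2\<close> is controlled by \<open>D\<^sup>d sup |\<epsilon>(p)|\<^sup>2\<close>, and it remains to bound the supremum of a polynomial by an integral over \<open>T\<close>.

  For that, take a smooth bump \<open>\<psi>\<close> supported in a ball of radius comparable to \<open>D\<close> inside \<open>T\<close>. On
  a space of polynomials of bounded degree \<open>\<integral>\<psi>q\<^sup>2\<close> is a positive definite quadratic form, so it bounds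
  point values; this is shown algebraically, by orthogonal projection
  (\<open>span_bound_by_form\<close>), and transported to every ball by scaling (\<open>Poly_le_bump_integral_scaled\<close>).

  Finally \<open>\<epsilon>(p)\<close> has to be compared with the weak strain of \<open>w\<^sub>1\<close>, which is only given by testing.
  The two agree almost everywhere on \<open>T\<close>, but a single test function suffices: with
  \<open>\<phi> = \<psi> \<epsilon>(p)\<^sub>i\<^sub>j\<close>, the definition of the weak gradient and integration by parts for \<open>p\<close> give
  \<open>\<integral>\<psi> \<epsilon>(p)\<^sub>i\<^sub>j\<^sup>2 = \<integral>\<psi> \<epsilon>(w\<^sub>1)\<^sub>i\<^sub>j \<epsilon>(p)\<^sub>i\<^sub>j\<close>, and Young's inequality yields
  \<open>\<integral>\<psi> \<epsilon>(p)\<^sub>i\<^sub>j\<^sup>2 \<le> \<integral>\<^sub>T \<epsilon>(w\<^sub>1)\<^sub>i\<^sub>j\<^sup>2\<close> (\<open>bump_strain_le_weak_strain\<close>). Summing over the facets costs only a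
  factor, since a simplex has a bounded number of facets and the interiors of the elements are disjoint.
\<close>

section \<open>Calculus of smooth functions and polynomials\<close>

lemma partial_eq:
  assumes "(f has_derivative f') (at x)"
  shows "partial f j x = f' (axis j 1)"
  using frechet_derivative_at[OF assms] by (simp add: partial_def)

lemma Ck_Suc_imp_Ck: "Ck (Suc m) f \<Longrightarrow> Ck m f"
proof (induction m arbitrary: f)
  case 0
  then show ?case
    by (auto intro!: continuous_at_imp_continuous_on differentiable_imp_continuous_within)
next
  case (Suc m)
  then show ?case by (metis Ck.simps(2))
qed

lemma partial_const: "partial (\<lambda>x. c) j = (\<lambda>x. 0)"
  by (rule ext, subst partial_eq[OF has_derivative_const]) simp

lemma partial_coord: "partial (\<lambda>x :: real^'n. x $ i) j = (\<lambda>x. if i = j then 1 else 0)"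
proof
  fix x :: "real^'n"
  have "((\<lambda>x::real^'n. x $ i) has_derivative (\<lambda>x. x $ i)) (at x)"
    by (rule bounded_linear_imp_has_derivative[OF bounded_linear_vec_nth])
  from partial_eq[OF this] show "partial (\<lambda>x :: real^'n. x $ i) j x = (if i = j then 1 else 0)"
    by (simp add: axis_def)
qed

lemma partial_add:
  assumes "\<And>x. f differentiable (at x)" "\<And>x. g differentiable (at x)"
  shows "partial (\<lambda>x. f x + g x) j = (\<lambda>x. partial f j x + partial g j x)"
proof
  fix x
  have "((\<lambda>x. f x + g x) has_derivative
      (\<lambda>h. frechet_derivative f (at x) h + frechet_derivative g (at x) h)) (at x)"
    using assms by (intro has_derivative_add) (auto simp: frechet_derivative_works[symmetric])
  from partial_eq[OF this] show "partial (\<lambda>x. f x + g x) j x = partial f j x + partial g j x"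
    by (simp add: partial_def)
qed

lemma partial_mult:
  assumes "\<And>x. f differentiable (at x)" "\<And>x. g differentiable (at x)"
  shows "partial (\<lambda>x. f x * g x) j = (\<lambda>x. f x * partial g j x + partial f j x * g x)"
proof
  fix x
  have "((\<lambda>x. f x * g x) has_derivative
      (\<lambda>h. f x * frechet_derivative g (at x) h + frechet_derivative f (at x) h * g x)) (at x)"
    using assms by (intro has_derivative_mult) (auto simp: frechet_derivative_works[symmetric])
  from partial_eq[OF this] show "partial (\<lambda>x. f x * g x) j x = f x * partial g j x + partial f j x * g x"
    by (simp add: partial_def)
qed

lemma partial_compose:
  assumes "\<And>x. f differentiable (at x)" and "\<And>t. (g has_real_derivative g' t) (at t)"
  shows "partial (\<lambda>x. g (f x)) j = (\<lambda>x. g' (f x) * partial f j x)"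
proof
  fix x
  have "(f has_derivative frechet_derivative f (at x)) (at x)"
    using assms(1) by (simp add: frechet_derivative_works[symmetric])
  then have "((\<lambda>x. g (f x)) has_derivative (\<lambda>h. g' (f x) * frechet_derivative f (at x) h)) (at x)"
    using assms(2)[of "f x"] by (rule has_derivative_compose[of f _ _ UNIV g "(*) (g' (f x))",
        unfolded has_field_derivative_def[symmetric]])
  from partial_eq[OF this] show "partial (\<lambda>x. g (f x)) j x = g' (f x) * partial f j x"
    by (simp add: partial_def)
qed

lemma Ck_add: "Ck m f \<Longrightarrow> Ck m g \<Longrightarrow> Ck m (\<lambda>x. f x + g x)"
proof (induction m arbitrary: f g)
  case 0
  then show ?case by (auto intro: continuous_on_add)
next
  case (Suc m)
  then show ?case by (auto simp: partial_add)
qed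

lemma Ck_mult: "Ck m f \<Longrightarrow> Ck m g \<Longrightarrow> Ck m (\<lambda>x. f x * g x)"
proof (induction m arbitrary: f g)
  case 0
  then show ?case by (auto intro: continuous_on_mult)
next
  case (Suc m)
  have "Ck m f" "Ck m g" using Suc.prems Ck_Suc_imp_Ck by blast+
  with Suc show ?case by (auto simp: partial_mult intro!: Ck_add)
qed

text \<open>Polynomials in several variables are given by coefficient families over multi-indices, which are
awkward to substitute into. This induction principle builds a polynomial from constants, sums and
multiplications by a coordinate instead, and tracks the degree bound. Membership of such
combinations in \<^const>\<open>Poly\<close> is recovered by the closure lemmas that follow.\<close>

lemma Poly_induct:
  fixes P :: "nat \<Rightarrow> (real^'n \<Rightarrow> real) \<Rightarrow> bool"
  assumes q: "q \<in> Poly m"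
    and const: "\<And>m c. P m (\<lambda>x. c)"
    and add: "\<And>m f g. P m f \<Longrightarrow> P m g \<Longrightarrow> P m (\<lambda>x. f x + g x)"
    and coord: "\<And>m f i. P m f \<Longrightarrow> P (Suc m) (\<lambda>x. x $ i * f x)"
    and mono: "\<And>m f. P m f \<Longrightarrow> P (Suc m) f"
  shows "P m q"
proof -
  have mono': "P m f \<Longrightarrow> m \<le> m' \<Longrightarrow> P m' f" for m m' f
    by (rule dec_induct[of m m' "\<lambda>k. P k f"]) (auto intro: mono)
  have monomial: "P k (\<lambda>x. c * (\<Prod>i\<in>UNIV. (x $ i) ^ a i))"
    if "(\<Sum>i\<in>UNIV. a i) = k" for c k and a :: "'n \<Rightarrow> nat"
    using that
  proof (induction k arbitrary: a)
    case 0
    then show ?case using const[of 0 c] by simp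
  next
    case (Suc k)
    then obtain i where i: "a i > 0" by (metis less_nat_zero_code sum.neutral gr0I zero_less_Suc)
    let ?a = "a(i := a i - 1)"
    have split: "(\<Sum>j\<in>UNIV. b j) = b i + (\<Sum>j\<in>UNIV - {i}. b j)" for b :: "'n \<Rightarrow> nat"
      by (simp add: sum.remove)
    have "(\<Sum>j\<in>UNIV - {i}. ?a j) = (\<Sum>j\<in>UNIV - {i}. a j)" by (rule sum.cong) auto
    then have "(\<Sum>j\<in>UNIV. ?a j) = k"
      using Suc.prems i split[of a] split[of ?a] by simp
    from coord[OF Suc.IH[OF this], of i]
    have "P (Suc k) (\<lambda>x. x $ i * (c * (\<Prod>j\<in>UNIV. (x $ j) ^ ?a j)))" .
    moreover have "x $ i * (c * (\<Prod>j\<in>UNIV. (x $ j) ^ ?a j)) = c * (\<Prod>j\<in>UNIV. (x $ j) ^ a j)" for x :: "real^'n"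
    proof -
      have "(\<Prod>j\<in>UNIV - {i}. (x $ j) ^ ?a j) = (\<Prod>j\<in>UNIV - {i}. (x $ j) ^ a j)"
        by (rule prod.cong) auto
      moreover have "(\<Prod>j\<in>UNIV. (x $ j) ^ b j) = (x $ i) ^ b i * (\<Prod>j\<in>UNIV - {i}. (x $ j) ^ b j)" for b
        by (simp add: prod.remove)
      moreover have "x $ i * (x $ i) ^ (a i - 1) = (x $ i) ^ a i"
        using i by (metis Suc_pred' power_Suc)
      ultimately show ?thesis by simp
    qed
    ultimately show ?case by (simp only:)
  qed
  obtain c where c: "q = (\<lambda>x. \<Sum>a \<in> {a :: 'n \<Rightarrow> nat. (\<Sum>i\<in>UNIV. a i) \<le> m}. c a * (\<Prod>i\<in>UNIV. (x $ i) ^ a i))"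
    using q by (auto simp: Poly_def)
  have "P m (\<lambda>x. \<Sum>a \<in> A. c a * (\<Prod>i\<in>UNIV. (x $ i) ^ a i))"
    if "A \<subseteq> {a :: 'n \<Rightarrow> nat. (\<Sum>i\<in>UNIV. a i) \<le> m}" for A
    using that
  proof (induction A rule: infinite_finite_induct)
    case (infinite A)
    then show ?case using const by simp
  next
    case empty
    then show ?case using const by simp
  next
    case (insert a A)
    then have "P m (\<lambda>x. c a * (\<Prod>i\<in>UNIV. (x $ i) ^ a i))"
      using monomial[of a _ "c a", OF refl] mono' by blast
    then show ?case using insert add by simp
  qed
  then show ?thesis by (simp add: c)
qed

lemma finite_multi_index: "finite {a :: 'n::finite \<Rightarrow> nat. (\<Sum>i\<in>UNIV. a i) \<le> m}"
proof (rule finite_subset)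
  have "a i \<le> m" if "(\<Sum>i\<in>UNIV. a i) \<le> m" for i and a :: "'n \<Rightarrow> nat"
    using member_le_sum[of i UNIV a] that by simp
  then show "{a :: 'n \<Rightarrow> nat. (\<Sum>i\<in>UNIV. a i) \<le> m} \<subseteq> (UNIV \<rightarrow>\<^sub>E {..m})"
    by (auto simp: PiE_def)
qed (auto intro: finite_PiE)

lemma PolyI:
  fixes f :: "real^'n \<Rightarrow> real"
  assumes "\<And>x. f x = (\<Sum>a \<in> {a :: 'n \<Rightarrow> nat. (\<Sum>i\<in>UNIV. a i) \<le> m}. c a * (\<Prod>i\<in>UNIV. (x $ i) ^ a i))"
  shows "f \<in> Poly m"
  using assms unfolding Poly_def by blast

lemma Poly_const: "(\<lambda>x. c) \<in> Poly m"
proof -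
  let ?A = "{a :: 'n \<Rightarrow> nat. (\<Sum>i\<in>UNIV. a i) \<le> m}"
  have "c = (\<Sum>a\<in>?A. (if a = (\<lambda>i. 0) then c else 0) * (\<Prod>i\<in>UNIV. (x $ i) ^ a i))" for x :: "real^'n"
    by (subst sum.mono_neutral_right[of ?A "{\<lambda>i. 0}"]) (auto simp: finite_multi_index)
  then show ?thesis by (rule PolyI)
qed

lemma Poly_add: "f \<in> Poly m \<Longrightarrow> g \<in> Poly m \<Longrightarrow> (\<lambda>x. f x + g x) \<in> Poly m"
proof -
  assume "f \<in> Poly m" "g \<in> Poly m"
  then obtain c d where
    "f = (\<lambda>x. \<Sum>a \<in> {a :: 'a \<Rightarrow> nat. (\<Sum>i\<in>UNIV. a i) \<le> m}. c a * (\<Prod>i\<in>UNIV. (x $ i) ^ a i))"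
    "g = (\<lambda>x. \<Sum>a \<in> {a :: 'a \<Rightarrow> nat. (\<Sum>i\<in>UNIV. a i) \<le> m}. d a * (\<Prod>i\<in>UNIV. (x $ i) ^ a i))"
    by (auto simp: Poly_def)
  then show ?thesis
    by (intro PolyI[where c = "\<lambda>a. c a + d a"]) (simp add: sum.distrib distrib_right)
qed

lemma Poly_cmult: "f \<in> Poly m \<Longrightarrow> (\<lambda>x. c * f x) \<in> Poly m"
proof -
  assume "f \<in> Poly m"
  then obtain d where
    "f = (\<lambda>x. \<Sum>a \<in> {a :: 'a \<Rightarrow> nat. (\<Sum>i\<in>UNIV. a i) \<le> m}. d a * (\<Prod>i\<in>UNIV. (x $ i) ^ a i))"
    by (auto simp: Poly_def)
  then show ?thesis
    by (intro PolyI[where c = "\<lambda>a. c * d a"]) (simp add: sum_distrib_left mult.assoc)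
qed

lemma Poly_Suc: "f \<in> Poly m \<Longrightarrow> f \<in> Poly (Suc m)"
proof -
  let ?A = "\<lambda>m. {a :: 'a \<Rightarrow> nat. (\<Sum>i\<in>UNIV. a i) \<le> m}"
  assume "f \<in> Poly m"
  then obtain d where f: "f = (\<lambda>x. \<Sum>a \<in> ?A m. d a * (\<Prod>i\<in>UNIV. (x $ i) ^ a i))"
    by (auto simp: Poly_def)
  have "f x = (\<Sum>a \<in> ?A (Suc m). (if a \<in> ?A m then d a else 0) * (\<Prod>i\<in>UNIV. (x $ i) ^ a i))" for x
    unfolding f by (rule sum.mono_neutral_cong_left) (auto simp: finite_multi_index)
  then show ?thesis by (rule PolyI)
qed

lemma Poly_coord_mult: "f \<in> Poly m \<Longrightarrow> (\<lambda>x. x $ i * f x) \<in> Poly (Suc m)"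
proof -
  let ?A = "\<lambda>m. {a :: 'a \<Rightarrow> nat. (\<Sum>i\<in>UNIV. a i) \<le> m}"
  let ?u = "\<lambda>a :: 'a \<Rightarrow> nat. a(i := Suc (a i))"
  assume "f \<in> Poly m"
  then obtain d where f: "f = (\<lambda>x. \<Sum>a \<in> ?A m. d a * (\<Prod>i\<in>UNIV. (x $ i) ^ a i))"
    by (auto simp: Poly_def)
  have sum_u: "(\<Sum>j\<in>UNIV. ?u a j) = Suc (\<Sum>j\<in>UNIV. a j)" for a
  proof -
    have "(\<Sum>j\<in>UNIV. ?u a j) = (\<Sum>j\<in>UNIV. a j + (if j = i then 1 else 0))"
      by (rule sum.cong) auto
    then show ?thesis by (simp add: sum.distrib)
  qed
  have prod_u: "(\<Prod>j\<in>UNIV. (x $ j) ^ ?u a j) = x $ i * (\<Prod>j\<in>UNIV. (x $ j) ^ a j)" for a and x :: "real^'a"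
  proof -
    have "(\<Prod>j\<in>UNIV. (x $ j) ^ ?u a j) = (\<Prod>j\<in>UNIV. (if j = i then x $ i else 1) * (x $ j) ^ a j)"
      by (rule prod.cong) auto
    then show ?thesis by (simp add: prod.distrib)
  qed
  have inj: "inj_on ?u (?A m)"
  proof (rule inj_onI)
    fix a b assume "?u a = ?u b"
    then have "?u a j = ?u b j" for j by simp
    then show "a = b" by (metis ext fun_upd_other fun_upd_same nat.inject)
  qed
  have img: "?u ` ?A m \<subseteq> ?A (Suc m)" using sum_u by auto
  have "x $ i * f x = (\<Sum>a \<in> ?u ` ?A m. d (a(i := a i - 1)) * (\<Prod>i\<in>UNIV. (x $ i) ^ a i))" for x
    unfolding f sum.reindex[OF inj] o_def prod_u by (simp add: sum_distrib_left mult_ac)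
  moreover have "(\<Sum>a \<in> ?u ` ?A m. d (a(i := a i - 1)) * (\<Prod>i\<in>UNIV. (x $ i) ^ a i))
     = (\<Sum>a \<in> ?A (Suc m). (if a \<in> ?u ` ?A m then d (a(i := a i - 1)) else 0) * (\<Prod>i\<in>UNIV. (x $ i) ^ a i))" for x :: "real^'a"
    using img by (intro sum.mono_neutral_cong_left) (auto simp: finite_multi_index)
  ultimately have "x $ i * f x = (\<Sum>a \<in> ?A (Suc m). (if a \<in> ?u ` ?A m then d (a(i := a i - 1)) else 0) * (\<Prod>i\<in>UNIV. (x $ i) ^ a i))" for x
    by (simp only:)
  then show ?thesis by (rule PolyI)
qed

lemma Poly_affine:
  fixes q :: "real^'n \<Rightarrow> real"
  shows "q \<in> Poly m \<Longrightarrow> (\<lambda>x. q (x0 + r *\<^sub>R x)) \<in> Poly m"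
proof (erule Poly_induct)
  fix m f i
  assume f: "(\<lambda>x. f (x0 + r *\<^sub>R x)) \<in> Poly m"
  have "(\<lambda>x. x0 $ i * f (x0 + r *\<^sub>R x) + r * (x $ i * f (x0 + r *\<^sub>R x))) \<in> Poly (Suc m)"
    using f by (intro Poly_add Poly_cmult Poly_coord_mult) (auto intro: Poly_Suc)
  then show "(\<lambda>x. (x0 + r *\<^sub>R x) $ i * f (x0 + r *\<^sub>R x)) \<in> Poly (Suc m)"
    by (simp add: algebra_simps)
qed (auto intro: Poly_const Poly_add Poly_Suc)

text \<open>Membership itself is part of the claim because differentiating \<open>x $ i * f x\<close> leaves a summand \<open>f x\<close>.\<close>

lemma Poly_partial:
  fixes q :: "real^'n \<Rightarrow> real"
  assumes "q \<in> Poly m"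
  shows "q \<in> Poly m \<and> (\<forall>x. q differentiable (at x)) \<and> (\<forall>j. partial q j \<in> Poly m)"
  using assms
proof (rule Poly_induct)
  fix m i and f :: "real^'n \<Rightarrow> real"
  assume f: "f \<in> Poly m \<and> (\<forall>x. f differentiable (at x)) \<and> (\<forall>j. partial f j \<in> Poly m)"
  have x: "(\<lambda>x. x $ i) differentiable (at y)" for y :: "real^'n"
    by (intro bounded_linear_imp_differentiable bounded_linear_vec_nth)
  have "(\<lambda>x. x $ i * partial f j x + (if i = j then 1 else 0) * f x) \<in> Poly (Suc m)" for j
    using f by (intro Poly_add Poly_coord_mult Poly_cmult) (auto intro: Poly_Suc)
  then show "(\<lambda>x. x $ i * f x) \<in> Poly (Suc m) \<and> (\<forall>x. (\<lambda>x. x $ i * f x) differentiable (at x)) \<and>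
      (\<forall>j. partial (\<lambda>x. x $ i * f x) j \<in> Poly (Suc m))"
    using f x by (auto simp: partial_mult partial_coord intro: Poly_coord_mult)
qed (auto simp: partial_const partial_add intro: Poly_const Poly_add Poly_Suc)

lemma Poly_smooth:
  fixes q :: "real^'n \<Rightarrow> real"
  shows "q \<in> Poly m \<Longrightarrow> smooth q"
proof -
  assume q: "q \<in> Poly m"
  have "Ck k q" if "q \<in> Poly m" for k and q :: "real^'n \<Rightarrow> real"
    using that
  proof (induction k arbitrary: q)
    case 0
    then show ?case using Poly_partial[of q m]
      by (auto intro!: continuous_at_imp_continuous_on differentiable_imp_continuous_within)
  next
    case (Suc k)
    then show ?case using Poly_partial[of q m] by auto
  qed
  with q show ?thesis by (simp add: smooth_def)
qed

text \<open>On every line through the origin, \<open>q\<close> is a univariate polynomial with infinitely many roots.\<close>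

lemma Poly_zero_on_ball:
  fixes q :: "real^'n \<Rightarrow> real"
  assumes q: "q \<in> Poly m" and "e > 0" and zero: "\<And>x. x \<in> ball 0 e \<Longrightarrow> q x = 0"
  shows "q x = 0"
proof -
  from q have "\<exists>c. \<forall>t. q (t *\<^sub>R x) = (\<Sum>i\<le>m. c i * t ^ i)"
  proof (rule Poly_induct)
    fix m f i
    assume "\<exists>c. \<forall>t. f (t *\<^sub>R x) = (\<Sum>i\<le>m. c i * t ^ i)"
    then obtain c where c: "\<And>t. f (t *\<^sub>R x) = (\<Sum>i\<le>m. c i * t ^ i)" by blast
    have "(t *\<^sub>R x) $ i * f (t *\<^sub>R x) = (\<Sum>j\<le>Suc m. (if j = 0 then 0 else x $ i * c (j - 1)) * t ^ j)" for t
      by (subst sum.atMost_Suc_shift) (simp add: c sum_distrib_left mult_ac)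
    then show "\<exists>c. \<forall>t. (t *\<^sub>R x) $ i * f (t *\<^sub>R x) = (\<Sum>j\<le>Suc m. c j * t ^ j)" by (intro exI allI)
  next
    fix m :: nat and b :: real
    have "b = (\<Sum>j\<le>m. (if j = 0 then b else 0) * t ^ j)" for t
      by (subst sum.mono_neutral_right[of _ "{0}"]) auto
    then show "\<exists>c. \<forall>t. b = (\<Sum>j\<le>m. c j * t ^ j)" by (intro exI allI)
  next
    fix m f g
    assume "\<exists>c. \<forall>t. f (t *\<^sub>R x) = (\<Sum>i\<le>m. c i * t ^ i)" "\<exists>c. \<forall>t. g (t *\<^sub>R x) = (\<Sum>i\<le>m. c i * t ^ i)"
    then obtain c d where "\<And>t. f (t *\<^sub>R x) = (\<Sum>i\<le>m. c i * t ^ i)" "\<And>t. g (t *\<^sub>R x) = (\<Sum>i\<le>m. d i * t ^ i)"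
      by blast
    then show "\<exists>c. \<forall>t. f (t *\<^sub>R x) + g (t *\<^sub>R x) = (\<Sum>i\<le>m. c i * t ^ i)"
      by (intro exI[of _ "\<lambda>i. c i + d i"]) (simp add: sum.distrib distrib_right)
  next
    fix m f
    assume "\<exists>c. \<forall>t. f (t *\<^sub>R x) = (\<Sum>i\<le>m. c i * t ^ i)"
    then obtain c where "\<And>t. f (t *\<^sub>R x) = (\<Sum>i\<le>m. c i * t ^ i)" by blast
    then show "\<exists>c. \<forall>t. f (t *\<^sub>R x) = (\<Sum>i\<le>Suc m. c i * t ^ i)"
      by (intro exI[of _ "\<lambda>i. if i \<le> m then c i else 0"]) simp
  qed
  then obtain c where c: "\<And>t. q (t *\<^sub>R x) = (\<Sum>i\<le>m. c i * t ^ i)" by blast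
  define d where "d = e / (norm x + 1)"
  have "d > 0" using \<open>e > 0\<close> by (simp add: d_def add_nonneg_pos)
  have "{0..<d} \<subseteq> {t. (\<Sum>i\<le>m. c i * t ^ i) = 0}"
  proof clarsimp
    fix t assume t: "0 \<le> t" "t < d"
    have "t * norm x \<le> t * (norm x + 1)" using t by (intro mult_left_mono) auto
    also have "\<dots> < e" using t by (simp add: d_def pos_less_divide_eq add_nonneg_pos)
    finally have "t *\<^sub>R x \<in> ball 0 e" using t by (simp add: abs_of_nonneg)
    then show "(\<Sum>i\<le>m. c i * t ^ i) = 0" using zero c by metis
  qed
  moreover have "infinite {0..<d}" using \<open>d > 0\<close> infinite_Ico by blast
  ultimately have "infinite {t. (\<Sum>i\<le>m. c i * t ^ i) = 0}" using finite_subset by blast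
  then have "\<And>k. k \<le> m \<Longrightarrow> c k = 0" using polyfun_finite_roots[of c m] by blast
  then have "q (1 *\<^sub>R x) = 0" unfolding c by simp
  then show ?thesis by simp
qed

section \<open>A smooth bump function\<close>

text \<open>The functions \<open>P(1/t) exp(-1/t)\<close>, extended by zero to \<open>t \<le> 0\<close>. They form a family that is closed
under differentiation, so that all of its members are smooth.\<close>

definition exp_inv_poly :: "real poly \<Rightarrow> real \<Rightarrow> real" where
  "exp_inv_poly P t = (if t \<le> 0 then 0 else poly P (1 / t) * exp (- (1 / t)))"

lemma tendsto_poly_div_exp_0: "((\<lambda>x. poly P x * exp (- x)) \<longlongrightarrow> 0) (at_top :: real filter)"
proof -
  have "((\<lambda>x. \<Sum>i\<le>degree P. coeff P i * (x ^ i / exp x)) \<longlongrightarrow> (\<Sum>i\<le>degree P. coeff P i * 0)) (at_top :: real filter)"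
    by (intro tendsto_sum tendsto_mult tendsto_const tendsto_power_div_exp_0)
  then show ?thesis
    by (simp add: poly_altdef sum_distrib_left exp_minus divide_inverse mult_ac)
qed

lemma exp_inv_poly_tendsto_0: "(exp_inv_poly P \<longlongrightarrow> 0) (at 0)"
proof -
  have "((\<lambda>t. poly P (inverse t) * exp (- inverse t)) \<longlongrightarrow> 0) (at_right (0::real))"
    by (rule filterlim_compose[OF tendsto_poly_div_exp_0 filterlim_inverse_at_top_right])
  then have "(exp_inv_poly P \<longlongrightarrow> 0) (at_right 0)"
    by (rule Lim_transform_eventually)
       (auto simp: eventually_at_right_field exp_inv_poly_def inverse_eq_divide intro!: exI[of _ 1])
  moreover have "(exp_inv_poly P \<longlongrightarrow> 0) (at_left 0)"
    by (rule Lim_transform_eventually[OF tendsto_const])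
       (auto simp: eventually_at_left_field exp_inv_poly_def intro!: exI[of _ "-1"])
  ultimately show ?thesis by (simp add: filterlim_split_at_real)
qed

text \<open>For \<open>t > 0\<close> this is the product rule. At 0 the difference quotient of a member of the family is
another member, \<open>pCons 0 P\<close> in place of \<open>P\<close>, and all members tend to 0 there.\<close>

lemma exp_inv_poly_deriv:
  "(exp_inv_poly P has_real_derivative exp_inv_poly ([:0,0,1:] * (P - pderiv P)) t) (at t)"
proof (cases t "0 :: real" rule: linorder_cases)
  case less
  have "((\<lambda>t. 0) has_real_derivative 0) (at t)" by simp
  then have "(exp_inv_poly P has_real_derivative 0) (at t)"
    by (rule DERIV_cong_ev[THEN iffD1, rotated -1])
       (use less in \<open>auto simp: exp_inv_poly_def intro!: eventually_nhds_in_open[of "{..<0}", THEN eventually_mono]\<close>)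
  then show ?thesis using less by (simp add: exp_inv_poly_def)
next
  case equal
  have "((\<lambda>h. exp_inv_poly (pCons 0 P) h) \<longlongrightarrow> 0) (at 0)"
    by (rule exp_inv_poly_tendsto_0)
  then have "((\<lambda>h. (exp_inv_poly P (0 + h) - exp_inv_poly P 0) / h) \<longlongrightarrow> 0) (at 0)"
    by (rule Lim_transform_eventually) (auto simp: exp_inv_poly_def intro!: always_eventually)
  then show ?thesis using equal by (simp add: DERIV_def exp_inv_poly_def)
next
  case greater
  have "((\<lambda>t. poly P (1 / t) * exp (- (1 / t))) has_real_derivative
      exp_inv_poly ([:0,0,1:] * (P - pderiv P)) t) (at t)"
    using greater
    by (auto intro!: derivative_eq_intros simp: exp_inv_poly_def field_simps power2_eq_square)
  then show ?thesis
    by (rule DERIV_cong_ev[THEN iffD1, rotated -1])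
       (use greater in \<open>auto simp: exp_inv_poly_def intro!: eventually_nhds_in_open[of "{0<..}", THEN eventually_mono]\<close>)
qed

lemma Ck_exp_inv_poly_compose: "smooth q \<Longrightarrow> Ck m (\<lambda>x. exp_inv_poly P (q x))"
proof (induction m arbitrary: P)
  case 0
  have "continuous_on UNIV (exp_inv_poly P)"
    using DERIV_isCont[OF exp_inv_poly_deriv] by (simp add: continuous_at_imp_continuous_on)
  moreover have "continuous_on UNIV q" using 0 unfolding smooth_def by (metis Ck.simps(1))
  ultimately show ?case
    using continuous_on_compose2[of UNIV "exp_inv_poly P" UNIV q] by simp
next
  case (Suc m)
  have q: "\<And>x. q differentiable (at x)" "\<And>j. Ck m (partial q j)"
    using Suc.prems unfolding smooth_def by (metis Ck.simps(2))+
  have "(\<lambda>x. exp_inv_poly P (q x)) differentiable (at x)" for x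
  proof (rule differentiable_compose[of "exp_inv_poly P"])
    show "exp_inv_poly P differentiable (at (q x))"
      using exp_inv_poly_deriv by (auto simp: real_differentiable_def)
  qed (rule q)
  then show ?case
    using q Suc by (auto simp: partial_compose[OF q(1) exp_inv_poly_deriv] intro!: Ck_mult)
qed

text \<open>For \<open>r > 0\<close> a smooth radial function, positive exactly on the ball of radius \<open>r/2\<close> around
\<open>x0\<close>. Half the radius keeps the compact support inside the open ball of radius \<open>r\<close>.\<close>

definition bump :: "real^'n \<Rightarrow> real \<Rightarrow> real^'n \<Rightarrow> real" where
  "bump x0 r x = exp_inv_poly 1 (1/4 - (norm ((1 / r) *\<^sub>R (x - x0)))\<^sup>2)"

lemma Poly_sum: "(\<And>i. i \<in> A \<Longrightarrow> f i \<in> Poly m) \<Longrightarrow> (\<lambda>x. \<Sum>i\<in>A. f i x) \<in> Poly m"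
  by (induction A rule: infinite_finite_induct) (auto intro: Poly_const Poly_add)

lemma smooth_bump: "smooth (bump x0 r)"
proof -
  have "(\<lambda>y :: real^'a. 1/4 + (-1) * (\<Sum>i\<in>UNIV. y $ i * (y $ i * 1))) \<in> Poly (Suc (Suc 0))"
    by (intro Poly_add Poly_const Poly_cmult Poly_sum Poly_coord_mult)
  from Poly_affine[OF this, of "- (1 / r) *\<^sub>R x0" "1 / r"]
  have "smooth (\<lambda>x. 1/4 - (norm ((1 / r) *\<^sub>R (x - x0)))\<^sup>2)"
    by (intro Poly_smooth[of _ "Suc (Suc 0)"])
       (simp add: power2_norm_eq_inner inner_vec_def algebra_simps)
  then show ?thesis
    unfolding bump_def[abs_def] smooth_def by (intro allI Ck_exp_inv_poly_compose) (simp add: smooth_def)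
qed

lemma bump_nonneg: "0 \<le> bump x0 r x"
  and bump_le_1: "bump x0 r x \<le> 1"
  by (simp_all add: bump_def exp_inv_poly_def)

lemma bump_outside:
  assumes "r > 0" and "r / 2 \<le> dist x0 x"
  shows "bump x0 r x = 0"
proof -
  have "1/2 \<le> norm ((1 / r) *\<^sub>R (x - x0))"
    using assms unfolding norm_scaleR by (simp add: dist_norm norm_minus_commute field_simps)
  then have "(1/2)\<^sup>2 \<le> (norm ((1 / r) *\<^sub>R (x - x0)))\<^sup>2" by (intro power_mono) auto
  then show ?thesis by (simp add: bump_def exp_inv_poly_def power2_eq_square)
qed

lemma bump_inside:
  assumes "dist x0 x < r / 2"
  shows "0 < bump x0 r x"
proof -
  have "r > 0" using assms zero_le_dist[of x0 x] by linarith
  have "norm ((1 / r) *\<^sub>R (x - x0)) < 1/2"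
    using assms \<open>r > 0\<close> unfolding norm_scaleR by (simp add: dist_norm norm_minus_commute field_simps)
  then have "(norm ((1 / r) *\<^sub>R (x - x0)))\<^sup>2 < (1/2)\<^sup>2" by (intro power_strict_mono) auto
  then show ?thesis by (simp add: bump_def exp_inv_poly_def power2_eq_square)
qed

lemma bump_affine: "r \<noteq> 0 \<Longrightarrow> bump x0 r (x0 + r *\<^sub>R y) = bump 0 1 y"
  by (simp add: bump_def)

section \<open>Integration by parts against compactly supported functions\<close>

lemma continuous_on_if_Ck: "Ck m f \<Longrightarrow> continuous_on UNIV f"
proof (induction m)
  case (Suc m)
  then show ?case using Ck_Suc_imp_Ck by blast
qed simp

lemma integrable_compact_support:
  fixes f :: "real^'n \<Rightarrow> real"
  assumes "continuous_on UNIV f" "compact K" "\<And>x. x \<notin> K \<Longrightarrow> f x = 0"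
  shows "integrable lborel f"
proof -
  have "integrable lborel (\<lambda>x. indicator K x *\<^sub>R f x)"
    using assms by (intro borel_integrable_compact) (auto intro: continuous_on_subset)
  moreover have "(\<lambda>x. indicator K x *\<^sub>R f x) = f"
    using assms(3) by (auto simp: fun_eq_iff indicator_def)
  ultimately show ?thesis by simp
qed

lemma partial_outside:
  assumes "closed K" "\<And>x. x \<notin> K \<Longrightarrow> f x = 0" "x \<notin> K"
  shows "partial f j x = 0"
proof -
  have "((\<lambda>x. 0) has_derivative (\<lambda>x. 0)) (at x)" by simp
  then have "(f has_derivative (\<lambda>x. 0)) (at x)"
    by (rule has_derivative_transform_within_open[of _ _ _ _ "- K"]) (use assms in auto)
  from partial_eq[OF this] show ?thesis by simp
qed

text \<open>The integral of a difference quotient of \<open>u\<close> vanishes because Lebesgue measure is invariant under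
translation; dominated convergence passes to the derivative.\<close>

lemma integral_partial_eq_0:
  fixes u :: "real^'n \<Rightarrow> real"
  assumes C1: "Ck (Suc 0) u" and K: "compact K" and zero: "\<And>x. x \<notin> K \<Longrightarrow> u x = 0"
  shows "(LINT x|lborel. partial u j x) = 0"
proof -
  let ?e = "axis j 1 :: real^'n"
  define h where "h n = 1 / real (Suc n)" for n
  have h: "0 < h n" "h n \<le> 1" for n by (auto simp: h_def)
  define U where "U n x = (u (h n *\<^sub>R ?e + x) - u x) / h n" for n x
  have cont: "continuous_on UNIV u" "continuous_on UNIV (partial u j)"
    using C1 continuous_on_if_Ck[OF C1] by auto
  have diff: "u differentiable (at x)" for x using C1 by auto
  have int_u: "integrable lborel u" by (rule integrable_compact_support[OF cont(1) K zero])
  have shift: "(LINT x|lborel. u (c + x)) = (LINT x|lborel. u x)"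
      "integrable lborel (\<lambda>x. u (c + x))" for c
  proof -
    have m: "u \<in> borel_measurable borel" using cont(1) by (rule borel_measurable_continuous_onI)
    show "(LINT x|lborel. u (c + x)) = (LINT x|lborel. u x)"
      using integral_distr[of "(+) c" lborel borel u] m by (simp add: lborel_distr_plus)
    show "integrable lborel (\<lambda>x. u (c + x))"
      using integrable_distr_eq[of "(+) c" lborel borel u] m int_u by (simp add: lborel_distr_plus)
  qed
  have "(LINT x|lborel. U n x) = 0" for n
    unfolding U_def using shift int_u by simp
  moreover obtain R where R: "K \<subseteq> cball 0 R"
    using bounded_subset_ballD[OF compact_imp_bounded[OF K], of 0] ball_subset_cball by blast
  obtain M where M: "\<And>x. \<bar>partial u j x\<bar> \<le> M"
  proof -
    have "compact (partial u j ` K)"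
      using K cont(2) by (intro compact_continuous_image) (auto intro: continuous_on_subset)
    then obtain M where M: "\<And>x. x \<in> K \<Longrightarrow> \<bar>partial u j x\<bar> \<le> M"
      using compact_imp_bounded[of "partial u j ` K"] by (auto simp: bounded_iff)
    have "\<bar>partial u j x\<bar> \<le> \<bar>M\<bar>" for x
      using M[of x] partial_outside[where f = u and x = x and j = j, OF compact_imp_closed[OF K] zero]
      by (cases "x \<in> K") auto
    then show ?thesis using that by blast
  qed
  \<comment> \<open>The restriction of \<open>u\<close> to a line in direction \<open>j\<close>, for the mean value theorem.\<close>
  have line: "((\<lambda>t. u (t *\<^sub>R ?e + x)) has_real_derivative partial u j (t *\<^sub>R ?e + x)) (at t)" for t x
  proof -
    have d: "(u has_derivative frechet_derivative u (at (t *\<^sub>R ?e + x))) (at (t *\<^sub>R ?e + x))"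
      using diff by (simp add: frechet_derivative_works[symmetric])
    have "((\<lambda>t. t *\<^sub>R ?e + x) has_derivative (\<lambda>s. s *\<^sub>R ?e)) (at t)"
      by (auto intro!: derivative_eq_intros)
    from has_derivative_compose[OF this d]
    have "((\<lambda>t. u (t *\<^sub>R ?e + x)) has_derivative (\<lambda>s. frechet_derivative u (at (t *\<^sub>R ?e + x)) (s *\<^sub>R ?e))) (at t)" .
    moreover have "frechet_derivative u (at (t *\<^sub>R ?e + x)) (s *\<^sub>R ?e) = partial u j (t *\<^sub>R ?e + x) * s" for s
      using linear_scale[OF linear_frechet_derivative[OF diff]] by (simp add: partial_def mult.commute)
    ultimately show ?thesis by (simp add: has_field_derivative_def)
  qed
  have lim: "(\<lambda>n. U n x) \<longlonglongrightarrow> partial u j x" for x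
  proof -
    have "((\<lambda>s. (u ((0 + s) *\<^sub>R ?e + x) - u (0 *\<^sub>R ?e + x)) / s) \<longlongrightarrow> partial u j x) (at 0)"
      using line[of x 0] by (simp add: DERIV_def)
    moreover have "filterlim h (at 0) sequentially"
      unfolding filterlim_at using h
      using LIMSEQ_Suc[OF lim_1_over_n[where 'a = real]] by (auto simp: h_def[abs_def])
    ultimately show ?thesis
      using filterlim_compose[of "\<lambda>s. (u ((0 + s) *\<^sub>R ?e + x) - u (0 *\<^sub>R ?e + x)) / s" _ "at 0" h]
      by (simp add: U_def)
  qed
  \<comment> \<open>The steps have length at most 1, so every quotient is supported in the ball enlarged by 1.\<close>
  have bound: "norm (U n x) \<le> indicator (cball 0 (R + 1)) x *\<^sub>R M" for n x
  proof (cases "x \<in> cball 0 (R + 1)")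
    case True
    obtain z where "u (h n *\<^sub>R ?e + x) - u (0 *\<^sub>R ?e + x) = (h n - 0) * partial u j (z *\<^sub>R ?e + x)"
      using MVT2[of 0 "h n" "\<lambda>t. u (t *\<^sub>R ?e + x)" "\<lambda>t. partial u j (t *\<^sub>R ?e + x)"] line h by blast
    then have "U n x = partial u j (z *\<^sub>R ?e + x)" using h(1)[of n] by (simp add: U_def)
    then show ?thesis using True M by simp
  next
    case False
    have "norm x \<le> norm (h n *\<^sub>R ?e + x) + norm (h n *\<^sub>R ?e)"
      by (metis norm_triangle_ineq4 add.commute add_diff_cancel_left')
    moreover have "norm (h n *\<^sub>R ?e) \<le> 1" using h[of n] by simp
    ultimately have "norm (h n *\<^sub>R ?e + x) > R" "norm x > R" using False by auto
    then have "h n *\<^sub>R ?e + x \<notin> K" "x \<notin> K" using R by (auto simp: subset_iff)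
    then show ?thesis using zero False by (simp add: U_def)
  qed
  have "(\<lambda>n. LINT x|lborel. U n x) \<longlonglongrightarrow> (LINT x|lborel. partial u j x)"
  proof (rule integral_dominated_convergence)
    show "integrable lborel (\<lambda>x. indicator (cball 0 (R + 1)) x *\<^sub>R M)"
      by (intro borel_integrable_compact) auto
    show "partial u j \<in> borel_measurable lborel"
      using borel_measurable_continuous_onI[OF cont(2)] by simp
    show "U n \<in> borel_measurable lborel" for n
      unfolding U_def[abs_def] using shift(2) int_u by (intro borel_measurable_integrable) auto
  qed (use lim bound in auto)
  ultimately show ?thesis by (simp add: LIMSEQ_const_iff)
qed

lemma integration_by_parts:
  fixes p \<phi> :: "real^'n \<Rightarrow> real"
  assumes p: "Ck (Suc 0) p" and \<phi>: "Ck (Suc 0) \<phi>" and K: "compact K"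
    and zero: "\<And>x. x \<notin> K \<Longrightarrow> \<phi> x = 0"
  shows "(LINT x|lborel. p x * partial \<phi> j x) = - (LINT x|lborel. partial p j x * \<phi> x)"
proof -
  have c: "continuous_on UNIV p" "continuous_on UNIV \<phi>" "continuous_on UNIV (partial p j)" "continuous_on UNIV (partial \<phi> j)"
    using p \<phi> continuous_on_if_Ck[OF p] continuous_on_if_Ck[OF \<phi>] by auto
  have z: "x \<notin> K \<Longrightarrow> partial \<phi> j x = 0" for x
    using partial_outside[OF compact_imp_closed[OF K] zero] .
  have "0 = (LINT x|lborel. partial (\<lambda>x. p x * \<phi> x) j x)"
    by (rule integral_partial_eq_0[symmetric, OF Ck_mult[OF p \<phi>] K]) (simp add: zero)
  also have "\<dots> = (LINT x|lborel. p x * partial \<phi> j x + partial p j x * \<phi> x)"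
    using p \<phi> by (subst partial_mult) auto
  also have "\<dots> = (LINT x|lborel. p x * partial \<phi> j x) + (LINT x|lborel. partial p j x * \<phi> x)"
    using c z zero by (intro Bochner_Integration.integral_add integrable_compact_support[OF _ K] continuous_on_mult) auto
  finally show ?thesis by simp
qed

section \<open>Point values of polynomials are bounded by weighted integrals\<close>

text \<open>If a positive semidefinite form \<open>Q\<close> vanishes only at functions that are zero on \<open>K\<close>, then on a
finite-dimensional space it controls values on \<open>K\<close>. The induction over the spanning set carries the
existence of \<open>Q\<close>-orthogonal projections along: writing the new function as its projection plus an
orthogonal remainder \<open>r\<close> splits \<open>Q\<close> by Pythagoras, and the two parts are bounded separately. The
generators may be linearly dependent: if \<open>Q r r = 0\<close>, then \<open>r\<close> vanishes on \<open>K\<close> and adds nothing.\<close>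

lemma span_bound_by_form:
  fixes b :: "'a \<Rightarrow> 's \<Rightarrow> real" and Q :: "('s \<Rightarrow> real) \<Rightarrow> ('s \<Rightarrow> real) \<Rightarrow> real"
  assumes lin: "\<And>f g c. f \<in> V \<Longrightarrow> g \<in> V \<Longrightarrow> (\<lambda>x. f x + c * g x) \<in> V" and zero: "(\<lambda>x. 0) \<in> V"
    and Qlin: "\<And>f g h c. f \<in> V \<Longrightarrow> g \<in> V \<Longrightarrow> h \<in> V \<Longrightarrow> Q (\<lambda>x. f x + c * g x) h = Q f h + c * Q g h"
    and Qsym: "\<And>f g. Q f g = Q g f"
    and Qpos: "\<And>f. f \<in> V \<Longrightarrow> 0 \<le> Q f f"
  shows "finite A \<Longrightarrow> b ` A \<subseteq> V \<Longrightarrow> (\<And>a. a \<in> A \<Longrightarrow> \<exists>M. \<forall>x\<in>K. \<bar>b a x\<bar> \<le> M) \<Longrightarrow>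
    (\<And>c x. Q (\<lambda>x. \<Sum>a\<in>A. c a * b a x) (\<lambda>x. \<Sum>a\<in>A. c a * b a x) = 0 \<Longrightarrow> x \<in> K \<Longrightarrow> (\<Sum>a\<in>A. c a * b a x) = 0) \<Longrightarrow>
    (\<forall>g\<in>V. \<exists>c. \<forall>a\<in>A. Q (\<lambda>x. g x + (-1) * (\<Sum>a\<in>A. c a * b a x)) (b a) = 0) \<and>
    (\<exists>C>0. \<forall>c. \<forall>x\<in>K. (\<Sum>a\<in>A. c a * b a x)\<^sup>2 \<le> C * Q (\<lambda>x. \<Sum>a\<in>A. c a * b a x) (\<lambda>x. \<Sum>a\<in>A. c a * b a x))"
proof (induction A rule: finite_induct)
  case empty
  have "Q (\<lambda>x. 0) (\<lambda>x. 0) = 0" using Qlin[OF zero zero zero, of 1] by simp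
  then show ?case by (auto intro: exI[of _ 1])
next
  case (insert z A)
  define S where "S c = (\<lambda>x. \<Sum>a\<in>A. c a * b a x)" for c
  note bnd = insert.prems(2)
  have bV: "b z \<in> V" "\<And>a. a \<in> A \<Longrightarrow> b a \<in> V" using insert.prems(1) by auto
  have SV: "S c \<in> V" for c
  proof -
    have "(\<lambda>x. \<Sum>a\<in>A'. c a * b a x) \<in> V" if "A' \<subseteq> A" for A'
      using finite_subset[OF that insert.hyps(1)] that
    proof (induction A' rule: finite_induct)
      case (insert a A')
      then have "(\<lambda>x. (\<Sum>a\<in>A'. c a * b a x) + c a * b a x) \<in> V"
        using bV by (intro lin) auto
      then show ?case using insert by (simp add: add.commute)
    qed (simp add: zero)
    then show ?thesis by (simp add: S_def)
  qed
  have Q0: "Q (\<lambda>x. 0) h = 0" if "h \<in> V" for h using Qlin[OF zero zero that, of 1] by simp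
  have QS: "Q (S c) h = 0" if h: "h \<in> V" and orth: "\<And>a. a \<in> A \<Longrightarrow> Q h (b a) = 0" for c h
  proof -
    have "Q (\<lambda>x. \<Sum>a\<in>A'. c a * b a x) h = 0 \<and> (\<lambda>x. \<Sum>a\<in>A'. c a * b a x) \<in> V" if "A' \<subseteq> A" for A'
      using finite_subset[OF that insert.hyps(1)] that
    proof (induction A' rule: finite_induct)
      case (insert a A')
      then have "Q (\<lambda>x. (\<Sum>a\<in>A'. c a * b a x) + c a * b a x) h = 0"
        using bV h orth Qsym by (subst Qlin) auto
      moreover have "(\<lambda>x. (\<Sum>a\<in>A'. c a * b a x) + c a * b a x) \<in> V"
        using bV insert by (intro lin) auto
      ultimately show ?case using insert by (simp add: add.commute)
    qed (simp add: zero Q0 h)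
    then show ?thesis by (simp add: S_def)
  qed
  have S_insert: "(\<lambda>x. \<Sum>a\<in>insert z A. c a * b a x) = (\<lambda>x. S c x + c z * b z x)" for c
    using insert.hyps by (simp add: S_def fun_eq_iff add.commute)
  have S_lin: "S (\<lambda>a. c a + t * d a) x = S c x + t * S d x" for c d t x
    by (simp add: S_def sum.distrib distrib_right sum_distrib_left mult.assoc)
  have S_cong: "(\<And>a. a \<in> A \<Longrightarrow> c a = d a) \<Longrightarrow> S c = S d" for c d by (simp add: S_def fun_eq_iff)
  have IH: "(\<forall>g\<in>V. \<exists>c. \<forall>a\<in>A. Q (\<lambda>x. g x + (-1) * S c x) (b a) = 0) \<and>
    (\<exists>C>0. \<forall>c. \<forall>x\<in>K. (S c x)\<^sup>2 \<le> C * Q (S c) (S c))"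
    unfolding S_def
  proof (rule insert.IH)
    fix c x assume *: "Q (\<lambda>x. \<Sum>a\<in>A. c a * b a x) (\<lambda>x. \<Sum>a\<in>A. c a * b a x) = 0" "x \<in> K"
    have "S (c(z := 0)) = S c" using insert.hyps by (intro S_cong) auto
    then have eq: "(\<lambda>x. \<Sum>a\<in>insert z A. (c(z := 0)) a * b a x) = S c"
      unfolding S_insert by (simp add: fun_upd_same del: fun_upd_apply)
    have "Q (S c) (S c) = 0 \<Longrightarrow> (\<Sum>a\<in>insert z A. (c(z := 0)) a * b a x) = 0"
      using insert.prems(3)[of "c(z := 0)" x] *(2) unfolding eq by blast
    then have "S c x = 0" using *(1) fun_cong[OF eq, of x] by (simp only: S_def)
    then show "(\<Sum>a\<in>A. c a * b a x) = 0" by (simp only: S_def)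
  qed (use insert.prems in auto)
  then obtain C where C: "C > 0" "\<And>c x. x \<in> K \<Longrightarrow> (S c x)\<^sup>2 \<le> C * Q (S c) (S c)" by blast
  from IH bV obtain e where e: "\<And>a. a \<in> A \<Longrightarrow> Q (\<lambda>x. b z x + (-1) * S e x) (b a) = 0" by blast
  define r where "r = (\<lambda>x. b z x + (-1) * S e x)"
  have rV: "r \<in> V" unfolding r_def by (intro lin bV SV)
  have r_orth: "Q r (b a) = 0" if "a \<in> A" for a using e[OF that] by (simp add: r_def)
  have rS: "Q (S c) r = 0" for c using QS[OF rV r_orth] .
  have bz: "b z = (\<lambda>x. r x + 1 * S e x)" by (simp add: r_def fun_eq_iff)
  have split: "(\<lambda>x. \<Sum>a\<in>insert z A. c a * b a x) = (\<lambda>x. S (\<lambda>a. c a + c z * e a) x + c z * r x)" for c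
    unfolding S_insert S_lin by (simp add: r_def fun_eq_iff algebra_simps)
  \<comment> \<open>The remainder lies in the span, so definiteness applies to it.\<close>
  have r_repr: "\<exists>c. r = (\<lambda>x. \<Sum>a\<in>insert z A. c a * b a x)"
  proof
    have "S (\<lambda>a. if a = z then 1 else - e a) = S (\<lambda>a. 0 + (-1) * e a)"
      using insert.hyps by (intro S_cong) auto
    then have "S (\<lambda>a. if a = z then 1 else - e a) x = - S e x" for x
      unfolding S_lin by (simp add: S_lin S_def)
    then show "r = (\<lambda>x. \<Sum>a\<in>insert z A. (if a = z then 1 else - e a) * b a x)"
      unfolding S_insert by (simp add: r_def fun_eq_iff)
  qed
  have r0: "r x = 0" if "Q r r = 0" "x \<in> K" for x
  proof -
    obtain c where c: "r = (\<lambda>x. \<Sum>a\<in>insert z A. c a * b a x)" using r_repr by blast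
    show ?thesis using insert.prems(3)[of c x] that unfolding c by blast
  qed
  \<comment> \<open>The degenerate case of the Cauchy-Schwarz inequality.\<close>
  have Qcs: "Q g r = 0" if "Q r r = 0" "g \<in> V" for g
  proof (rule ccontr)
    assume ne: "Q g r \<noteq> 0"
    \<comment> \<open>For this \<open>t\<close> the form at \<open>g + t r\<close> would be \<open>-1\<close>.\<close>
    define t where "t = - (Q g g + 1) / (2 * Q g r)"
    have gt: "(\<lambda>x. g x + t * r x) \<in> V" using that rV by (intro lin)
    have "Q (\<lambda>x. g x + t * r x) (\<lambda>x. g x + t * r x) = Q g g + 2 * t * Q g r + t * t * Q r r"
      unfolding Qlin[OF that(2) rV gt] Qsym[of g "\<lambda>x. g x + t * r x"] Qsym[of r "\<lambda>x. g x + t * r x"]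
        Qlin[OF that(2) rV that(2)] Qlin[OF that(2) rV rV] Qsym[of r g] by (simp add: algebra_simps)
    also have "\<dots> = -1" using that ne by (simp add: t_def field_simps)
    finally show False using Qpos[OF gt] by simp
  qed
  have "\<exists>c. \<forall>a\<in>insert z A. Q (\<lambda>x. g x + (-1) * (\<Sum>a\<in>insert z A. c a * b a x)) (b a) = 0" if g: "g \<in> V" for g
  proof -
    obtain c0 where c0: "\<And>a. a \<in> A \<Longrightarrow> Q (\<lambda>x. g x + (-1) * S c0 x) (b a) = 0" using IH g by blast
    \<comment> \<open>Division by zero gives 0, which is the right value in the degenerate case.\<close>
    define t where "t = Q g r / Q r r"
    have t: "Q g r = t * Q r r" using Qcs[OF _ g] by (auto simp: t_def)
    let ?g0 = "\<lambda>x. g x + (-1) * S c0 x"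
    let ?g1 = "\<lambda>x. ?g0 x + (- t) * r x"
    have g0: "?g0 \<in> V" by (intro lin g SV)
    have g1: "?g1 \<in> V" by (intro lin g0 rV)
    have orthA: "Q ?g1 (b a) = 0" if "a \<in> A" for a
      using c0[OF that] r_orth[OF that] Qlin[OF g0 rV bV(2)[OF that], of "-t"] by simp
    have "Q ?g1 r = 0"
      unfolding Qlin[OF g0 rV rV] Qlin[OF g SV rV] rS t by simp
    moreover have "Q ?g1 (S e) = 0" using QS[OF g1 orthA, of e] Qsym[of ?g1 "S e"] by simp
    ultimately have orthz: "Q ?g1 (b z) = 0"
      unfolding bz Qsym[of ?g1] Qlin[OF rV SV g1] by (simp add: Qsym[of ?g1])
    obtain c where c: "c = (\<lambda>a. if a = z then t else c0 a + (-t) * e a)" by blast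
    have "S c = S (\<lambda>a. c0 a + (-t) * e a)" using insert.hyps by (intro S_cong) (auto simp: c)
    then have "S c x = S c0 x + (-t) * S e x" for x by (simp only: S_lin)
    moreover have "c z = t" by (simp add: c)
    ultimately have "(\<lambda>x. \<Sum>a\<in>insert z A. c a * b a x) = (\<lambda>x. S c0 x + t * r x)"
      unfolding S_insert by (simp add: r_def fun_eq_iff algebra_simps)
    then have "(\<lambda>x. g x + (-1) * (\<Sum>a\<in>insert z A. c a * b a x)) = ?g1"
      by (simp add: fun_eq_iff)
    then show ?thesis using orthA orthz by (intro exI[of _ c]) auto
  qed
  moreover have "\<exists>C>0. \<forall>c. \<forall>x\<in>K. (\<Sum>a\<in>insert z A. c a * b a x)\<^sup>2
      \<le> C * Q (\<lambda>x. \<Sum>a\<in>insert z A. c a * b a x) (\<lambda>x. \<Sum>a\<in>insert z A. c a * b a x)"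
  proof -
    have pyth: "Q (\<lambda>x. S c x + t * r x) (\<lambda>x. S c x + t * r x) = Q (S c) (S c) + t\<^sup>2 * Q r r" for c t
    proof -
      have V: "(\<lambda>x. S c x + t * r x) \<in> V" by (intro lin SV rV)
      show ?thesis
        unfolding Qlin[OF SV rV V] Qsym[of "S c" "\<lambda>x. S c x + t * r x"] Qsym[of r "\<lambda>x. S c x + t * r x"]
          Qlin[OF SV rV SV] Qlin[OF SV rV rV] Qsym[of r "S c"] rS by (simp add: power2_eq_square)
    qed
    have suffices: ?thesis
      if "C' > 0" and bd: "\<And>c t x. x \<in> K \<Longrightarrow> (S c x + t * r x)\<^sup>2 \<le> C' * (Q (S c) (S c) + t\<^sup>2 * Q r r)" for C'
    proof (intro exI[of _ C'] conjI allI ballI)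
      fix c x assume "x \<in> K"
      from bd[OF this, of "\<lambda>a. c a + c z * e a" "c z"]
      show "(\<Sum>a\<in>insert z A. c a * b a x)\<^sup>2
          \<le> C' * Q (\<lambda>x. \<Sum>a\<in>insert z A. c a * b a x) (\<lambda>x. \<Sum>a\<in>insert z A. c a * b a x)"
        unfolding split pyth fun_cong[OF split] .
    qed fact
    show ?thesis
    proof (cases "Q r r = 0")
      case True
      have "(S c x + t * r x)\<^sup>2 \<le> C * (Q (S c) (S c) + t\<^sup>2 * Q r r)" if "x \<in> K" for c t x
        using C(2)[OF that] r0[OF True that] True by simp
      then show ?thesis by (rule suffices[OF C(1)])
    next
      case False
      then have Qr: "Q r r > 0" using Qpos[OF rV] by simp
      obtain M where M: "\<And>x. x \<in> K \<Longrightarrow> \<bar>r x\<bar> \<le> M"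
      proof -
        have "\<exists>M. \<forall>x\<in>K. \<bar>\<Sum>a\<in>A'. c a * b a x\<bar> \<le> M" if "A' \<subseteq> insert z A" for A' c
          using finite_subset[OF that finite.insertI[OF insert.hyps(1)]] that
        proof (induction A' rule: finite_induct)
          case (insert a A')
          then obtain M1 where M1: "\<forall>x\<in>K. \<bar>\<Sum>a\<in>A'. c a * b a x\<bar> \<le> M1" by auto
          obtain M2 where M2: "\<forall>x\<in>K. \<bar>b a x\<bar> \<le> M2" using insert.prems bnd[of a] by blast
          have "\<forall>x\<in>K. \<bar>\<Sum>a\<in>insert a A'. c a * b a x\<bar> \<le> \<bar>c a\<bar> * M2 + M1"
          proof
            fix x assume x: "x \<in> K"
            have "\<bar>c a * b a x\<bar> \<le> \<bar>c a\<bar> * M2" using M2 x by (simp add: abs_mult mult_left_mono)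
            then show "\<bar>\<Sum>a\<in>insert a A'. c a * b a x\<bar> \<le> \<bar>c a\<bar> * M2 + M1"
              using M1 x insert.hyps by (fastforce simp: abs_le_iff)
          qed
          then show ?case by blast
        qed auto
        then show ?thesis using r_repr that by blast
      qed
      define C' where "C' = 2 * C + 2 * M\<^sup>2 / Q r r"
      have "(S c x + t * r x)\<^sup>2 \<le> C' * (Q (S c) (S c) + t\<^sup>2 * Q r r)" if "x \<in> K" for c t x
      proof -
        have "(S c x + t * r x)\<^sup>2 \<le> 2 * (S c x)\<^sup>2 + 2 * (t * r x)\<^sup>2"
          by (smt (verit) sum_squares_bound power2_sum)
        moreover have "(r x)\<^sup>2 \<le> M\<^sup>2" using M[OF that] abs_le_square_iff by (metis abs_ge_self abs_idempotent order_trans)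
        then have "2 * (t * r x)\<^sup>2 \<le> 2 * M\<^sup>2 / Q r r * (t\<^sup>2 * Q r r)"
          using Qr by (simp add: power_mult_distrib mult.commute[of "t\<^sup>2"] mult_right_mono)
        moreover have "2 * (S c x)\<^sup>2 \<le> 2 * C * Q (S c) (S c)" using C(2)[OF that] by simp
        moreover have "0 \<le> 2 * M\<^sup>2 / Q r r * Q (S c) (S c)" "0 \<le> 2 * C * (t\<^sup>2 * Q r r)"
          using C Qr Qpos[OF SV] by auto
        ultimately show ?thesis unfolding C'_def distrib_left distrib_right by linarith
      qed
      moreover have "C' > 0" using C Qr by (simp add: C'_def add_pos_nonneg)
      ultimately show ?thesis using suffices[of C'] by blast
    qed
  qed
  ultimately show ?case by blast
qed

lemma Ck_if_smooth: "smooth f \<Longrightarrow> Ck m f" by (simp add: smooth_def)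

lemma continuous_on_bump: "continuous_on UNIV (bump x0 r)"
  using continuous_on_if_Ck[OF Ck_if_smooth[OF smooth_bump]] .

lemma continuous_on_Poly: "q \<in> Poly m \<Longrightarrow> continuous_on UNIV q"
  by (rule continuous_on_if_Ck[OF Ck_if_smooth[OF Poly_smooth]])

lemma integrable_bump:
  assumes "continuous_on UNIV f" "r > 0"
  shows "integrable lborel (\<lambda>x. bump x0 r x * f x)"
  by (rule integrable_compact_support[where K = "cball x0 (r/2)"])
     (use assms in \<open>auto intro!: continuous_on_mult continuous_on_bump simp: bump_outside\<close>)

text \<open>The weighted square integral is definite because a polynomial that vanishes on the support of the
bump vanishes identically.\<close>

lemma Poly_le_bump_integral:
  "\<exists>C>0. \<forall>q \<in> Poly m. \<forall>x \<in> cball (0 :: real^'n) \<rho>. (q x)\<^sup>2 \<le> C * (LINT y|lborel. bump 0 1 y * (q y)\<^sup>2)"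
proof -
  let ?A = "{a :: 'n \<Rightarrow> nat. (\<Sum>i\<in>UNIV. a i) \<le> m}"
  let ?b = "\<lambda>a (x :: real^'n). \<Prod>i\<in>UNIV. (x $ i) ^ a i"
  define Q where "Q f g = (LINT y|lborel. bump (0 :: real^'n) 1 y * (f y * g y))" for f g
  let ?V = "{f :: real^'n \<Rightarrow> real. continuous_on UNIV f}"
  have cb: "continuous_on S (?b a)" for a S
    by (intro continuous_on_prod continuous_on_power continuous_on_component continuous_on_id)
  have "(\<forall>g\<in>?V. \<exists>c. \<forall>a\<in>?A. Q (\<lambda>x. g x + (-1) * (\<Sum>a\<in>?A. c a * ?b a x)) (?b a) = 0) \<and>
    (\<exists>C>0. \<forall>c. \<forall>x\<in>cball 0 \<rho>. (\<Sum>a\<in>?A. c a * ?b a x)\<^sup>2 \<le> C * Q (\<lambda>x. \<Sum>a\<in>?A. c a * ?b a x) (\<lambda>x. \<Sum>a\<in>?A. c a * ?b a x))"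
  proof (rule span_bound_by_form)
    fix f g h c assume "f \<in> ?V" "g \<in> ?V" "h \<in> ?V"
    then have "integrable lborel (\<lambda>y. bump 0 1 y * (f y * h y))" "integrable lborel (\<lambda>y. bump 0 1 y * (g y * h y))"
      by (auto intro!: integrable_bump continuous_on_mult)
    moreover have "bump 0 1 y * ((f y + c * g y) * h y) = bump 0 1 y * (f y * h y) + c * (bump 0 1 y * (g y * h y))" for y
      by (simp add: algebra_simps)
    ultimately show "Q (\<lambda>x. f x + c * g x) h = Q f h + c * Q g h"
      unfolding Q_def by simp
  next
    fix c x
    let ?q = "\<lambda>x. \<Sum>a\<in>?A. c a * ?b a x"
    assume Q0: "Q ?q ?q = 0"
    have cq: "continuous_on UNIV ?q" by (intro continuous_on_sum continuous_on_mult cb continuous_on_const)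
    let ?F = "\<lambda>y. bump 0 1 y * (?q y * ?q y)"
    have cF: "continuous_on UNIV ?F" using cq by (intro continuous_on_mult continuous_on_bump)
    have "AE y in lborel. ?F y = 0"
      using Q0 integrable_bump[OF continuous_on_mult[OF cq cq], of 1 0] unfolding Q_def
      by (subst (asm) integral_nonneg_eq_0_iff_AE) (simp_all add: bump_nonneg)
    have F0: "?F y = 0" for y
    proof (rule ccontr)
      assume y: "?F y \<noteq> 0"
      have "open {y. ?F y \<noteq> 0}" using cF by (intro open_Collect_neq) auto
      moreover have "{y. ?F y \<noteq> 0} \<in> null_sets lborel"
      proof -
        have "{y. ?F y \<noteq> 0} \<in> sets lborel" using \<open>open {y. ?F y \<noteq> 0}\<close> by simp
        with \<open>AE y in lborel. ?F y = 0\<close> show ?thesis by (subst (asm) AE_iff_null) auto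
      qed
      ultimately show False using y open_not_negligible[of "{y. ?F y \<noteq> 0}"]
        by (auto simp: negligible_iff_null_sets null_sets_completionI)
    qed
    have "?q \<in> Poly m" by (rule PolyI) simp
    from Poly_zero_on_ball[OF this, of "1/2" x] show "?q x = 0"
      using F0 bump_inside[of 0 _ 1] by (metis (no_types, lifting) ball_eq_ball_iff less_numeral_extra(3) mem_ball mult_eq_0_iff zero_less_divide_1_iff zero_less_numeral)
  next
    fix a
    have "compact (?b a ` cball 0 \<rho>)" by (intro compact_continuous_image cb) simp
    then show "\<exists>M. \<forall>x\<in>cball 0 \<rho>. \<bar>?b a x\<bar> \<le> M"
      using compact_imp_bounded by (fastforce simp: bounded_iff)
  next
    show "finite ?A" by (rule finite_multi_index)
    show "?b ` ?A \<subseteq> ?V" using cb by blast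
    show "0 \<le> Q f f" for f unfolding Q_def by (intro Bochner_Integration.integral_nonneg) (simp add: bump_nonneg)
    show "Q f g = Q g f" for f g unfolding Q_def by (simp only: mult.commute[of "f _"])
  qed (auto intro!: continuous_on_add continuous_on_mult)
  then obtain C where "C > 0" and C: "\<And>c x. x\<in>cball 0 \<rho> \<Longrightarrow>
      (\<Sum>a\<in>?A. c a * ?b a x)\<^sup>2 \<le> C * Q (\<lambda>x. \<Sum>a\<in>?A. c a * ?b a x) (\<lambda>x. \<Sum>a\<in>?A. c a * ?b a x)"
    by blast
  show ?thesis
  proof (intro exI conjI ballI)
    fix q :: "real^'n \<Rightarrow> real" and x assume "q \<in> Poly m" and x: "x \<in> cball (0 :: real^'n) \<rho>"
    then obtain c where "q = (\<lambda>x. \<Sum>a\<in>?A. c a * ?b a x)" unfolding Poly_def by blast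
    then show "(q x)\<^sup>2 \<le> C * (LINT y|lborel. bump 0 1 y * (q y)\<^sup>2)"
      using C[OF x, of c] by (simp only: Q_def power2_eq_square)
  qed fact
qed

lemma lborel_integral_affine:
  fixes f :: "real^'n \<Rightarrow> real"
  assumes "r > 0" "f \<in> borel_measurable borel"
  shows "(LINT x|lborel. f x) = r ^ CARD('n) * (LINT y|lborel. f (x0 + r *\<^sub>R y))"
proof -
  have "(LINT x|lborel. f x) = (LINT x|density (distr lborel borel (\<lambda>x. x0 + r *\<^sub>R x)) (\<lambda>_. \<bar>r\<bar> ^ DIM(real^'n)). f x)"
    using lborel_affine[of r x0] assms by simp
  also have "\<dots> = (LINT x|distr lborel borel (\<lambda>x. x0 + r *\<^sub>R x). r ^ CARD('n) * f x)"
    using assms by (subst integral_density) auto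
  also have "\<dots> = (LINT y|lborel. r ^ CARD('n) * f (x0 + r *\<^sub>R y))"
    using assms by (subst integral_distr) auto
  finally show ?thesis by simp
qed

text \<open>Polynomials of bounded degree are invariant under \<open>y \<mapsto> x0 + r y\<close>, so the constant for the unit bump
serves all bumps; the Jacobian of the substitution produces the power of \<open>r\<close>.\<close>

lemma Poly_le_bump_integral_scaled:
  "\<exists>C>0. \<forall>q \<in> Poly m. \<forall>(x0 :: real^'n) x. \<forall>r>0. dist x0 x \<le> \<rho> * r \<longrightarrow>
     (q x)\<^sup>2 * r ^ CARD('n) \<le> C * (LINT y|lborel. bump x0 r y * (q y)\<^sup>2)"
proof -
  obtain C where "C > 0" and C: "\<And>(q :: real^'n \<Rightarrow> real) x. q \<in> Poly m \<Longrightarrow> x \<in> cball (0 :: real^'n) \<rho> \<Longrightarrow> (q x)\<^sup>2 \<le> C * (LINT y|lborel. bump 0 1 y * (q y)\<^sup>2)"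
    using Poly_le_bump_integral[of m \<rho>] by blast
  show ?thesis
  proof (intro exI conjI ballI allI impI)
    fix q :: "real^'n \<Rightarrow> real" and x0 x :: "real^'n" and r :: real
    assume q: "q \<in> Poly m" and r: "0 < r" and d: "dist x0 x \<le> \<rho> * r"
    let ?q = "\<lambda>y. q (x0 + r *\<^sub>R y)"
    have "(1 / r) *\<^sub>R (x - x0) \<in> cball 0 \<rho>"
      using d r unfolding mem_cball dist_0_norm norm_scaleR by (simp add: dist_norm norm_minus_commute field_simps)
    from C[OF Poly_affine[OF q] this, of x0 r]
    have "(q x)\<^sup>2 \<le> C * (LINT y|lborel. bump 0 1 y * (?q y)\<^sup>2)" using r by simp
    then have "(q x)\<^sup>2 * r ^ CARD('n) \<le> C * (LINT y|lborel. bump 0 1 y * (?q y)\<^sup>2) * r ^ CARD('n)"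
      using r by (intro mult_right_mono) auto
    also have "\<dots> = C * (r ^ CARD('n) * (LINT y|lborel. bump x0 r (x0 + r *\<^sub>R y) * (?q y)\<^sup>2))"
      using r by (simp add: bump_affine)
    also have "\<dots> = C * (LINT y|lborel. bump x0 r y * (q y)\<^sup>2)"
    proof -
      have "(\<lambda>y. bump x0 r y * (q y)\<^sup>2) \<in> borel_measurable borel"
        using continuous_on_Poly[OF q] by (intro borel_measurable_continuous_onI continuous_intros continuous_on_bump)
      from lborel_integral_affine[OF r this, of x0] show ?thesis by simp
    qed
    finally show "(q x)\<^sup>2 * r ^ CARD('n) \<le> C * (LINT y|lborel. bump x0 r y * (q y)\<^sup>2)" .
  qed fact
qed

section \<open>An upper bound for the surface measure\<close>

text \<open>If the set function on the right is not a measure on the Borel sets, \<^const>\<open>measure_of\<close> yields the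
zero measure; so it is an upper bound in either case.\<close>

lemma emeasure_hausdorff_le:
  "emeasure (hausdorff_measure k) A \<le> (SUP \<delta> \<in> {0<..}. hausdorff_pre k \<delta> A)"
  unfolding hausdorff_measure_def by (simp add: emeasure_measure_of_conv)

text \<open>Let \<open>i\<close> be the coordinate in which the normal vector is largest. Over the other coordinates the
hyperplane is a Lipschitz graph, so the cells of a grid of mesh size \<open>s = D/N\<close> in those coordinates
cut \<open>F\<close> into at most \<open>(3N)\<close> to the power \<open>d-1\<close> pieces of diameter at most \<open>2ds\<close>. Their number and
size balance, whatever \<open>N\<close> is, and a large \<open>N\<close> makes the pieces smaller than \<open>\<delta>\<close>.\<close>

lemma hausdorff_pre_hyperplane_le:
  fixes F :: "(real^'n) set"
  assumes card: "CARD('n) \<ge> 2" and "a \<noteq> 0" and hyp: "F \<subseteq> {x. a \<bullet> x = c}"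
    and D: "D > 0" and F: "F \<subseteq> cball y D" and \<delta>: "\<delta> > 0"
  shows "hausdorff_pre (CARD('n) - 1) \<delta> F
     \<le> ennreal (unit_ball_vol (real (CARD('n) - 1)) * (3 * real CARD('n) * D) ^ (CARD('n) - 1))"
proof -
  let ?k = "CARD('n) - 1" and ?d = "real CARD('n)"
  obtain i where i: "\<And>j. \<bar>a $ j\<bar> \<le> \<bar>a $ i\<bar>"
  proof -
    have "finite (range (\<lambda>j. \<bar>a $ j\<bar>))" "range (\<lambda>j. \<bar>a $ j\<bar>) \<noteq> {}" by auto
    from Max_in[OF this] Max_ge[OF this(1)] show ?thesis using that by fastforce
  qed
  have ai: "\<bar>a $ i\<bar> > 0"
  proof (rule ccontr)
    assume "\<not> 0 < \<bar>a $ i\<bar>"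
    then have "a $ j = 0" for j using i[of j] by simp
    then show False using \<open>a \<noteq> 0\<close> by (simp add: vec_eq_iff)
  qed
  have graph: "\<bar>(x - z) $ i\<bar> \<le> (\<Sum>j\<in>UNIV - {i}. \<bar>(x - z) $ j\<bar>)" if "x \<in> F" "z \<in> F" for x z
  proof -
    have "a \<bullet> (x - z) = 0" using that hyp by (auto simp: inner_diff_right)
    then have "a $ i * (x - z) $ i = - (\<Sum>j\<in>UNIV - {i}. a $ j * (x - z) $ j)"
      by (simp add: inner_vec_def sum.remove[of UNIV i])
    then have "\<bar>a $ i\<bar> * \<bar>(x - z) $ i\<bar> = \<bar>\<Sum>j\<in>UNIV - {i}. a $ j * (x - z) $ j\<bar>"
      by (metis abs_minus_cancel abs_mult)
    also have "\<dots> \<le> (\<Sum>j\<in>UNIV - {i}. \<bar>a $ i\<bar> * \<bar>(x - z) $ j\<bar>)"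
      using i by (intro order_trans[OF sum_abs] sum_mono) (simp add: abs_mult mult_right_mono)
    also have "\<dots> = \<bar>a $ i\<bar> * (\<Sum>j\<in>UNIV - {i}. \<bar>(x - z) $ j\<bar>)" by (simp add: sum_distrib_left)
    finally show ?thesis using ai by (rule mult_left_le_imp_le)
  qed
  obtain N :: nat where N: "N > 0" "2 * ?d * D / \<delta> \<le> real N"
    by (metis real_arch_simple gr0I le_less_trans less_imp_le of_nat_0 zero_less_one
        of_nat_1 order_trans zero_le_one)
  define s where "s = D / real N"
  have s: "s > 0" using D N by (simp add: s_def)
  have Ns: "real N * s = D" using N by (simp add: s_def)
  define M where "M = (UNIV - {i}) \<rightarrow>\<^sub>E {- int N .. int N}"
  have finM: "finite M" unfolding M_def by (intro finite_PiE) auto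
  have cardM: "card M = (2 * N + 1) ^ ?k"
    unfolding M_def by (subst card_PiE) (simp_all add: nat_add_distrib nat_mult_distrib)
  define cell where "cell m = {x \<in> F. \<forall>j\<in>UNIV - {i}. \<lfloor>(x - y) $ j / s\<rfloor> = m j}" for m :: "'n \<Rightarrow> int"
  have cell_dist: "norm (x - z) \<le> 2 * ?d * s" if "x \<in> cell m" "z \<in> cell m" for x z m
  proof -
    have xz: "x \<in> F" "z \<in> F" using that by (auto simp: cell_def)
    have "\<bar>(x - z) $ j\<bar> \<le> s" if j: "j \<in> UNIV - {i}" for j
    proof -
      have "\<lfloor>(x - y) $ j / s\<rfloor> = \<lfloor>(z - y) $ j / s\<rfloor>"
        using \<open>x \<in> cell m\<close> \<open>z \<in> cell m\<close> j by (auto simp: cell_def)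
      then have "\<bar>(x - y) $ j / s - (z - y) $ j / s\<bar> < 1" by linarith
      moreover have "(x - y) $ j / s - (z - y) $ j / s = (x - z) $ j / s"
        by (simp add: diff_divide_distrib)
      ultimately show ?thesis using s by (simp add: pos_divide_less_eq)
    qed
    then have "(\<Sum>j\<in>UNIV - {i}. \<bar>(x - z) $ j\<bar>) \<le> real (card (UNIV - {i})) * s"
      by (intro sum_bounded_above) auto
    also have "\<dots> \<le> ?d * s" using s by (intro mult_right_mono) (auto simp: card_Diff_subset)
    finally have "(\<Sum>j\<in>UNIV - {i}. \<bar>(x - z) $ j\<bar>) \<le> ?d * s" .
    moreover have "norm (x - z) \<le> \<bar>(x - z) $ i\<bar> + (\<Sum>j\<in>UNIV - {i}. \<bar>(x - z) $ j\<bar>)"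
      using norm_le_l1_cart[of "x - z"] by (simp add: sum.remove[of UNIV i])
    ultimately show ?thesis using graph[OF xz] by linarith
  qed
  have cover: "F \<subseteq> (\<Union>m\<in>M. cell m)"
  proof
    fix x assume x: "x \<in> F"
    let ?m = "restrict (\<lambda>j. \<lfloor>(x - y) $ j / s\<rfloor>) (UNIV - {i})"
    have "\<lfloor>(x - y) $ j / s\<rfloor> \<in> {- int N .. int N}" for j
    proof -
      have "\<bar>(x - y) $ j\<bar> \<le> D"
        using x F component_le_norm_cart[of "x - y" j] by (force simp: dist_norm norm_minus_commute)
      then have "- real N \<le> (x - y) $ j / s" "(x - y) $ j / s \<le> real N"
        using s Ns by (auto simp: pos_le_divide_eq pos_divide_le_eq abs_le_iff)
      then show ?thesis by (simp add: le_floor_iff floor_le_iff)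
    qed
    then have "?m \<in> M" unfolding M_def by auto
    moreover have "x \<in> cell ?m" using x by (simp add: cell_def)
    ultimately show "x \<in> (\<Union>m\<in>M. cell m)" by blast
  qed
  obtain g where g: "bij_betw g {0..<card M} M" using ex_bij_betw_nat_finite[OF finM] by blast
  \<comment> \<open>Padding with empty sets turns the finite cover into a sequence; the empty set has diameter 0.\<close>
  define C where "C n = (if n < card M then cell (g n) else {})" for n
  have bF: "bounded F" using F bounded_cball bounded_subset by blast
  have C_sub: "C n \<subseteq> F" for n by (auto simp: C_def cell_def)
  have C_cover: "F \<subseteq> (\<Union>n. C n)"
  proof
    fix x assume "x \<in> F"
    then obtain m where m: "m \<in> M" "x \<in> cell m" using cover by blast
    then obtain n where "n < card M" "g n = m" using bij_betw_imp_surj_on[OF g] by (metis atLeastLessThan_iff imageE)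
    then show "x \<in> (\<Union>n. C n)" using m by (auto simp: C_def)
  qed
  have C_diam: "diameter (C n) \<le> 2 * ?d * s" for n
    using cell_dist s by (intro diameter_le) (auto simp: C_def split: if_splits)
  have s_le: "2 * ?d * s \<le> \<delta>"
    using N \<delta> by (simp add: s_def pos_divide_le_eq mult.commute)
  have "hausdorff_pre ?k \<delta> F \<le> (\<Sum>n. ennreal (unit_ball_vol (real ?k) * (diameter (C n) / 2) ^ ?k))"
    unfolding hausdorff_pre_def
    by (rule INF_lower) (use C_cover bounded_subset[OF bF C_sub] order_trans[OF C_diam s_le] in blast)
  also have "\<dots> = (\<Sum>n\<in>{0..<card M}. ennreal (unit_ball_vol (real ?k) * (diameter (C n) / 2) ^ ?k))"
    using card by (intro suminf_finite) (auto simp: C_def power_0_left)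
  also have "\<dots> \<le> (\<Sum>n\<in>{0..<card M}. ennreal (unit_ball_vol (real ?k) * (?d * s) ^ ?k))"
  proof (intro sum_mono ennreal_leI mult_left_mono power_mono)
    fix n show "diameter (C n) / 2 \<le> ?d * s" using C_diam[of n] by simp
    show "0 \<le> diameter (C n) / 2" using diameter_ge_0[OF bounded_subset[OF bF C_sub]] by simp
  qed simp
  also have "\<dots> = ennreal (real (card M) * (unit_ball_vol (real ?k) * (?d * s) ^ ?k))"
    using s by (subst sum_ennreal) auto
  also have "\<dots> \<le> ennreal (unit_ball_vol (real ?k) * (3 * ?d * D) ^ ?k)"
  proof (rule ennreal_leI)
    have "real (card M) \<le> (3 * real N) ^ ?k"
      unfolding cardM of_nat_power using N by (intro power_mono) auto
    then have "real (card M) * (unit_ball_vol (real ?k) * (?d * s) ^ ?k)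
        \<le> (3 * real N) ^ ?k * (unit_ball_vol (real ?k) * (?d * s) ^ ?k)"
      using s by (intro mult_right_mono) auto
    also have "\<dots> = unit_ball_vol (real ?k) * ((3 * real N) * (?d * s)) ^ ?k"
      by (simp add: power_mult_distrib)
    also have "(3 * real N) * (?d * s) = 3 * ?d * D" using N by (simp add: s_def)
    finally show "real (card M) * (unit_ball_vol (real ?k) * (?d * s) ^ ?k)
        \<le> unit_ball_vol (real ?k) * (3 * ?d * D) ^ ?k" .
  qed
  finally show ?thesis .
qed

lemma surface_measure_hyperplane_le:
  fixes F :: "(real^'n) set"
  assumes "CARD('n) \<ge> 2" and "a \<noteq> 0" and "F \<subseteq> {x. a \<bullet> x = c}"
    and "D > 0" and "F \<subseteq> cball y D"
  shows "emeasure surface_measure F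
     \<le> ennreal (unit_ball_vol (real (CARD('n) - 1)) * (3 * real CARD('n) * D) ^ (CARD('n) - 1))"
  unfolding surface_measure_def
  by (rule order_trans[OF emeasure_hausdorff_le], intro SUP_least hausdorff_pre_hyperplane_le[OF assms]) simp

lemma sets_surface_measure [measurable_cong]: "sets (surface_measure :: (real^'n) measure) = sets borel"
  unfolding surface_measure_def hausdorff_measure_def
  by (simp add: sets.sigma_sets_eq[of "borel :: (real^'n) measure", simplified])

section \<open>The weak strain of a piecewise polynomial\<close>

lemma integrable_mult_if_squares:
  fixes f g :: "'a \<Rightarrow> real"
  assumes [measurable]: "f \<in> borel_measurable M" "g \<in> borel_measurable M"
    and "integrable M (\<lambda>x. (f x)\<^sup>2)" "integrable M (\<lambda>x. (g x)\<^sup>2)"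
  shows "integrable M (\<lambda>x. f x * g x)"
proof (rule Bochner_Integration.integrable_bound)
  show "integrable M (\<lambda>x. (f x)\<^sup>2 + (g x)\<^sup>2)" using assms by simp
  show "AE x in M. norm (f x * g x) \<le> norm ((f x)\<^sup>2 + (g x)\<^sup>2)"
  proof (rule AE_I2)
    fix x
    have "2 * (\<bar>f x\<bar> * \<bar>g x\<bar>) \<le> (f x)\<^sup>2 + (g x)\<^sup>2" using sum_squares_bound[of "\<bar>f x\<bar>" "\<bar>g x\<bar>"] by simp
    then show "norm (f x * g x) \<le> norm ((f x)\<^sup>2 + (g x)\<^sup>2)"
      by (simp add: abs_mult) (smt (verit) abs_ge_zero mult_nonneg_nonneg)
  qed
qed simp

lemma strain_nth: "strain G $ i $ j = (G $ i $ j + G $ j $ i) / 2"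
  by (simp add: strain_def transpose_def)

lemma jacobian_nth_Poly_vec:
  assumes "p \<in> Poly_vec k"
  shows "jacobian p (at x) $ i $ j = partial (\<lambda>x. p x $ i) j x"
proof -
  have comp: "(\<lambda>x. p x $ i) differentiable (at x)" for i
    using assms Poly_partial[of "\<lambda>x. p x $ i" k] by (simp add: Poly_vec_def)
  have "p differentiable (at x)"
    using comp by (subst differentiable_componentwise_within) (auto simp: Basis_vec_def inner_axis)
  then have "(p has_derivative frechet_derivative p (at x)) (at x)"
    by (simp add: frechet_derivative_works[symmetric])
  then have "((\<lambda>x. p x $ i) has_derivative (\<lambda>h. frechet_derivative p (at x) h $ i)) (at x)"
    by (rule bounded_linear.has_derivative[OF bounded_linear_vec_nth])
  from partial_eq[OF this] show ?thesis
    by (simp add: jacobian_def matrix_def)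
qed

text \<open>Weak gradients are tested with integrals over the domain in the completed measure, whereas
translation and scaling act on Borel functions on the whole space.\<close>

lemma integral_lebesgue_on_eq_lborel:
  fixes f g :: "real^'n \<Rightarrow> real"
  assumes \<Omega>: "\<Omega> \<in> sets lebesgue" and f: "f \<in> borel_measurable (lebesgue_on \<Omega>)"
    and g: "g \<in> borel_measurable borel"
    and ae: "AE x in lebesgue. x \<in> \<Omega> \<longrightarrow> f x = g x" and out: "\<And>x. x \<notin> \<Omega> \<Longrightarrow> g x = 0"
  shows "(LINT x|lebesgue_on \<Omega>. f x) = (LINT x|lborel. g x)"
proof -
  have gl: "g \<in> borel_measurable lebesgue" using g by (simp add: measurable_completion)
  have "(LINT x|lebesgue_on \<Omega>. f x) = (LINT x|lebesgue. indicator \<Omega> x *\<^sub>R f x)"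
    using \<Omega> by (simp add: integral_restrict_space)
  also have "\<dots> = (LINT x|lebesgue. g x)"
  proof (rule integral_cong_AE)
    show "(\<lambda>x. indicator \<Omega> x *\<^sub>R f x) \<in> borel_measurable lebesgue"
      using f \<Omega> by (simp add: borel_measurable_restrict_space_iff mult.commute)
    show "AE x in lebesgue. indicator \<Omega> x *\<^sub>R f x = g x"
      using ae by eventually_elim (use out in \<open>auto simp: indicator_def\<close>)
  qed (rule gl)
  also have "\<dots> = (LINT x|lborel. g x)"
    using g by (simp add: integral_completion)
  finally show ?thesis .
qed

lemma integrable_lebesgue_on_continuous:
  fixes f :: "real^'n \<Rightarrow> real"
  assumes "continuous_on UNIV f" "compact K" "\<And>x. x \<notin> K \<Longrightarrow> f x = 0" "\<Omega> \<in> sets lebesgue"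
  shows "integrable (lebesgue_on \<Omega>) f"
proof -
  have "integrable lebesgue f"
    using integrable_compact_support[OF assms(1-3)] borel_measurable_integrable
    by (subst integrable_completion) blast+
  then have "integrable lebesgue (\<lambda>x. indicator \<Omega> x *\<^sub>R f x)"
    by (rule integrable_mult_indicator[OF assms(4)])
  then show ?thesis using assms(4) by (subst integrable_restrict_space) auto
qed

text \<open>If \<open>\<phi>\<close> is supported where \<open>w\<close> agrees with \<open>p\<close>, the weak gradient of \<open>w\<close> can be replaced by the
Jacobian of \<open>p\<close>: move the derivative onto \<open>\<phi>\<close>, exchange \<open>w\<close> and \<open>p\<close>, and move it back.\<close>

lemma weak_grad_tested_on_polynomial_piece:
  fixes w p :: "'n::finite vfield"
  assumes \<Omega>: "open \<Omega>" and w: "w \<in> borel_measurable (lebesgue_on \<Omega>)"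
    and G: "has_weak_grad \<Omega> w G"
    and U: "open U" "U \<subseteq> \<Omega>" and p: "p \<in> Poly_vec k"
    and wp: "AE x in lebesgue_on U. w x = p x"
    and \<phi>: "smooth \<phi>" and K: "compact K" "K \<subseteq> U" and zero: "\<And>x. x \<notin> K \<Longrightarrow> \<phi> x = 0"
  shows "(LINT x|lebesgue_on \<Omega>. G x $ i $ j * \<phi> x) = (LINT x|lborel. jacobian p (at x) $ i $ j * \<phi> x)"
proof -
  let ?p = "\<lambda>x. p x $ i"
  have pi: "?p \<in> Poly k" using p by (simp add: Poly_vec_def)
  have C1: "Ck (Suc 0) ?p" "Ck (Suc 0) \<phi>"
    using Ck_if_smooth[OF Poly_smooth[OF pi]] Ck_if_smooth[OF \<phi>] by blast+
  have c\<phi>: "continuous_on UNIV (partial \<phi> j)" using C1(2) by simp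
  have "test_function \<Omega> \<phi>" using \<phi> K U zero unfolding test_function_def by blast
  then have "(LINT x|lebesgue_on \<Omega>. G x $ i $ j * \<phi> x) = - (LINT x|lebesgue_on \<Omega>. w x $ i * partial \<phi> j x)"
    using G unfolding has_weak_grad_def by simp
  also have "(LINT x|lebesgue_on \<Omega>. w x $ i * partial \<phi> j x) = (LINT x|lborel. ?p x * partial \<phi> j x)"
  proof (rule integral_lebesgue_on_eq_lborel)
    show "(\<lambda>x. w x $ i * partial \<phi> j x) \<in> borel_measurable (lebesgue_on \<Omega>)"
    proof (intro borel_measurable_times)
      show "(\<lambda>x. w x $ i) \<in> borel_measurable (lebesgue_on \<Omega>)"
        using w by (rule measurable_compose) (simp add: borel_measurable_continuous_onI continuous_intros)
      show "partial \<phi> j \<in> borel_measurable (lebesgue_on \<Omega>)"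
        using borel_measurable_continuous_onI[OF c\<phi>]
        by (intro measurable_restrict_space1) (simp add: measurable_completion)
    qed
    show "(\<lambda>x. ?p x * partial \<phi> j x) \<in> borel_measurable borel"
      using continuous_on_Poly[OF pi] c\<phi> by (intro borel_measurable_continuous_onI continuous_on_mult)
    have out: "partial \<phi> j x = 0" if "x \<notin> U" for x
      using partial_outside[where f = \<phi> and x = x, OF compact_imp_closed[OF K(1)] zero] that K by blast
    show "?p x * partial \<phi> j x = 0" if "x \<notin> \<Omega>" for x using that out U by auto
    have "AE x in lebesgue. x \<in> U \<longrightarrow> w x = p x"
      using wp U by (subst (asm) AE_restrict_space_iff) auto
    then show "AE x in lebesgue. x \<in> \<Omega> \<longrightarrow> w x $ i * partial \<phi> j x = ?p x * partial \<phi> j x"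
      by eventually_elim (use out in auto)
  qed (use \<Omega> in auto)
  also have "\<dots> = - (LINT x|lborel. partial ?p j x * \<phi> x)"
    by (rule integration_by_parts[OF C1 K(1) zero])
  finally show ?thesis by (simp add: jacobian_nth_Poly_vec[OF p])
qed

lemma smooth_mult: "smooth f \<Longrightarrow> smooth g \<Longrightarrow> smooth (\<lambda>x. f x * g x)"
  by (simp add: smooth_def Ck_mult)

lemma strain_jacobian_Poly:
  assumes "p \<in> Poly_vec k"
  shows "(\<lambda>x. strain (jacobian p (at x)) $ i $ j) \<in> Poly k"
proof -
  have "partial (\<lambda>x. p x $ i) j \<in> Poly k" for i j
    using assms Poly_partial[of "\<lambda>x. p x $ i" k] by (simp add: Poly_vec_def)
  then have "(\<lambda>x. 1/2 * (partial (\<lambda>x. p x $ i) j x + partial (\<lambda>x. p x $ j) i x)) \<in> Poly k"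
    by (intro Poly_cmult Poly_add)
  then show ?thesis by (simp add: strain_nth jacobian_nth_Poly_vec[OF assms])
qed

lemma weak_grad_entry:
  assumes G: "has_weak_grad \<Omega> w G"
  shows "(\<lambda>x. G x $ a $ b) \<in> borel_measurable (lebesgue_on \<Omega>)"
    and "integrable (lebesgue_on \<Omega>) (\<lambda>x. (G x $ a $ b)\<^sup>2)"
proof -
  let ?M = "lebesgue_on \<Omega>"
  have Gm: "G \<in> borel_measurable ?M" and Gi: "integrable ?M (\<lambda>x. (norm (G x))\<^sup>2)"
    using G by (auto simp: has_weak_grad_def square_integrable_def)
  show Gnth: "(\<lambda>x. G x $ a $ b) \<in> borel_measurable ?M"
    by (rule measurable_compose[OF Gm])
       (intro borel_measurable_continuous_onI continuous_on_component continuous_on_id)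
  show "integrable ?M (\<lambda>x. (G x $ a $ b)\<^sup>2)"
  proof (rule Bochner_Integration.integrable_bound[OF Gi])
    have "\<bar>G x $ a $ b\<bar> \<le> norm (G x)" for x
      by (rule order_trans[OF component_le_norm_cart[of "G x $ a" b] Finite_Cartesian_Product.norm_nth_le])
    then show "AE x in ?M. norm ((G x $ a $ b)\<^sup>2) \<le> norm ((norm (G x))\<^sup>2)"
      by (intro AE_I2) (simp add: abs_le_square_iff[symmetric])
  qed (use Gnth in measurable)
qed

lemma weak_strain_entry:
  assumes G: "has_weak_grad \<Omega> w G"
  shows "(\<lambda>x. strain (G x) $ i $ j) \<in> borel_measurable (lebesgue_on \<Omega>)"
    and "integrable (lebesgue_on \<Omega>) (\<lambda>x. (strain (G x) $ i $ j)\<^sup>2)"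
proof -
  note Gnth = weak_grad_entry(1)[OF G] and Gsq = weak_grad_entry(2)[OF G]
  show "(\<lambda>x. strain (G x) $ i $ j) \<in> borel_measurable (lebesgue_on \<Omega>)"
    unfolding strain_nth using Gnth[of i j] Gnth[of j i] by measurable
  have "(\<lambda>x. (strain (G x) $ i $ j)\<^sup>2)
      = (\<lambda>x. ((G x $ i $ j)\<^sup>2 + 2 * (G x $ i $ j * G x $ j $ i) + (G x $ j $ i)\<^sup>2) / 4)"
    by (auto simp: strain_nth fun_eq_iff power2_eq_square field_simps)
  then show "integrable (lebesgue_on \<Omega>) (\<lambda>x. (strain (G x) $ i $ j)\<^sup>2)"
    using Gsq integrable_mult_if_squares[OF Gnth Gnth Gsq Gsq] by simp
qed

text \<open>Testing with the bump times the polynomial strain entry turns the identity of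
\<open>weak_grad_tested_on_polynomial_piece\<close> into one between quadratic quantities; Young's inequality then absorbs the polynomial part.\<close>

lemma bump_strain_le_weak_strain:
  fixes w p :: "'n::finite vfield"
  assumes \<Omega>: "open \<Omega>" and w: "w \<in> borel_measurable (lebesgue_on \<Omega>)"
    and G: "has_weak_grad \<Omega> w G"
    and U: "open U" "U \<subseteq> \<Omega>" and p: "p \<in> Poly_vec k"
    and wp: "AE x in lebesgue_on U. w x = p x"
    and r: "r > 0" and ball: "cball x0 (r/2) \<subseteq> U"
  shows "(LINT y|lborel. bump x0 r y * (strain (jacobian p (at y)) $ i $ j)\<^sup>2)
     \<le> (LINT x|lebesgue_on \<Omega>. indicator U x * (strain (G x) $ i $ j)\<^sup>2)"
proof -
  let ?M = "lebesgue_on \<Omega>"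
  define q where "q = (\<lambda>x. strain (jacobian p (at x)) $ i $ j)"
  define \<psi> where "\<psi> = bump x0 r"
  define e where "e = (\<lambda>x. strain (G x) $ i $ j)"
  let ?K = "cball x0 (r/2)"
  have q: "q \<in> Poly k" unfolding q_def by (rule strain_jacobian_Poly[OF p])
  note cq = continuous_on_Poly[OF q]
  have c\<psi>: "continuous_on UNIV \<psi>" unfolding \<psi>_def by (rule continuous_on_bump)
  have \<psi>0: "\<psi> x = 0" if "x \<notin> ?K" for x using that r by (simp add: \<psi>_def bump_outside)
  have \<psi>U: "\<psi> x = 0" if "x \<notin> U" for x using that ball \<psi>0 by blast
  have \<psi>01: "0 \<le> \<psi> x" "\<psi> x \<le> 1" for x by (simp_all add: \<psi>_def bump_nonneg bump_le_1)
  have \<Omega>l: "\<Omega> \<in> sets lebesgue" using \<Omega> by auto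
  have mcont: "f \<in> borel_measurable ?M" if "continuous_on UNIV f" for f :: "real^'n \<Rightarrow> real"
    using borel_measurable_continuous_onI[OF that]
    by (intro measurable_restrict_space1) (simp add: measurable_completion)
  have Gnth: "(\<lambda>x. G x $ a $ b) \<in> borel_measurable ?M"
    and Gsq: "integrable ?M (\<lambda>x. (G x $ a $ b)\<^sup>2)" for a b
    using weak_grad_entry[OF G] by blast+
  have em: "e \<in> borel_measurable ?M" and esq: "integrable ?M (\<lambda>x. (e x)\<^sup>2)"
    unfolding e_def using weak_strain_entry[OF G] by blast+
  let ?t = "\<lambda>x. \<psi> x * q x"
  have st: "smooth ?t" unfolding \<psi>_def by (intro smooth_mult smooth_bump Poly_smooth[OF q])
  have t0: "?t x = 0" if "x \<notin> ?K" for x using \<psi>0[OF that] by simp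
  have ct: "continuous_on UNIV ?t" by (intro continuous_on_mult c\<psi> cq)
  have G_test: "(LINT x|?M. G x $ a $ b * ?t x) = (LINT x|lborel. jacobian p (at x) $ a $ b * ?t x)" for a b
    by (rule weak_grad_tested_on_polynomial_piece[OF \<Omega> w G U p wp st _ ball t0]) simp_all
  have Gt_int: "integrable ?M (\<lambda>x. G x $ a $ b * ?t x)" for a b
  proof (rule integrable_mult_if_squares[OF Gnth mcont[OF ct] Gsq])
    show "integrable ?M (\<lambda>x. (?t x)\<^sup>2)"
      by (rule integrable_lebesgue_on_continuous[where K = ?K])
         (use \<psi>0 \<Omega>l in \<open>auto intro!: continuous_intros c\<psi> cq\<close>)
  qed
  have Jt_int: "integrable lborel (\<lambda>x. jacobian p (at x) $ a $ b * ?t x)" for a b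
  proof (rule integrable_compact_support[where K = ?K])
    have "partial (\<lambda>x. p x $ a) b \<in> Poly k"
      using p Poly_partial[of "\<lambda>x. p x $ a" k] by (simp add: Poly_vec_def)
    then show "continuous_on UNIV (\<lambda>x. jacobian p (at x) $ a $ b * ?t x)"
      unfolding jacobian_nth_Poly_vec[OF p] by (intro continuous_on_mult ct continuous_on_Poly)
  qed (use \<psi>0 in auto)
  have "(LINT x|?M. e x * ?t x) = (LINT x|?M. (G x $ i $ j * ?t x + G x $ j $ i * ?t x) / 2)"
    by (simp add: e_def strain_nth field_simps)
  also have "\<dots> = ((LINT x|?M. G x $ i $ j * ?t x) + (LINT x|?M. G x $ j $ i * ?t x)) / 2"
    using Gt_int by simp
  also have "\<dots> = (LINT x|lborel. (jacobian p (at x) $ i $ j * ?t x + jacobian p (at x) $ j $ i * ?t x) / 2)"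
    using G_test Jt_int by simp
  also have "\<dots> = (LINT x|lborel. \<psi> x * (q x)\<^sup>2)"
    by (rule Bochner_Integration.integral_cong) (simp_all add: q_def strain_nth power2_eq_square field_simps)
  finally have test: "(LINT x|?M. e x * ?t x) = (LINT x|lborel. \<psi> x * (q x)\<^sup>2)" .
  have et_int: "integrable ?M (\<lambda>x. e x * ?t x)"
  proof (rule integrable_mult_if_squares[OF em mcont[OF ct] esq])
    show "integrable ?M (\<lambda>x. (?t x)\<^sup>2)"
      by (rule integrable_lebesgue_on_continuous[where K = ?K])
         (use \<psi>0 \<Omega>l in \<open>auto intro!: continuous_intros c\<psi> cq\<close>)
  qed
  have qq_int: "integrable ?M (\<lambda>x. \<psi> x * (q x)\<^sup>2)"
    by (rule integrable_lebesgue_on_continuous[where K = ?K])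
       (use \<psi>0 \<Omega>l in \<open>auto intro!: continuous_intros c\<psi> cq\<close>)
  have qq: "(LINT x|?M. \<psi> x * (q x)\<^sup>2) = (LINT x|lborel. \<psi> x * (q x)\<^sup>2)"
  proof (rule integral_lebesgue_on_eq_lborel[OF \<Omega>l])
    have c: "continuous_on UNIV (\<lambda>x. \<psi> x * (q x)\<^sup>2)" by (intro continuous_intros c\<psi> cq)
    show "(\<lambda>x. \<psi> x * (q x)\<^sup>2) \<in> borel_measurable ?M" by (rule mcont[OF c])
    show "(\<lambda>x. \<psi> x * (q x)\<^sup>2) \<in> borel_measurable borel" by (rule borel_measurable_continuous_onI[OF c])
  qed (use \<psi>U U in auto)
  have Ue_int: "integrable ?M (\<lambda>x. indicator U x * (e x)\<^sup>2)"
  proof -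
    have "U \<in> sets lebesgue" using U by auto
    then have "U \<in> sets ?M" using U \<Omega>l by (auto simp: sets_restrict_space)
    from integrable_mult_indicator[OF this esq] show ?thesis by simp
  qed
  have "2 * (LINT x|?M. e x * ?t x) \<le> (LINT x|?M. indicator U x * (e x)\<^sup>2 + \<psi> x * (q x)\<^sup>2)"
    unfolding integral_mult_right_zero[symmetric]
  proof (rule integral_mono)
    fix x
    have "2 * (e x * q x) \<le> (e x)\<^sup>2 + (q x)\<^sup>2" using sum_squares_bound[of "e x" "q x"] by simp
    then have "\<psi> x * (2 * (e x * q x)) \<le> \<psi> x * ((e x)\<^sup>2 + (q x)\<^sup>2)" using \<psi>01 by (intro mult_left_mono)
    moreover have "\<psi> x * (e x)\<^sup>2 \<le> indicator U x * (e x)\<^sup>2"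
      using \<psi>U \<psi>01 by (intro mult_right_mono) (auto simp: indicator_def)
    ultimately show "2 * (e x * ?t x) \<le> indicator U x * (e x)\<^sup>2 + \<psi> x * (q x)\<^sup>2"
      by (simp add: algebra_simps)
  qed (use et_int Ue_int qq_int in auto)
  also have "\<dots> = (LINT x|?M. indicator U x * (e x)\<^sup>2) + (LINT x|?M. \<psi> x * (q x)\<^sup>2)"
    using Ue_int qq_int by simp
  finally have "(LINT x|lborel. \<psi> x * (q x)\<^sup>2) \<le> (LINT x|?M. indicator U x * (e x)\<^sup>2)"
    unfolding test qq by simp
  then show ?thesis by (simp add: \<psi>_def q_def e_def)
qed

section \<open>The inverse estimate for the strain\<close>

lemma norm_square_vec: "(norm (x :: 'a::real_inner^'n))\<^sup>2 = (\<Sum>i\<in>UNIV. (norm (x $ i))\<^sup>2)"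
  by (simp add: power2_norm_eq_inner inner_vec_def)

lemma norm_square_mat: "(norm (A :: real^'n^'m))\<^sup>2 = (\<Sum>i\<in>UNIV. \<Sum>j\<in>UNIV. (A $ i $ j)\<^sup>2)"
  by (simp add: norm_square_vec)

lemma integrable_weak_strain_square:
  fixes G :: "'n::finite mfield"
  assumes G: "has_weak_grad \<Omega> w G"
  shows "integrable (lebesgue_on \<Omega>) (\<lambda>x. (norm (strain (G x)))\<^sup>2)"
  unfolding norm_square_mat by (intro Bochner_Integration.integrable_sum weak_strain_entry[OF G])

text \<open>The sup bound for polynomials and the comparison with the weak strain, combined entry by entry.
In applications \<open>U\<close> is the interior of a mesh element, and \<open>\<rho>\<close> is twice the shape regularity constant.\<close>

lemma strain_inverse_inequality:
  "\<exists>C>0. \<forall>(w :: 'n::finite vfield) G \<Omega> U p x0 r x.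
     open \<Omega> \<longrightarrow> w \<in> borel_measurable (lebesgue_on \<Omega>) \<longrightarrow> has_weak_grad \<Omega> w G \<longrightarrow>
     open U \<longrightarrow> U \<subseteq> \<Omega> \<longrightarrow> p \<in> Poly_vec k \<longrightarrow> (AE x in lebesgue_on U. w x = p x) \<longrightarrow>
     r > 0 \<longrightarrow> cball x0 (r/2) \<subseteq> U \<longrightarrow> dist x0 x \<le> \<rho> * r \<longrightarrow>
     (norm (strain (jacobian p (at x))))\<^sup>2 * r ^ CARD('n)
       \<le> C * (LINT y|lebesgue_on \<Omega>. indicator U y * (norm (strain (G y)))\<^sup>2)"
proof -
  obtain C where "C > 0" and C: "\<And>q x0 (x :: real^'n) r. q \<in> Poly k \<Longrightarrow> r > 0 \<Longrightarrow> dist x0 x \<le> \<rho> * r \<Longrightarrow>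
     (q x)\<^sup>2 * r ^ CARD('n) \<le> C * (LINT y|lborel. bump x0 r y * (q y)\<^sup>2)"
    using Poly_le_bump_integral_scaled[where m = k and \<rho> = \<rho> and 'n = 'n] by blast
  show ?thesis
  proof (intro exI conjI allI impI)
    fix w :: "'n vfield" and G \<Omega> U p x0 r x
    assume \<Omega>: "open \<Omega>" and w: "w \<in> borel_measurable (lebesgue_on \<Omega>)" and G: "has_weak_grad \<Omega> w G"
      and U: "open U" "U \<subseteq> \<Omega>" and p: "p \<in> Poly_vec k" and wp: "AE x in lebesgue_on U. w x = p x"
      and r: "r > 0" and ball: "cball x0 (r/2) \<subseteq> U" and x: "dist x0 x \<le> \<rho> * r"
    let ?M = "lebesgue_on \<Omega>"
    have "U \<in> sets ?M" using U \<Omega> by (auto simp: sets_restrict_space)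
    then have int: "integrable ?M (\<lambda>y. indicator U y * (strain (G y) $ i $ j)\<^sup>2)" for i j
      using integrable_mult_indicator[OF _ weak_strain_entry(2)[OF G, of i j]] by fastforce
    have "(norm (strain (jacobian p (at x))))\<^sup>2 * r ^ CARD('n)
        = (\<Sum>i\<in>UNIV. \<Sum>j\<in>UNIV. (strain (jacobian p (at x)) $ i $ j)\<^sup>2 * r ^ CARD('n))"
      by (simp add: norm_square_mat sum_distrib_right)
    also have "\<dots> \<le> (\<Sum>i\<in>UNIV. \<Sum>j\<in>UNIV. C * (LINT y|?M. indicator U y * (strain (G y) $ i $ j)\<^sup>2))"
    proof (intro sum_mono)
      fix i j
      have "(strain (jacobian p (at x)) $ i $ j)\<^sup>2 * r ^ CARD('n)
          \<le> C * (LINT y|lborel. bump x0 r y * (strain (jacobian p (at y)) $ i $ j)\<^sup>2)"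
        using C[OF strain_jacobian_Poly[OF p] r x] .
      also have "\<dots> \<le> C * (LINT y|?M. indicator U y * (strain (G y) $ i $ j)\<^sup>2)"
        using \<open>C > 0\<close> bump_strain_le_weak_strain[OF \<Omega> w G U p wp r ball] by (intro mult_left_mono) auto
      finally show "(strain (jacobian p (at x)) $ i $ j)\<^sup>2 * r ^ CARD('n)
          \<le> C * (LINT y|?M. indicator U y * (strain (G y) $ i $ j)\<^sup>2)" .
    qed
    also have "\<dots> = C * (LINT y|?M. (\<Sum>i\<in>UNIV. \<Sum>j\<in>UNIV. indicator U y * (strain (G y) $ i $ j)\<^sup>2))"
      using int by (simp only: sum_distrib_left Bochner_Integration.integral_sum
          Bochner_Integration.integrable_sum)
    also have "\<dots> = C * (LINT y|?M. indicator U y * (norm (strain (G y)))\<^sup>2)"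
      by (simp only: norm_square_mat sum_distrib_left)
    finally show "(norm (strain (jacobian p (at x))))\<^sup>2 * r ^ CARD('n)
       \<le> C * (LINT y|?M. indicator U y * (norm (strain (G y)))\<^sup>2)" .
  qed fact
qed

section \<open>Bounds for the elastic stress\<close>

lemma norm_matrix_vector_le: "norm (A *v x) \<le> norm (A :: real^'n^'m) * norm x"
proof -
  have "(norm (A *v x))\<^sup>2 = (\<Sum>i\<in>UNIV. (A $ i \<bullet> x)\<^sup>2)"
    by (simp add: norm_square_vec matrix_vector_mult_def inner_vec_def)
  also have "\<dots> \<le> (\<Sum>i\<in>UNIV. (norm (A $ i))\<^sup>2 * (norm x)\<^sup>2)"
    by (intro sum_mono) (metis Cauchy_Schwarz_ineq2 abs_ge_zero power2_abs power_mono power_mult_distrib)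
  also have "\<dots> = (norm A * norm x)\<^sup>2"
    by (simp add: power_mult_distrib norm_square_vec[of A] sum_distrib_right)
  finally show ?thesis by (rule power2_le_imp_le) simp
qed

lemma stress_bounded_by_strain:
  "\<exists>B>0. \<forall>G :: real^'n^'n. norm (stress E \<nu> G) \<le> B * norm (strain G)"
proof -
  define L where "L S = (E / (1 + \<nu>)) *\<^sub>R S + (E * \<nu> / ((1 + \<nu>) * (1 - 2 * \<nu>)) * trace S) *\<^sub>R mat 1"
    for S :: "real^'n^'n"
  have "linear L"
    unfolding L_def
    by (intro linearI) (simp_all add: trace_def sum.distrib sum_distrib_left algebra_simps)
  then obtain B where "B > 0" "\<And>S. norm (L S) \<le> B * norm S" using linear_bounded_pos by blast
  moreover have "stress E \<nu> G = L (strain G)" for G :: "real^'n^'n" by (simp add: L_def stress_def)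
  ultimately show ?thesis by auto
qed

text \<open>For \<open>\<nu> \<ge> 0\<close> the trace term is nonnegative. For \<open>\<nu> < 0\<close> it is bounded from below by
\<open>(tr S)\<^sup>2 \<le> d |S|\<^sup>2\<close>, and the resulting coefficient is a positive multiple of \<open>1 - 2\<nu> + d\<nu>\<close>, which for
\<open>\<nu> > -1\<close> is positive in dimensions two and three.\<close>

lemma stress_coercive:
  assumes "CARD('n) \<in> {2, 3}" and E: "E > 0" and \<nu>: "-1 < \<nu>" "\<nu> < 1/2"
  shows "\<exists>c>0. \<forall>G :: real^'n^'n. c * (norm (strain G))\<^sup>2 \<le> stress E \<nu> G \<bullet> strain G"
proof -
  define a where "a = E / (1 + \<nu>)"
  define b where "b = E * \<nu> / ((1 + \<nu>) * (1 - 2 * \<nu>))"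
  let ?d = "real CARD('n)"
  have a: "a > 0" using E \<nu> by (simp add: a_def)
  have "a + ?d * b > 0"
  proof -
    have "a + ?d * b = E * (1 - 2 * \<nu> + ?d * \<nu>) / ((1 + \<nu>) * (1 - 2 * \<nu>))"
      using \<nu> by (simp add: a_def b_def divide_simps) (simp add: algebra_simps)
    moreover have "1 - 2 * \<nu> + ?d * \<nu> > 0" using assms(1) \<nu> by auto
    ultimately show ?thesis using E \<nu> by simp
  qed
  have form: "stress E \<nu> G \<bullet> strain G = a * (norm (strain G))\<^sup>2 + b * (trace (strain G))\<^sup>2" for G :: "real^'n^'n"
  proof -
    have "mat 1 \<bullet> S = trace S" for S :: "real^'n^'n"
      by (simp add: inner_vec_def mat_def trace_def if_distrib[of "\<lambda>x. x * _"] cong: if_cong)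
    then show ?thesis
      by (simp add: stress_def a_def b_def inner_add_left power2_norm_eq_inner) (simp add: power2_eq_square)
  qed
  have tr: "(trace S)\<^sup>2 \<le> ?d * (norm S)\<^sup>2" for S :: "real^'n^'n"
  proof -
    have "(trace S)\<^sup>2 \<le> ?d * (\<Sum>i\<in>UNIV. (S $ i $ i)\<^sup>2)"
      unfolding trace_def using sum_squared_le_sum_of_squares[of "\<lambda>i. S $ i $ i" UNIV] by (simp add: mult.commute)
    also have "(\<Sum>i\<in>UNIV. (S $ i $ i)\<^sup>2) \<le> (\<Sum>i\<in>UNIV. \<Sum>j\<in>UNIV. (S $ i $ j)\<^sup>2)"
      by (intro sum_mono member_le_sum) auto
    finally show ?thesis by (simp add: norm_square_mat mult_left_mono)
  qed
  have "min a (a + ?d * b) * (norm (strain G))\<^sup>2 \<le> stress E \<nu> G \<bullet> strain G" for G :: "real^'n^'n"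
  proof (cases "b \<ge> 0")
    case True
    have "min a (a + ?d * b) * (norm (strain G))\<^sup>2 \<le> a * (norm (strain G))\<^sup>2" by (intro mult_right_mono) auto
    then show ?thesis unfolding form using True by (smt (verit) mult_nonneg_nonneg zero_le_power2)
  next
    case False
    have "min a (a + ?d * b) * (norm (strain G))\<^sup>2 \<le> (a + ?d * b) * (norm (strain G))\<^sup>2" by (intro mult_right_mono) auto
    moreover have "b * (?d * (norm (strain G))\<^sup>2) \<le> b * (trace (strain G))\<^sup>2"
      using tr False by (intro mult_left_mono_neg) auto
    ultimately show ?thesis unfolding form by (simp add: algebra_simps)
  qed
  then show ?thesis using a \<open>a + ?d * b > 0\<close> by (intro exI[of _ "min a (a + ?d * b)"]) auto
qed

section \<open>Geometry of simplices and triangulations\<close>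

text \<open>The inradius is a supremum; going down to half of it yields an actual ball, hence the factor 2.\<close>

lemma simplex_inner_ball:
  fixes T :: "(real^'n) set"
  assumes T: "int CARD('n) simplex T" and \<kappa>: "\<kappa> > 0" and reg: "diameter T \<le> \<kappa> * inradius T"
  obtains x0 r where "r > 0" "cball x0 r \<subseteq> T" "diameter T \<le> 2 * \<kappa> * r" "diameter T > 0"
proof -
  have bT: "bounded T" using T simplex_imp_polytope polytope_imp_bounded by blast
  have "aff_dim T = int CARD('n)" using T aff_dim_simplex by blast
  then have ad: "aff_dim T > 0" by simp
  then obtain x where x: "x \<in> T" using aff_dim_empty by fastforce
  have "T \<noteq> {x}" using ad aff_dim_sing[of x] by auto
  then obtain y where y: "y \<in> T" "y \<noteq> x" using x by blast
  have "0 < dist x y" using y by simp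
  also have "\<dots> \<le> diameter T" using diameter_bounded_bound[OF bT x y(1)] .
  finally have D: "diameter T > 0" .
  let ?R = "{r. 0 \<le> r \<and> (\<exists>x. cball x r \<subseteq> T)}"
  have "0 < inradius T" using D reg \<kappa> by (smt (verit) mult_nonneg_nonpos)
  then have "inradius T / 2 < Sup ?R" by (simp add: inradius_def)
  moreover have "0 \<in> ?R" using x by auto
  ultimately obtain r where r: "r \<in> ?R" "inradius T / 2 < r" using less_cSupD[of ?R] by blast
  then obtain x0 where "cball x0 r \<subseteq> T" by blast
  moreover have "r > 0" using r \<open>0 < inradius T\<close> by linarith
  moreover have "\<kappa> * inradius T \<le> \<kappa> * (2 * r)" using r \<kappa> by (intro mult_left_mono) auto
  ultimately show ?thesis using that D reg by auto
qed

lemma card_facets_simplex_le: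
  assumes "n simplex T"
  shows "finite {F. F facet_of T}" and "card {F. F facet_of T} \<le> 2 ^ nat (n + 1)"
proof -
  obtain C where C: "\<not> affine_dependent C" "int (card C) = n + 1" "T = convex hull C"
    using assms by (auto simp: simplex_def)
  have fin: "finite C" using C(1) aff_independent_finite by blast
  have sub: "{F. F facet_of T} \<subseteq> (\<lambda>c. convex hull c) ` Pow C"
    using face_of_convex_hull_affine_independent[OF C(1)] C(3) by (auto simp: facet_of_def)
  show "finite {F. F facet_of T}" using finite_subset[OF sub] fin by simp
  have "card {F. F facet_of T} \<le> card ((\<lambda>c. convex hull c) ` Pow C)" using fin by (intro card_mono sub) simp
  also have "\<dots> \<le> card (Pow C)" using fin by (intro card_image_le) simp
  also have "\<dots> = 2 ^ nat (n + 1)" using fin C(2) by (simp add: card_Pow flip: C(2))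
  finally show "card {F. F facet_of T} \<le> 2 ^ nat (n + 1)" .
qed

lemma facet_in_hyperplane:
  fixes T :: "(real^'n) set"
  assumes "F facet_of T"
  obtains a c where "a \<noteq> 0" "F \<subseteq> {x. a \<bullet> x = c}"
proof -
  have "aff_dim F < int (DIM(real^'n))"
    using assms aff_dim_le_DIM[of T] by (simp add: facet_of_def)
  then show ?thesis using aff_lowdim_subset_hyperplane[of F] that by blast
qed

text \<open>A face that meets the relative interior of a convex subset contains that subset. So if the relative
interiors of \<open>F\<close> and \<open>F'\<close> meet, both are faces of \<open>T \<inter> T'\<close>, and faces whose relative interiors meet
coincide.\<close>

lemma triangulation_facets_rel_interior_disjoint:
  assumes tri: "triangulation \<T>" and T: "T \<in> \<T>" "F facet_of T" and T': "T' \<in> \<T>" "F' facet_of T'"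
    and x: "x \<in> rel_interior F" "x \<in> rel_interior F'"
  shows "F = F'"
proof -
  have face: "F face_of T" "F' face_of T'" using T T' by (auto simp: facet_of_def)
  have TT: "(T \<inter> T') face_of T" "(T' \<inter> T) face_of T'" using tri T T' unfolding triangulation_def by auto
  have xx: "x \<in> F" "x \<in> F'" using x rel_interior_subset by blast+
  have "F \<subseteq> T \<inter> T'"
    using subset_of_face_of[OF TT(1)] face_of_imp_subset[OF face(1)] x xx face_of_imp_subset[OF face(2)] by blast
  moreover have "F' \<subseteq> T' \<inter> T"
    using subset_of_face_of[OF TT(2)] face_of_imp_subset[OF face(2)] x xx face_of_imp_subset[OF face(1)] by blast
  ultimately have "F face_of (T \<inter> T')" "F' face_of (T \<inter> T')"
    using face face_of_subset by (metis inf.cobounded1 inf_commute)+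
  then show ?thesis using face_of_eq x by blast
qed

lemma triangulation_interiors_disjoint:
  assumes tri: "triangulation \<T>" and T: "T \<in> \<T>" "T' \<in> \<T>" and x: "x \<in> interior T" "x \<in> interior T'"
  shows "T = T'"
proof -
  have TT: "(T \<inter> T') face_of T" "(T' \<inter> T) face_of T'" using tri T unfolding triangulation_def by auto
  have "T \<subseteq> T \<inter> T'"
    using subset_of_face_of[OF TT(1), of T] x interior_subset interior_subset_rel_interior by blast
  moreover have "T' \<subseteq> T' \<inter> T"
    using subset_of_face_of[OF TT(2), of T'] x interior_subset interior_subset_rel_interior by blast
  ultimately show ?thesis by blast
qed

lemma borel_rel_interior: "rel_interior (F :: 'a::euclidean_space set) \<in> sets borel"
proof -
  obtain U where "open U" "rel_interior F = affine hull F \<inter> U"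
    using openin_rel_interior[of F] unfolding openin_open by blast
  then show ?thesis by (simp add: borel_closed)
qed

section \<open>The discrete trace inequality\<close>

lemma stress_nth: "stress E \<nu> G $ i $ j = E / (1 + \<nu>) * strain G $ i $ j
    + E * \<nu> / ((1 + \<nu>) * (1 - 2 * \<nu>)) * (\<Sum>l\<in>UNIV. strain G $ l $ l) * mat 1 $ i $ j"
  by (simp add: stress_def trace_def)

lemma borel_measurable_surface_on:
  fixes f :: "real^'n \<Rightarrow> 'b::topological_space"
  shows "f \<in> borel_measurable borel \<Longrightarrow> f \<in> borel_measurable (surface_on \<Gamma>)"
  unfolding surface_on_def
  by (intro measurable_restrict_space1) (simp add: measurable_cong_sets[OF sets_surface_measure refl])

text \<open>The facet is contained in a ball of radius \<open>D\<close> and in a hyperplane, which bounds its measure; on it the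
squared traction is at most \<open>B\<^sup>2 m\<close> almost everywhere, because the normal has length 1.\<close>

lemma facet_traction_integral_le:
  fixes n p :: "'n::finite vfield"
  assumes card: "CARD('n) \<ge> 2" and \<Gamma>: "\<Gamma> \<in> sets borel"
    and n: "n \<in> borel_measurable (surface_on \<Gamma>)" "AE x in surface_on \<Gamma>. norm (n x) = 1"
    and F: "F \<subseteq> \<Gamma>" "F facet_of T" "F \<subseteq> cball y D" "diameter F \<le> D" "0 \<le> diameter F" and D: "D > 0"
    and p: "p \<in> Poly_vec k"
    and B: "\<And>G :: real^'n^'n. norm (stress E \<nu> G) \<le> B * norm (strain G)" "B > 0"
    and m: "\<And>x. x \<in> F \<Longrightarrow> (norm (strain (jacobian p (at x))))\<^sup>2 \<le> m" "m \<ge> 0"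
  defines "f \<equiv> \<lambda>x. diameter F * indicator (rel_interior F) x * (norm (stress E \<nu> (jacobian p (at x)) *v n x))\<^sup>2"
  shows "integrable (surface_on \<Gamma>) f"
    and "(LINT x|surface_on \<Gamma>. f x)
      \<le> D * (B\<^sup>2 * m) * (unit_ball_vol (real (CARD('n) - 1)) * (3 * real CARD('n) * D) ^ (CARD('n) - 1))"
proof -
  let ?M = "surface_on \<Gamma>"
  let ?c = "unit_ball_vol (real (CARD('n) - 1)) * (3 * real CARD('n) * D) ^ (CARD('n) - 1)"
  let ?F = "rel_interior F"
  have sub: "?F \<subseteq> F" by (rule rel_interior_subset)
  have setF: "?F \<in> sets ?M"
    using borel_rel_interior[of F] sub F(1) \<Gamma>
    by (auto simp: surface_on_def sets_restrict_space sets_surface_measure)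
  obtain a c where a: "a \<noteq> 0" "F \<subseteq> {x. a \<bullet> x = c}" using facet_in_hyperplane[OF F(2)] by blast
  have "emeasure ?M ?F = emeasure surface_measure ?F"
    using \<Gamma> sub F(1) unfolding surface_on_def
    by (intro emeasure_restrict_space) (auto simp: sets_surface_measure)
  also have "\<dots> \<le> ennreal ?c"
    using surface_measure_hyperplane_le[OF card a(1) _ D, of ?F c y] a(2) F(3) sub by blast
  finally have em: "emeasure ?M ?F \<le> ennreal ?c" .
  then have fin: "emeasure ?M ?F < \<infinity>" by (rule le_less_trans) simp
  have c0: "0 \<le> ?c" using D by simp
  have meas: "measure ?M ?F \<le> ?c"
    using enn2real_mono[OF em] c0 by (simp add: measure_def)
  have nj: "(\<lambda>x. n x $ j) \<in> borel_measurable ?M" for j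
    by (rule measurable_compose[OF n(1)])
       (intro borel_measurable_continuous_onI continuous_on_component continuous_on_id)
  have sj: "(\<lambda>x. stress E \<nu> (jacobian p (at x)) $ i $ j) \<in> borel_measurable ?M" for i j
    unfolding stress_nth using continuous_on_Poly[OF strain_jacobian_Poly[OF p]]
    by (intro borel_measurable_surface_on borel_measurable_continuous_onI continuous_on_add
        continuous_on_mult continuous_on_const continuous_on_sum)
  have "(\<lambda>x. (norm (stress E \<nu> (jacobian p (at x)) *v n x))\<^sup>2) \<in> borel_measurable ?M"
    unfolding norm_square_vec matrix_vector_mult_def using nj sj by simp
  then have fm: "f \<in> borel_measurable ?M"
    unfolding f_def using setF by (intro borel_measurable_times) auto
  let ?g = "\<lambda>x. D * (B\<^sup>2 * m) * indicator ?F x :: real"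
  have gi: "integrable ?M ?g"
    using setF fin by (intro integrable_mult_right) (auto simp: integrable_indicator_iff)
  have f0: "0 \<le> f x" for x using F(5) by (simp add: f_def)
  have fg: "AE x in ?M. f x \<le> ?g x"
    using n(2)
  proof eventually_elim
    case (elim x)
    show ?case
    proof (cases "x \<in> ?F")
      case True
      have "norm (stress E \<nu> (jacobian p (at x)) *v n x) \<le> B * norm (strain (jacobian p (at x)))"
        using norm_matrix_vector_le[of "stress E \<nu> (jacobian p (at x))" "n x"] B(1)[of "jacobian p (at x)"] elim by simp
      then have "(norm (stress E \<nu> (jacobian p (at x)) *v n x))\<^sup>2 \<le> (B * norm (strain (jacobian p (at x))))\<^sup>2"
        by (intro power_mono) auto
      also have "\<dots> \<le> B\<^sup>2 * m"
        using m(1) sub True by (auto simp: power_mult_distrib intro!: mult_left_mono)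
      finally have "diameter F * (norm (stress E \<nu> (jacobian p (at x)) *v n x))\<^sup>2 \<le> D * (B\<^sup>2 * m)"
        using F(4,5) D by (intro mult_mono) auto
      then show ?thesis using True by (simp add: f_def)
    qed (simp add: f_def)
  qed
  show fi: "integrable ?M f"
    by (rule Bochner_Integration.integrable_bound[OF gi fm])
       (use fg in \<open>eventually_elim, use f0 in \<open>auto simp: abs_of_nonneg intro: order_trans[OF _ abs_ge_self]\<close>\<close>)
  have "(LINT x|?M. f x) \<le> (LINT x|?M. ?g x)" by (rule integral_mono_AE[OF fi gi fg])
  also have "\<dots> = D * (B\<^sup>2 * m) * measure ?M ?F"
    using setF fin sets.sets_into_space[OF setF] by (simp add: Int_absorb1 Int_absorb2)
  also have "\<dots> \<le> D * (B\<^sup>2 * m) * ?c" using meas D m(2) by (intro mult_left_mono) auto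
  finally show "(LINT x|?M. f x) \<le> D * (B\<^sup>2 * m) * ?c" .
qed

text \<open>Both factors are sums over all facets. At each point at most one summand of each is nonzero, so the
mixed products vanish.\<close>

lemma h_Gamma_normal_stress_square:
  assumes mesh: "simplicial_mesh \<Omega> \<T>" and fin: "finite (facets_on \<T> \<Gamma>)"
  shows "h_Gamma \<T> \<Gamma> x * (norm (normal_stress k E \<nu> \<T> \<Gamma> n w x))\<^sup>2
    = (\<Sum>F\<in>facets_on \<T> \<Gamma>. diameter F * indicator (rel_interior F) x *
        (norm (stress E \<nu> (jacobian (local_poly k w (adjacent_element \<T> F)) (at x)) *v n x))\<^sup>2)"
proof (cases "\<exists>F\<in>facets_on \<T> \<Gamma>. x \<in> rel_interior F")
  case False
  then show ?thesis by (simp add: h_Gamma_def)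
next
  case True
  then obtain F where F: "F \<in> facets_on \<T> \<Gamma>" "x \<in> rel_interior F" by blast
  have tri: "triangulation \<T>" using mesh by (simp add: simplicial_mesh_def)
  have uniq: "x \<notin> rel_interior F'" if F': "F' \<in> facets_on \<T> \<Gamma> - {F}" for F'
  proof
    assume x: "x \<in> rel_interior F'"
    obtain T T' where "T \<in> \<T>" "F facet_of T" "T' \<in> \<T>" "F' facet_of T'"
      using F(1) F' unfolding facets_on_def by blast
    from triangulation_facets_rel_interior_disjoint[OF tri this F(2) x] F' show False by blast
  qed
  show ?thesis
    unfolding h_Gamma_def normal_stress_def sum.remove[OF fin F(1)] using F uniq by simp
qed

lemma finite_facets_on:
  assumes "simplicial_mesh \<Omega> \<T>"
  shows "finite (facets_on \<T> \<Gamma>)"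
proof (rule finite_subset)
  show "facets_on \<T> \<Gamma> \<subseteq> (\<Union>T\<in>\<T>. {F. F facet_of T})" by (auto simp: facets_on_def)
  show "finite (\<Union>T\<in>\<T>. {F. F facet_of T})"
    using assms card_facets_simplex_le(1) unfolding simplicial_mesh_def triangulation_def by blast
qed

lemma adjacent_element:
  assumes "F \<in> facets_on \<T> \<Gamma>"
  shows "adjacent_element \<T> F \<in> \<T>" "F facet_of adjacent_element \<T> F"
proof -
  have "\<exists>T. T \<in> \<T> \<and> F facet_of T" using assms by (auto simp: facets_on_def)
  from someI_ex[OF this] show "adjacent_element \<T> F \<in> \<T>" "F facet_of adjacent_element \<T> F"
    by (simp_all add: adjacent_element_def)
qed

lemma local_poly:
  assumes "w \<in> Vh_space k \<Omega> \<Gamma>D \<T>" "T \<in> \<T>"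
  shows "local_poly k w T \<in> Poly_vec k" "AE x in lebesgue_on T. w x = local_poly k w T x"
proof -
  have "\<exists>p. p \<in> Poly_vec k \<and> (AE x in lebesgue_on T. w x = p x)"
    using assms by (auto simp: Vh_space_def)
  from someI_ex[OF this] show "local_poly k w T \<in> Poly_vec k" "AE x in lebesgue_on T. w x = local_poly k w T x"
    by (simp_all add: local_poly_def)
qed

text \<open>An element is adjacent to no more facets than the simplex has, and each facet of the simplex is the
convex hull of a subset of its \<open>d+1\<close> vertices.\<close>

lemma sum_adjacent_elements_le:
  fixes \<Omega> :: "(real^'n) set"
  assumes mesh: "simplicial_mesh \<Omega> \<T>" and g: "\<And>T. T \<in> \<T> \<Longrightarrow> 0 \<le> (g T :: real)"
  shows "(\<Sum>F\<in>facets_on \<T> \<Gamma>. g (adjacent_element \<T> F)) \<le> 2 ^ (CARD('n) + 1) * (\<Sum>T\<in>\<T>. g T)"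
proof -
  let ?S = "facets_on \<T> \<Gamma>"
  have fin: "finite \<T>" "finite ?S"
    using mesh finite_facets_on by (auto simp: simplicial_mesh_def triangulation_def)
  have "(\<Sum>F\<in>?S. g (adjacent_element \<T> F)) = (\<Sum>T\<in>\<T>. \<Sum>F\<in>{F\<in>?S. adjacent_element \<T> F = T}. g (adjacent_element \<T> F))"
    using fin adjacent_element(1) by (intro sum.group[symmetric]) auto
  also have "\<dots> \<le> (\<Sum>T\<in>\<T>. 2 ^ (CARD('n) + 1) * g T)"
  proof (rule sum_mono)
    fix T assume T: "T \<in> \<T>"
    let ?A = "{F\<in>?S. adjacent_element \<T> F = T}"
    have sim: "int CARD('n) simplex T" using mesh T by (simp add: simplicial_mesh_def)
    have "?A \<subseteq> {F. F facet_of T}" using adjacent_element(2) by blast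
    then have "card ?A \<le> card {F. F facet_of T}" by (intro card_mono card_facets_simplex_le(1)[OF sim])
    also have "\<dots> \<le> 2 ^ nat (int CARD('n) + 1)" by (rule card_facets_simplex_le(2)[OF sim])
    also have "nat (int CARD('n) + 1) = CARD('n) + 1" by simp
    finally have "real (card ?A) \<le> real (2 ^ (CARD('n) + 1))" by (rule of_nat_mono)
    then have "real (card ?A) \<le> 2 ^ (CARD('n) + 1)" by simp
    then have "real (card ?A) * g T \<le> 2 ^ (CARD('n) + 1) * g T" using g[OF T] by (intro mult_right_mono)
    then show "(\<Sum>F\<in>?A. g (adjacent_element \<T> F)) \<le> 2 ^ (CARD('n) + 1) * g T" by simp
  qed
  finally show ?thesis by (simp add: sum_distrib_left)
qed

lemma sum_element_integrals_le:
  fixes f :: "real^'n \<Rightarrow> real"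
  assumes mesh: "simplicial_mesh \<Omega> \<T>" and \<Omega>: "open \<Omega>"
    and sub: "\<And>T. T \<in> \<T> \<Longrightarrow> interior T \<subseteq> \<Omega>"
    and f: "integrable (lebesgue_on \<Omega>) f" "\<And>x. 0 \<le> f x"
  shows "(\<Sum>T\<in>\<T>. LINT x|lebesgue_on \<Omega>. indicator (interior T) x * f x) \<le> (LINT x|lebesgue_on \<Omega>. f x)"
proof -
  have tri: "triangulation \<T>" using mesh by (simp add: simplicial_mesh_def)
  then have fin: "finite \<T>" by (simp add: triangulation_def)
  have int: "integrable (lebesgue_on \<Omega>) (\<lambda>x. indicator (interior T) x * f x)" if "T \<in> \<T>" for T
  proof -
    have "interior T \<in> sets (lebesgue_on \<Omega>)" using sub[OF that] \<Omega> by (auto simp: sets_restrict_space)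
    from integrable_mult_indicator[OF this f(1)] show ?thesis by simp
  qed
  have "(\<Sum>T\<in>\<T>. LINT x|lebesgue_on \<Omega>. indicator (interior T) x * f x)
      = (LINT x|lebesgue_on \<Omega>. (\<Sum>T\<in>\<T>. indicator (interior T) x * f x))"
    using int by (rule Bochner_Integration.integral_sum[symmetric])
  also have "\<dots> \<le> (LINT x|lebesgue_on \<Omega>. f x)"
  proof (rule integral_mono)
    show "(\<Sum>T\<in>\<T>. indicator (interior T) x * f x) \<le> f x" for x
    proof (cases "\<exists>T\<in>\<T>. x \<in> interior T")
      case True
      then obtain T where T: "T \<in> \<T>" "x \<in> interior T" by blast
      have "x \<notin> interior T'" if "T' \<in> \<T> - {T}" for T'
        using triangulation_interiors_disjoint[OF tri] that T by blast
      then show ?thesis unfolding sum.remove[OF fin T(1)] using T by simp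
    qed (use f(2) in simp)
  qed (use int f in \<open>auto intro: Bochner_Integration.integrable_sum\<close>)
  finally show ?thesis .
qed

text \<open>With \<open>D\<close> the diameter of the adjacent element and \<open>r\<close> the radius of a ball inside it, the measure of a
facet contributes \<open>D\<close> to the power \<open>d-1\<close>, the weight \<open>h\<^sub>\<Gamma>\<close> one more factor \<open>D\<close>, and the inverse estimate
\<open>r\<close> to the power \<open>-d\<close>. Shape regularity bounds the quotient \<open>D/r\<close>, so no power of the mesh size is left.\<close>

lemma discrete_trace_inequality:
  fixes \<Omega> :: "(real^'n) set"
  assumes card: "CARD('n) \<ge> 2" and \<Omega>: "polyhedral_domain \<Omega>" and \<Gamma>: "\<Gamma> \<in> sets borel"
    and n: "n \<in> borel_measurable (surface_on \<Gamma>)" "AE x in surface_on \<Gamma>. norm (n x) = 1"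
    and \<kappa>: "\<kappa> > 0"
  shows "\<exists>C>0. \<forall>\<T> \<Gamma>D w. simplicial_mesh \<Omega> \<T> \<longrightarrow> (\<forall>T\<in>\<T>. diameter T \<le> \<kappa> * inradius T) \<longrightarrow>
    w \<in> Vh_space k \<Omega> \<Gamma>D \<T> \<longrightarrow>
      integrable (surface_on \<Gamma>) (\<lambda>x. h_Gamma \<T> \<Gamma> x * (norm (normal_stress k E \<nu> \<T> \<Gamma> n w x))\<^sup>2) \<and>
      (LINT x|surface_on \<Gamma>. h_Gamma \<T> \<Gamma> x * (norm (normal_stress k E \<nu> \<T> \<Gamma> n w x))\<^sup>2)
        \<le> C * (LINT x|lebesgue_on \<Omega>. (norm (strain (weak_grad \<Omega> w x)))\<^sup>2)"
proof -
  let ?d = "CARD('n)"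
  obtain B where B: "B > 0" "\<And>G :: real^'n^'n. norm (stress E \<nu> G) \<le> B * norm (strain G)"
    using stress_bounded_by_strain by blast
  obtain A where A: "A > 0" "\<And>(w :: 'n vfield) G \<Omega> U p x0 r x.
     open \<Omega> \<Longrightarrow> w \<in> borel_measurable (lebesgue_on \<Omega>) \<Longrightarrow> has_weak_grad \<Omega> w G \<Longrightarrow>
     open U \<Longrightarrow> U \<subseteq> \<Omega> \<Longrightarrow> p \<in> Poly_vec k \<Longrightarrow> (AE x in lebesgue_on U. w x = p x) \<Longrightarrow>
     r > 0 \<Longrightarrow> cball x0 (r/2) \<subseteq> U \<Longrightarrow> dist x0 x \<le> (2 * \<kappa>) * r \<Longrightarrow>
     (norm (strain (jacobian p (at x))))\<^sup>2 * r ^ ?d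
       \<le> A * (LINT y|lebesgue_on \<Omega>. indicator U y * (norm (strain (G y)))\<^sup>2)"
    using strain_inverse_inequality[where k = k and \<rho> = "2 * \<kappa>" and 'n = 'n] by blast
  define H where "H = unit_ball_vol (real (?d - 1)) * (3 * real ?d) ^ (?d - 1)"
  define C1 where "C1 = B\<^sup>2 * A * H * (2 * \<kappa>) ^ ?d"
  have H: "H > 0" by (simp add: H_def)
  have C1: "C1 > 0" using B A H \<kappa> by (simp add: C1_def)
  have op: "open \<Omega>" "\<Omega> = interior (closure \<Omega>)" using \<Omega> by (auto simp: polyhedral_domain_def)
  show ?thesis
  proof (intro exI conjI allI impI)
    show "0 < C1 * 2 ^ (?d + 1)" using C1 by simp
  next
    fix \<T> \<Gamma>D and w :: "'n vfield"
    assume mesh: "simplicial_mesh \<Omega> \<T>" and reg: "\<forall>T\<in>\<T>. diameter T \<le> \<kappa> * inradius T"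
      and w: "w \<in> Vh_space k \<Omega> \<Gamma>D \<T>"
    let ?S = "facets_on \<T> \<Gamma>"
    let ?G = "weak_grad \<Omega> w"
    let ?T = "adjacent_element \<T>"
    let ?p = "\<lambda>F. local_poly k w (?T F)"
    let ?e = "\<lambda>x. (norm (strain (?G x)))\<^sup>2"
    let ?I = "\<lambda>T. LINT y|lebesgue_on \<Omega>. indicator (interior T) y * ?e y"
    define f where "f F x = diameter F * indicator (rel_interior F) x *
        (norm (stress E \<nu> (jacobian (?p F) (at x)) *v n x))\<^sup>2" for F x
    have wH: "w \<in> H1 \<Omega>" using w by (simp add: Vh_space_def V_space_def)
    have wm: "w \<in> borel_measurable (lebesgue_on \<Omega>)" using wH by (simp add: H1_def square_integrable_def)
    have G: "has_weak_grad \<Omega> w ?G"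
      using wH unfolding weak_grad_def H1_def by (intro someI_ex[of "has_weak_grad \<Omega> w"]) blast
    have fin: "finite ?S" using finite_facets_on[OF mesh] .
    have Tsub: "interior T \<subseteq> \<Omega>" if "T \<in> \<T>" for T
    proof -
      have "T \<subseteq> closure \<Omega>" using mesh that by (auto simp: simplicial_mesh_def)
      then show ?thesis using interior_mono op(2) by blast
    qed
    have facet: "integrable (surface_on \<Gamma>) (f F) \<and> (LINT x|surface_on \<Gamma>. f F x) \<le> C1 * ?I (?T F)"
      if F: "F \<in> ?S" for F
    proof -
      define T where "T = ?T F"
      have T: "T \<in> \<T>" "F facet_of T" using adjacent_element[OF F] by (simp_all add: T_def)
      have simplex: "int ?d simplex T" using mesh T by (simp add: simplicial_mesh_def)
      obtain x0 r where r: "r > 0" "cball x0 r \<subseteq> T" "diameter T \<le> 2 * \<kappa> * r" "diameter T > 0"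
        by (rule simplex_inner_ball[OF simplex \<kappa> bspec[OF reg T(1)]])
      have bT: "bounded T" using compact_simplex[OF simplex] compact_imp_bounded by blast
      have FT: "F \<subseteq> T" using T(2) facet_of_imp_subset by blast
      obtain y where y: "y \<in> F" using T(2) by (auto simp: facet_of_def)
      have x0: "x0 \<in> T" using r by auto
      have diamF: "diameter F \<le> diameter T" "0 \<le> diameter F"
        using diameter_subset[OF FT bT] diameter_ge_0 bounded_subset[OF bT FT] by blast+
      have Fball: "F \<subseteq> cball y (diameter T)"
        using diameter_bounded_bound[OF bT] FT y by (auto simp: subset_iff)
      have AE_int: "AE x in lebesgue_on (interior T). w x = ?p F x"
      proof -
        have "AE x in lebesgue_on T. w x = ?p F x"
          using local_poly(2)[OF w T(1)] by (simp add: T_def)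
        moreover have "T \<in> sets lebesgue" using closed_simplex[OF simplex] by auto
        ultimately have "AE x in lebesgue. x \<in> T \<longrightarrow> w x = ?p F x"
          by (subst (asm) AE_restrict_space_iff) auto
        then have "AE x in lebesgue. x \<in> interior T \<longrightarrow> w x = ?p F x"
          by eventually_elim (use interior_subset in blast)
        then show ?thesis by (subst AE_restrict_space_iff) auto
      qed
      have pT: "?p F \<in> Poly_vec k" using local_poly(1)[OF w T(1)] by (simp add: T_def)
      have "cball x0 (r/2) \<subseteq> ball x0 r" using r(1) by auto
      then have ball_int: "cball x0 (r/2) \<subseteq> interior T"
        using r(2) interior_maximal[of "ball x0 r" T] ball_subset_cball by blast
      define m where "m = A * ?I T / r ^ ?d"
      have I0: "0 \<le> ?I T" by (intro Bochner_Integration.integral_nonneg) simp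
      then have m0: "m \<ge> 0" using A r by (simp add: m_def)
      have sup: "(norm (strain (jacobian (?p F) (at x))))\<^sup>2 \<le> m" if "x \<in> F" for x
      proof -
        have "dist x0 x \<le> 2 * \<kappa> * r"
          using diameter_bounded_bound[OF bT x0, of x] FT that r(3) by auto
        from A(2)[OF op(1) wm G open_interior Tsub[OF T(1)] pT AE_int r(1) ball_int this]
        show ?thesis using r(1) by (simp add: m_def pos_le_divide_eq)
      qed
      have F\<Gamma>: "F \<subseteq> \<Gamma>" using F by (simp add: facets_on_def)
      note bound = facet_traction_integral_le[OF card \<Gamma> n F\<Gamma> T(2) Fball diamF r(4) pT B(2) B(1) sup m0]
      have "(LINT x|surface_on \<Gamma>. f F x) \<le> diameter T * (B\<^sup>2 * m) *
          (unit_ball_vol (real (?d - 1)) * (3 * real ?d * diameter T) ^ (?d - 1))"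
        unfolding f_def using bound(2) by simp
      also have "\<dots> = B\<^sup>2 * m * H * (diameter T * diameter T ^ (?d - 1))"
        by (simp add: H_def power_mult_distrib mult_ac)
      also have "diameter T * diameter T ^ (?d - 1) = diameter T ^ ?d"
        using card by (metis One_nat_def Suc_pred' power_Suc zero_less_card_finite)
      also have "B\<^sup>2 * m * H * diameter T ^ ?d \<le> B\<^sup>2 * m * H * (2 * \<kappa> * r) ^ ?d"
        using r H m0 by (intro mult_left_mono power_mono) auto
      also have "\<dots> = C1 * ?I T"
        using r(1) by (simp add: m_def C1_def power_mult_distrib)
      finally show ?thesis using bound(1) by (simp add: f_def[abs_def] T_def)
    qed
    have hs: "h_Gamma \<T> \<Gamma> x * (norm (normal_stress k E \<nu> \<T> \<Gamma> n w x))\<^sup>2 = (\<Sum>F\<in>?S. f F x)" for x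
      using h_Gamma_normal_stress_square[OF mesh fin] by (simp add: f_def)
    show "integrable (surface_on \<Gamma>) (\<lambda>x. h_Gamma \<T> \<Gamma> x * (norm (normal_stress k E \<nu> \<T> \<Gamma> n w x))\<^sup>2)"
      unfolding hs using facet by (intro Bochner_Integration.integrable_sum) auto
    have "(LINT x|surface_on \<Gamma>. h_Gamma \<T> \<Gamma> x * (norm (normal_stress k E \<nu> \<T> \<Gamma> n w x))\<^sup>2)
        = (\<Sum>F\<in>?S. LINT x|surface_on \<Gamma>. f F x)"
      unfolding hs using facet by (intro Bochner_Integration.integral_sum) auto
    also have "\<dots> \<le> (\<Sum>F\<in>?S. C1 * ?I (?T F))" using facet by (intro sum_mono) auto
    also have "\<dots> = C1 * (\<Sum>F\<in>?S. ?I (?T F))" by (simp add: sum_distrib_left)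
    also have "\<dots> \<le> C1 * (2 ^ (?d + 1) * (\<Sum>T\<in>\<T>. ?I T))"
      using C1 by (intro mult_left_mono sum_adjacent_elements_le[OF mesh] Bochner_Integration.integral_nonneg) auto
    also have "\<dots> \<le> C1 * (2 ^ (?d + 1) * (LINT x|lebesgue_on \<Omega>. ?e x))"
      using C1 integrable_weak_strain_square[OF G] Tsub
      by (intro mult_left_mono sum_element_integrals_le[OF mesh op(1)]) auto
    finally show "(LINT x|surface_on \<Gamma>. h_Gamma \<T> \<Gamma> x * (norm (normal_stress k E \<nu> \<T> \<Gamma> n w x))\<^sup>2)
        \<le> C1 * 2 ^ (?d + 1) * (LINT x|lebesgue_on \<Omega>. ?e x)" by (simp only: mult.assoc)
  qed
qed

section \<open>Coercivity of the stabilized form\<close>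

lemma outer_unit_normal_norm: "outer_unit_normal \<Omega> x v \<Longrightarrow> norm v = 1"
  by (simp add: outer_unit_normal_def)

lemma weak_grad_has_weak_grad: "w \<in> H1 \<Omega> \<Longrightarrow> has_weak_grad \<Omega> w (weak_grad \<Omega> w)"
  unfolding weak_grad_def H1_def by (intro someI_ex[of "has_weak_grad \<Omega> w"]) blast

text \<open>The upper bound for the stress serves to show that the energy density is integrable; without it the
pointwise coercivity could not be integrated.\<close>

lemma elastic_form_coercive:
  assumes "CARD('n) \<in> {2, 3}" and "E > 0" and "-1 < \<nu>" "\<nu> < 1/2"
  shows "\<exists>c>0. \<forall>\<Omega>. \<forall>w \<in> H1 (\<Omega> :: (real^'n) set).
    c * (LINT x|lebesgue_on \<Omega>. (norm (strain (weak_grad \<Omega> w x)))\<^sup>2) \<le> elastic_form E \<nu> \<Omega> w w"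
proof -
  obtain c where c: "c > 0" "\<And>G :: real^'n^'n. c * (norm (strain G))\<^sup>2 \<le> stress E \<nu> G \<bullet> strain G"
    using stress_coercive[OF assms] by blast
  obtain B where B: "B > 0" "\<And>G :: real^'n^'n. norm (stress E \<nu> G) \<le> B * norm (strain G)"
    using stress_bounded_by_strain by blast
  show ?thesis
  proof (intro exI conjI allI ballI)
    fix \<Omega> and w :: "'n vfield" assume w: "w \<in> H1 \<Omega>"
    let ?G = "weak_grad \<Omega> w"
    note G = weak_grad_has_weak_grad[OF w]
    note e = weak_strain_entry(1)[OF G]
    have meas: "(\<lambda>x. stress E \<nu> (?G x) \<bullet> strain (?G x)) \<in> borel_measurable (lebesgue_on \<Omega>)"
      unfolding inner_vec_def stress_nth using e by simp
    have int: "integrable (lebesgue_on \<Omega>) (\<lambda>x. stress E \<nu> (?G x) \<bullet> strain (?G x))"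
    proof (rule Bochner_Integration.integrable_bound[OF _ meas])
      show "integrable (lebesgue_on \<Omega>) (\<lambda>x. B * (norm (strain (?G x)))\<^sup>2)"
        using integrable_weak_strain_square[OF G] by simp
      have "\<bar>stress E \<nu> H \<bullet> strain H\<bar> \<le> B * (norm (strain H))\<^sup>2" for H :: "real^'n^'n"
        using Cauchy_Schwarz_ineq2[of "stress E \<nu> H" "strain H"]
          mult_right_mono[OF B(2)[of H] norm_ge_zero[of "strain H"]]
        by (simp add: power2_eq_square mult.assoc)
      then show "AE x in lebesgue_on \<Omega>. norm (stress E \<nu> (?G x) \<bullet> strain (?G x))
          \<le> norm (B * (norm (strain (?G x)))\<^sup>2)"
        using B(1) by (intro AE_I2) simp
    qed
    show "c * (LINT x|lebesgue_on \<Omega>. (norm (strain (?G x)))\<^sup>2) \<le> elastic_form E \<nu> \<Omega> w w"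
      unfolding elastic_form_def l2_inner_def integral_mult_right_zero[symmetric]
      using integrable_weak_strain_square[OF G] int c(2) by (intro integral_mono) auto
  qed fact
qed

lemma integrable_h_Gamma_mult:
  assumes mesh: "simplicial_mesh \<Omega> \<T>" and \<xi>: "square_integrable (surface_on \<Gamma>) \<xi>"
  shows "integrable (surface_on \<Gamma>) (\<lambda>x. h_Gamma \<T> \<Gamma> x * (norm (\<xi> x))\<^sup>2)"
    and "0 \<le> h_Gamma \<T> \<Gamma> x"
proof -
  have diam: "0 \<le> diameter F" if F: "F \<in> facets_on \<T> \<Gamma>" for F
  proof -
    have "bounded (adjacent_element \<T> F)"
      using adjacent_element(1)[OF F] mesh compact_simplex compact_imp_bounded
      unfolding simplicial_mesh_def by blast
    then have "bounded F" using facet_of_imp_subset[OF adjacent_element(2)[OF F]] bounded_subset by blast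
    then show ?thesis by (rule diameter_ge_0)
  qed
  then show nonneg: "0 \<le> h_Gamma \<T> \<Gamma> x" for x unfolding h_Gamma_def by (intro sum_nonneg) simp
  let ?H = "\<Sum>F\<in>facets_on \<T> \<Gamma>. diameter F"
  have le: "h_Gamma \<T> \<Gamma> x \<le> ?H" for x
    unfolding h_Gamma_def using diam by (intro sum_mono) (auto simp: indicator_def)
  have hm: "h_Gamma \<T> \<Gamma> \<in> borel_measurable (surface_on \<Gamma>)"
    unfolding h_Gamma_def[abs_def] using borel_rel_interior
    by (intro borel_measurable_surface_on borel_measurable_sum borel_measurable_times
        borel_measurable_indicator borel_measurable_const) auto
  have \<xi>m: "\<xi> \<in> borel_measurable (surface_on \<Gamma>)" and \<xi>i: "integrable (surface_on \<Gamma>) (\<lambda>x. (norm (\<xi> x))\<^sup>2)"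
    using \<xi> by (auto simp: square_integrable_def)
  show "integrable (surface_on \<Gamma>) (\<lambda>x. h_Gamma \<T> \<Gamma> x * (norm (\<xi> x))\<^sup>2)"
  proof (rule Bochner_Integration.integrable_bound)
    show "integrable (surface_on \<Gamma>) (\<lambda>x. ?H * (norm (\<xi> x))\<^sup>2)" using \<xi>i by simp
    show "(\<lambda>x. h_Gamma \<T> \<Gamma> x * (norm (\<xi> x))\<^sup>2) \<in> borel_measurable (surface_on \<Gamma>)"
      using hm \<xi>m by measurable
    show "AE x in surface_on \<Gamma>. norm (h_Gamma \<T> \<Gamma> x * (norm (\<xi> x))\<^sup>2) \<le> norm (?H * (norm (\<xi> x))\<^sup>2)"
    proof (rule AE_I2)
      fix x
      have "h_Gamma \<T> \<Gamma> x * (norm (\<xi> x))\<^sup>2 \<le> ?H * (norm (\<xi> x))\<^sup>2" using le by (intro mult_right_mono) auto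
      then show "norm (h_Gamma \<T> \<Gamma> x * (norm (\<xi> x))\<^sup>2) \<le> norm (?H * (norm (\<xi> x))\<^sup>2)"
        using nonneg[of x] order_trans[OF nonneg le] by (simp add: abs_mult)
    qed
  qed
qed

text \<open>The integrability assumptions allow the stabilization term to be split; the multiplier terms cancel
for every multiplier and every jump.\<close>

lemma Bh_form_diagonal:
  assumes int_\<xi>: "integrable (surface_on (interface \<Omega>1 \<Omega>2)) (\<lambda>x. h_Gamma \<T> (interface \<Omega>1 \<Omega>2) x * (norm (\<xi> x))\<^sup>2)"
    and int_s: "integrable (surface_on (interface \<Omega>1 \<Omega>2)) (\<lambda>x. h_Gamma \<T> (interface \<Omega>1 \<Omega>2) x *
          (norm (normal_stress k E \<nu> \<T> (interface \<Omega>1 \<Omega>2) n (fst w) x))\<^sup>2)"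
  shows "Bh_form \<alpha> k E \<nu> \<Omega>1 \<Omega>2 n \<T> w \<xi> w (\<lambda>x. - \<xi> x)
    = elastic_form E \<nu> \<Omega>1 (fst w) (fst w) + elastic_form E \<nu> \<Omega>2 (snd w) (snd w)
      + \<alpha> * (LINT x|surface_on (interface \<Omega>1 \<Omega>2). h_Gamma \<T> (interface \<Omega>1 \<Omega>2) x * (norm (\<xi> x))\<^sup>2)
      - \<alpha> * (LINT x|surface_on (interface \<Omega>1 \<Omega>2). h_Gamma \<T> (interface \<Omega>1 \<Omega>2) x *
          (norm (normal_stress k E \<nu> \<T> (interface \<Omega>1 \<Omega>2) n (fst w) x))\<^sup>2)"
proof -
  let ?\<Gamma> = "interface \<Omega>1 \<Omega>2"
  let ?h = "h_Gamma \<T> ?\<Gamma>"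
  let ?s = "normal_stress k E \<nu> \<T> ?\<Gamma> n (fst w)"
  have "(?h x *\<^sub>R (\<xi> x + ?s x)) \<bullet> (- \<xi> x + ?s x) = ?h x * (norm (?s x))\<^sup>2 - ?h x * (norm (\<xi> x))\<^sup>2" for x
    by (simp add: power2_norm_eq_inner algebra_simps inner_commute)
  then have "l2_inner (surface_on ?\<Gamma>) (\<lambda>x. ?h x *\<^sub>R (\<xi> x + ?s x)) (\<lambda>x. - \<xi> x + ?s x)
      = (LINT x|surface_on ?\<Gamma>. ?h x * (norm (?s x))\<^sup>2) - (LINT x|surface_on ?\<Gamma>. ?h x * (norm (\<xi> x))\<^sup>2)"
    unfolding l2_inner_def using int_\<xi> int_s by simp
  moreover have "L2_functional ?\<Gamma> (\<lambda>x. - \<xi> x) g = - L2_functional ?\<Gamma> \<xi> g" for g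
    by (simp add: L2_functional_def l2_inner_def)
  ultimately show ?thesis
    by (simp add: Bh_form_def B_form_def Let_def right_diff_distrib)
qed

lemma mesh_norm_square:
  assumes "0 \<le> elastic_form E \<nu> \<Omega>1 (fst w) (fst w)" "0 \<le> elastic_form E \<nu> \<Omega>2 (snd w) (snd w)"
    and h: "\<And>x. 0 \<le> h_Gamma \<T> (interface \<Omega>1 \<Omega>2) x"
  shows "(mesh_norm E \<nu> \<Omega>1 \<Omega>2 \<T> w \<xi>)\<^sup>2
    = elastic_form E \<nu> \<Omega>1 (fst w) (fst w) + elastic_form E \<nu> \<Omega>2 (snd w) (snd w)
      + (LINT x|surface_on (interface \<Omega>1 \<Omega>2). h_Gamma \<T> (interface \<Omega>1 \<Omega>2) x * (norm (\<xi> x))\<^sup>2)"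
proof -
  let ?I = "LINT x|surface_on (interface \<Omega>1 \<Omega>2). h_Gamma \<T> (interface \<Omega>1 \<Omega>2) x * (norm (\<xi> x))\<^sup>2"
  have "0 \<le> ?I" using h by (intro Bochner_Integration.integral_nonneg) simp
  then have "(l2_norm (surface_on (interface \<Omega>1 \<Omega>2)) (\<lambda>x. sqrt (h_Gamma \<T> (interface \<Omega>1 \<Omega>2) x) *\<^sub>R \<xi> x))\<^sup>2 = ?I"
    using h by (simp add: l2_norm_def power_mult_distrib)
  then show ?thesis using assms \<open>0 \<le> ?I\<close> by (simp add: mesh_norm_def energy_norm_def Let_def)
qed

theorem theorem1:
  fixes \<Omega> \<Omega>1 \<Omega>2 \<Gamma>D1 \<Gamma>D2 \<Gamma>N1 \<Gamma>N2 :: "(real^'n) set"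
    and n :: "real^'n \<Rightarrow> real^'n"
    and E \<nu> :: real and k l :: nat
    and \<T>1 \<T>2 :: "'h \<Rightarrow> (real^'n) set set"
  assumes "CARD('n) \<in> {2, 3}"
    and "split_domain \<Omega> \<Omega>1 \<Omega>2"
    and "boundary_split \<Omega>1 \<Gamma>D1 \<Gamma>N1 (interface \<Omega>1 \<Omega>2)"
    and "boundary_split \<Omega>2 \<Gamma>D2 \<Gamma>N2 (interface \<Omega>1 \<Omega>2)"
    and "unit_normal_field \<Omega>1 (interface \<Omega>1 \<Omega>2) n"
    and "E > 0" and "-1 < \<nu>" and "\<nu> < 1/2"
    and "k \<ge> 1"
    and "\<And>h. simplicial_mesh \<Omega>1 (\<T>1 h)" and "\<And>h. simplicial_mesh \<Omega>2 (\<T>2 h)"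
    and "\<And>h. fitted_to (interface \<Omega>1 \<Omega>2) (\<T>1 h)"
    and "shape_regular \<T>1" and "shape_regular \<T>2"
  shows "\<exists>\<alpha>0>0. \<forall>\<alpha>. 0 < \<alpha> \<and> \<alpha> < \<alpha>0 \<longrightarrow>
           (\<exists>C>0. \<forall>h.
              \<forall>w \<in> Vh_space k \<Omega>1 \<Gamma>D1 (\<T>1 h) \<times> Vh_space k \<Omega>2 \<Gamma>D2 (\<T>2 h).
              \<forall>\<xi> \<in> Lambdah_space l \<Omega>1 (interface \<Omega>1 \<Omega>2) (\<T>1 h).
                Bh_form \<alpha> k E \<nu> \<Omega>1 \<Omega>2 n (\<T>1 h) w \<xi> w (\<lambda>x. - \<xi> x)
                  \<ge> C * (mesh_norm E \<nu> \<Omega>1 \<Omega>2 (\<T>1 h) w \<xi>)\<^sup>2)"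
proof -
  let ?\<Gamma> = "interface \<Omega>1 \<Omega>2"
  have card: "CARD('n) \<ge> 2" using assms(1) by auto
  have poly: "polyhedral_domain \<Omega>1" using assms(2) by (simp add: split_domain_def)
  have \<Gamma>: "?\<Gamma> \<in> sets borel" by (simp add: interface_def borel_closed closed_Int)
  have n: "n \<in> borel_measurable (surface_on ?\<Gamma>)" "AE x in surface_on ?\<Gamma>. norm (n x) = 1"
    using assms(5) by (auto simp: unit_normal_field_def intro: outer_unit_normal_norm)
  obtain \<kappa> where \<kappa>: "\<kappa> > 0" "\<And>h T. T \<in> \<T>1 h \<Longrightarrow> diameter T \<le> \<kappa> * inradius T"
    using assms(13) by (auto simp: shape_regular_def)
  obtain CI where CI: "CI > 0" and trace_ineq: "\<And>\<T> \<Gamma>D w. simplicial_mesh \<Omega>1 \<T> \<Longrightarrow>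
      (\<forall>T\<in>\<T>. diameter T \<le> \<kappa> * inradius T) \<Longrightarrow> w \<in> Vh_space k \<Omega>1 \<Gamma>D \<T> \<Longrightarrow>
      integrable (surface_on ?\<Gamma>) (\<lambda>x. h_Gamma \<T> ?\<Gamma> x * (norm (normal_stress k E \<nu> \<T> ?\<Gamma> n w x))\<^sup>2) \<and>
      (LINT x|surface_on ?\<Gamma>. h_Gamma \<T> ?\<Gamma> x * (norm (normal_stress k E \<nu> \<T> ?\<Gamma> n w x))\<^sup>2)
        \<le> CI * (LINT x|lebesgue_on \<Omega>1. (norm (strain (weak_grad \<Omega>1 w x)))\<^sup>2)"
    using discrete_trace_inequality[OF card poly \<Gamma> n \<kappa>(1), of k E \<nu>] by blast
  obtain c where c: "c > 0" and coercive: "\<And>\<Omega> w. w \<in> H1 (\<Omega> :: (real^'n) set) \<Longrightarrow>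
      c * (LINT x|lebesgue_on \<Omega>. (norm (strain (weak_grad \<Omega> w x)))\<^sup>2) \<le> elastic_form E \<nu> \<Omega> w w"
    using elastic_form_coercive[OF assms(1,6,7,8)] by blast
  show ?thesis
  proof (rule exI[of _ "c / CI"], intro conjI allI impI)
    show "0 < c / CI" using c CI by simp
    fix \<alpha> assume \<alpha>: "0 < \<alpha> \<and> \<alpha> < c / CI"
    \<comment> \<open>The fraction of the energy of the first component that the negative term can consume.\<close>
    define \<beta> where "\<beta> = \<alpha> * CI / c"
    have \<beta>: "\<beta> < 1" using \<alpha> c CI by (simp add: \<beta>_def field_simps)
    show "\<exists>C>0. \<forall>h.
              \<forall>w \<in> Vh_space k \<Omega>1 \<Gamma>D1 (\<T>1 h) \<times> Vh_space k \<Omega>2 \<Gamma>D2 (\<T>2 h).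
              \<forall>\<xi> \<in> Lambdah_space l \<Omega>1 ?\<Gamma> (\<T>1 h).
                Bh_form \<alpha> k E \<nu> \<Omega>1 \<Omega>2 n (\<T>1 h) w \<xi> w (\<lambda>x. - \<xi> x)
                  \<ge> C * (mesh_norm E \<nu> \<Omega>1 \<Omega>2 (\<T>1 h) w \<xi>)\<^sup>2"
    proof (intro exI[of _ "min \<alpha> (1 - \<beta>)"] conjI allI ballI)
      show "0 < min \<alpha> (1 - \<beta>)" using \<alpha> \<beta> by simp
      fix h w \<xi>
      assume w: "w \<in> Vh_space k \<Omega>1 \<Gamma>D1 (\<T>1 h) \<times> Vh_space k \<Omega>2 \<Gamma>D2 (\<T>2 h)"
        and \<xi>: "\<xi> \<in> Lambdah_space l \<Omega>1 ?\<Gamma> (\<T>1 h)"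
      let ?h = "h_Gamma (\<T>1 h) ?\<Gamma>"
      define e1 where "e1 = elastic_form E \<nu> \<Omega>1 (fst w) (fst w)"
      define e2 where "e2 = elastic_form E \<nu> \<Omega>2 (snd w) (snd w)"
      define X where "X = (LINT x|surface_on ?\<Gamma>. ?h x * (norm (\<xi> x))\<^sup>2)"
      define Y where "Y = (LINT x|surface_on ?\<Gamma>. ?h x * (norm (normal_stress k E \<nu> (\<T>1 h) ?\<Gamma> n (fst w) x))\<^sup>2)"
      define S where "S = (LINT x|lebesgue_on \<Omega>1. (norm (strain (weak_grad \<Omega>1 (fst w) x)))\<^sup>2)"
      have wV: "fst w \<in> Vh_space k \<Omega>1 \<Gamma>D1 (\<T>1 h)" and wH: "fst w \<in> H1 \<Omega>1" "snd w \<in> H1 \<Omega>2"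
        using w by (auto simp: Vh_space_def V_space_def)
      have \<xi>2: "square_integrable (surface_on ?\<Gamma>) \<xi>" using \<xi> by (simp add: Lambdah_space_def)
      note h\<xi> = integrable_h_Gamma_mult[OF assms(10) \<xi>2]
      have Y: "integrable (surface_on ?\<Gamma>) (\<lambda>x. ?h x * (norm (normal_stress k E \<nu> (\<T>1 h) ?\<Gamma> n (fst w) x))\<^sup>2)"
          "Y \<le> CI * S"
        using trace_ineq[OF assms(10) _ wV] \<kappa>(2) by (auto simp: Y_def S_def)
      have e1: "c * S \<le> e1" using coercive[OF wH(1)] by (simp add: e1_def S_def)
      have "0 \<le> c * S" using c unfolding S_def
        by (intro mult_nonneg_nonneg Bochner_Integration.integral_nonneg) auto
      then have e1_0: "0 \<le> e1" using e1 by linarith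
      have "0 \<le> c * (LINT x|lebesgue_on \<Omega>2. (norm (strain (weak_grad \<Omega>2 (snd w) x)))\<^sup>2)"
        using c by (intro mult_nonneg_nonneg Bochner_Integration.integral_nonneg) auto
      then have e2_0: "0 \<le> e2" using coercive[OF wH(2)] by (simp add: e2_def)
      have X0: "0 \<le> X" unfolding X_def using h\<xi>(2) by (intro Bochner_Integration.integral_nonneg) simp
      have "\<alpha> * Y \<le> \<alpha> * (CI * S)" using Y(2) \<alpha> by (intro mult_left_mono) auto
      also have "\<dots> = \<beta> * (c * S)" using c by (simp add: \<beta>_def)
      also have "\<dots> \<le> \<beta> * e1" using e1 \<alpha> c CI by (intro mult_left_mono) (auto simp: \<beta>_def)
      finally have Y_le: "\<alpha> * Y \<le> \<beta> * e1" .
      have "min \<alpha> (1 - \<beta>) * e1 \<le> (1 - \<beta>) * e1" using e1_0 by (intro mult_right_mono) auto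
      moreover have "min \<alpha> (1 - \<beta>) * e2 \<le> 1 * e2"
        using e2_0 \<alpha> c CI by (intro mult_right_mono) (auto simp: \<beta>_def min_le_iff_disj)
      moreover have "min \<alpha> (1 - \<beta>) * X \<le> \<alpha> * X" using X0 by (intro mult_right_mono) auto
      ultimately have "min \<alpha> (1 - \<beta>) * (e1 + e2 + X) \<le> e1 + e2 + \<alpha> * X - \<alpha> * Y"
        using Y_le by (simp add: algebra_simps)
      moreover have "Bh_form \<alpha> k E \<nu> \<Omega>1 \<Omega>2 n (\<T>1 h) w \<xi> w (\<lambda>x. - \<xi> x) = e1 + e2 + \<alpha> * X - \<alpha> * Y"
        using Bh_form_diagonal[OF h\<xi>(1) Y(1)] by (simp add: e1_def e2_def X_def Y_def)
      moreover have "(mesh_norm E \<nu> \<Omega>1 \<Omega>2 (\<T>1 h) w \<xi>)\<^sup>2 = e1 + e2 + X"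
        using mesh_norm_square[of E \<nu> \<Omega>1 w \<Omega>2 "\<T>1 h" \<xi>] e1_0 e2_0 h\<xi>(2) by (simp add: e1_def e2_def X_def)
      ultimately show "Bh_form \<alpha> k E \<nu> \<Omega>1 \<Omega>2 n (\<T>1 h) w \<xi> w (\<lambda>x. - \<xi> x)
                  \<ge> min \<alpha> (1 - \<beta>) * (mesh_norm E \<nu> \<Omega>1 \<Omega>2 (\<T>1 h) w \<xi>)\<^sup>2"
        by simp
    qed
  qed
qed

end
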